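(* Let $p$ be a fixed prime and let $G$ be a group of inertia type. Let $\ell\neq p$ be a prime number. Let $K$ be a complete discrete valuation field of characteristic zero and residue characteristic $\ell$, and let $e=e(K)$. Suppose $V$ is a $2d$-dimensional $K$-vector space which is a symplectic $K[G]$-module, and suppose $\ell>de+1$. Then there exist a $G$-stable $\mathcal{O}_K$-lattice $T$ in $V$ and a perfect alternating $G$-invariant bilinear form $f':T\times T\to\mathcal{O}_K$.
   Context: A group $G$ is of inertia type if it is finite and has a normal $p$-subgroup $H$ with $G/H$ cyclic of order prime to $p$. For a discrete valuation field $K$ of residue characteristic $\ell$ with valuation $v$ normalized by $v(K^\times)=\mathbf{Z}$, $\mathcal{O}_K$ is its valuation ring and $e(K)=v(\ell)$. A $K[G]$-module $V$ is symplectic if there is a nondegenerate $G$-invariant alternating bilinear form $V\times V\to K$. A bilinear form $f:T\times T\to\mathcal{O}_K$ on a free $\mathcal{O}_K$-module is perfect if the induced maps $T\to\mathrm{Hom}(T,\mathcal{O}_K)$ (on either side) are bijective. *)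

theory Defs
  imports
    Complex_Main
    "HOL-Computational_Algebra.Primes"
    "HOL-Algebra.Elementary_Groups"
    "HOL-Algebra.Group_Action"
begin

definition inertia_type :: "nat \<Rightarrow> ('g, 'm) monoid_scheme \<Rightarrow> bool" where
  "inertia_type p G \<longleftrightarrow>
     group G \<and> finite (carrier G) \<and>
     (\<exists>H. H \<lhd> G \<and> (\<exists>n. card H = p ^ n) \<and>
          cyclic_group (G Mod H) \<and> coprime (order (G Mod H)) p)"


text \<open>Valuations are integer-valued and only their values on nonzero elements are meaningful:
  \<^term>\<open>v 0\<close> is unconstrained, and zero is treated separately (as having infinite valuation)
  throughout.\<close>

locale discrete_valuation =
  fixes v :: "'k::field \<Rightarrow> int"
  assumes mult: "x \<noteq> 0 \<Longrightarrow> y \<noteq> 0 \<Longrightarrow> v (x * y) = v x + v y"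
    and add: "x \<noteq> 0 \<Longrightarrow> y \<noteq> 0 \<Longrightarrow> x + y \<noteq> 0 \<Longrightarrow> v (x + y) \<ge> min (v x) (v y)"
    and normalized: "v ` (UNIV - {0}) = UNIV"

definition val_ge :: "('k::field \<Rightarrow> int) \<Rightarrow> int \<Rightarrow> 'k set" where
  "val_ge v n = {x. x = 0 \<or> v x \<ge> n}"

definition val_ring :: "('k::field \<Rightarrow> int) \<Rightarrow> 'k set" where
  "val_ring v = val_ge v 0"

definition val_max_ideal :: "('k::field \<Rightarrow> int) \<Rightarrow> 'k set" where
  "val_max_ideal v = val_ge v 1"

definition val_Cauchy :: "('k::field \<Rightarrow> int) \<Rightarrow> (nat \<Rightarrow> 'k) \<Rightarrow> bool" where
  "val_Cauchy v s \<longleftrightarrow> (\<forall>N. \<exists>M. \<forall>m\<ge>M. \<forall>n\<ge>M. s m - s n \<in> val_ge v N)"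

definition val_tendsto :: "('k::field \<Rightarrow> int) \<Rightarrow> (nat \<Rightarrow> 'k) \<Rightarrow> 'k \<Rightarrow> bool" where
  "val_tendsto v s a \<longleftrightarrow> (\<forall>N. \<exists>M. \<forall>n\<ge>M. s n - a \<in> val_ge v N)"

locale complete_discrete_valuation = discrete_valuation +
  assumes complete: "val_Cauchy v s \<Longrightarrow> \<exists>a. val_tendsto v s a"

text \<open>The characteristic of the residue field, i.e. of the quotient of the valuation ring by its
  maximal ideal, spelled out as in the definition of \<^const>\<open>semiring_char\<close>: a natural number
  vanishes in the residue field iff it lies in the maximal ideal.\<close>

definition residue_char :: "('k::field \<Rightarrow> int) \<Rightarrow> nat" where
  "residue_char v = Gcd {n. of_nat n \<in> val_max_ideal v}"

definition abs_ramification_index :: "('k::field \<Rightarrow> int) \<Rightarrow> int" where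
  "abs_ramification_index v = v (of_nat (residue_char v))"


text \<open>A \<open>K[G]\<close>-module is a \<open>K\<close>-vector space (a whole type with scalar multiplication
  \<open>scale\<close>) together with an action \<open>\<rho>\<close> of \<open>G\<close> by \<open>K\<close>-linear maps.\<close>

definition group_rep ::
  "('g, 'm) monoid_scheme \<Rightarrow> ('k::field \<Rightarrow> 'v::ab_group_add \<Rightarrow> 'v) \<Rightarrow> ('g \<Rightarrow> 'v \<Rightarrow> 'v) \<Rightarrow> bool" where
  "group_rep G scale \<rho> \<longleftrightarrow>
     group_action G UNIV \<rho> \<and>
     (\<forall>g\<in>carrier G. Vector_Spaces.linear scale scale (\<rho> g))"

definition bilinear_form :: "('k::field \<Rightarrow> 'v::ab_group_add \<Rightarrow> 'v) \<Rightarrow> ('v \<Rightarrow> 'v \<Rightarrow> 'k) \<Rightarrow> bool" where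
  "bilinear_form scale f \<longleftrightarrow>
     (\<forall>x. Vector_Spaces.linear scale (*) (\<lambda>y. f x y)) \<and>
     (\<forall>y. Vector_Spaces.linear scale (*) (\<lambda>x. f x y))"

definition nondegenerate_form :: "('v::ab_group_add \<Rightarrow> 'v \<Rightarrow> 'k::field) \<Rightarrow> bool" where
  "nondegenerate_form f \<longleftrightarrow>
     (\<forall>x. (\<forall>y. f x y = 0) \<longrightarrow> x = 0) \<and> (\<forall>y. (\<forall>x. f x y = 0) \<longrightarrow> y = 0)"

definition alternating_on :: "'v set \<Rightarrow> ('v \<Rightarrow> 'v \<Rightarrow> 'k::zero) \<Rightarrow> bool" where
  "alternating_on T f \<longleftrightarrow> (\<forall>x\<in>T. f x x = 0)"

definition invariant_form_on ::
  "('g, 'm) monoid_scheme \<Rightarrow> ('g \<Rightarrow> 'v \<Rightarrow> 'v) \<Rightarrow> 'v set \<Rightarrow> ('v \<Rightarrow> 'v \<Rightarrow> 'k) \<Rightarrow> bool" where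
  "invariant_form_on G \<rho> T f \<longleftrightarrow>
     (\<forall>g\<in>carrier G. \<forall>x\<in>T. \<forall>y\<in>T. f (\<rho> g x) (\<rho> g y) = f x y)"

definition symplectic_rep ::
  "('g, 'm) monoid_scheme \<Rightarrow> ('k::field \<Rightarrow> 'v::ab_group_add \<Rightarrow> 'v) \<Rightarrow> ('g \<Rightarrow> 'v \<Rightarrow> 'v) \<Rightarrow> bool" where
  "symplectic_rep G scale \<rho> \<longleftrightarrow>
     group_rep G scale \<rho> \<and>
     (\<exists>f. bilinear_form scale f \<and> nondegenerate_form f \<and>
          alternating_on UNIV f \<and> invariant_form_on G \<rho> UNIV f)"


text \<open>A lattice is the module over the valuation ring spanned by a finite \<open>K\<close>-basis of \<open>V\<close>; it is
  thus free over the valuation ring, of rank the dimension of \<open>V\<close>.\<close>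

definition val_lattice ::
  "('k::field \<Rightarrow> int) \<Rightarrow> ('k \<Rightarrow> 'v::ab_group_add \<Rightarrow> 'v) \<Rightarrow> 'v set \<Rightarrow> bool" where
  "val_lattice v scale T \<longleftrightarrow>
     (\<exists>B. finite_dimensional_vector_space scale B \<and>
          T = {\<Sum>b\<in>B. scale (c b) b | c. \<forall>b\<in>B. c b \<in> val_ring v})"

definition stable_under ::
  "('g, 'm) monoid_scheme \<Rightarrow> ('g \<Rightarrow> 'v \<Rightarrow> 'v) \<Rightarrow> 'v set \<Rightarrow> bool" where
  "stable_under G \<rho> T \<longleftrightarrow> (\<forall>g\<in>carrier G. \<forall>x\<in>T. \<rho> g x \<in> T)"

text \<open>The module of linear maps from \<open>T\<close> to the valuation ring; its elements are extensional
  functions on \<open>T\<close>, so that equality is equality as maps on \<open>T\<close>. Likewise, a form on \<open>T\<close> is a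
  function on the whole type of which only the values on \<open>T\<close> matter.\<close>

definition val_dual ::
  "('k::field \<Rightarrow> int) \<Rightarrow> ('k \<Rightarrow> 'v::ab_group_add \<Rightarrow> 'v) \<Rightarrow> 'v set \<Rightarrow> ('v \<Rightarrow> 'k) set" where
  "val_dual v scale T =
     {\<phi> \<in> T \<rightarrow>\<^sub>E val_ring v.
        (\<forall>x\<in>T. \<forall>y\<in>T. \<phi> (x + y) = \<phi> x + \<phi> y) \<and>
        (\<forall>a\<in>val_ring v. \<forall>x\<in>T. \<phi> (scale a x) = a * \<phi> x)}"

definition val_bilinear_form_on ::
  "('k::field \<Rightarrow> int) \<Rightarrow> ('k \<Rightarrow> 'v::ab_group_add \<Rightarrow> 'v) \<Rightarrow> 'v set \<Rightarrow> ('v \<Rightarrow> 'v \<Rightarrow> 'k) \<Rightarrow> bool" where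
  "val_bilinear_form_on v scale T f \<longleftrightarrow>
     (\<forall>x\<in>T. (\<lambda>y\<in>T. f x y) \<in> val_dual v scale T) \<and>
     (\<forall>y\<in>T. (\<lambda>x\<in>T. f x y) \<in> val_dual v scale T)"

definition perfect_form_on ::
  "('k::field \<Rightarrow> int) \<Rightarrow> ('k \<Rightarrow> 'v::ab_group_add \<Rightarrow> 'v) \<Rightarrow> 'v set \<Rightarrow> ('v \<Rightarrow> 'v \<Rightarrow> 'k) \<Rightarrow> bool" where
  "perfect_form_on v scale T f \<longleftrightarrow>
     val_bilinear_form_on v scale T f \<and>
     bij_betw (\<lambda>x. \<lambda>y\<in>T. f x y) T (val_dual v scale T) \<and>
     bij_betw (\<lambda>y. \<lambda>x\<in>T. f x y) T (val_dual v scale T)"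

end

theory Submission
  imports Defs "HOL-Algebra.Sylow" "HOL-Algebra.Multiplicative_Group"
    "Jordan_Normal_Form.Determinant" "HOL-Number_Theory.Cong"
begin

text \<open>Splitting \<open>V\<close> orthogonally, and trading an isotropic stable subspace \<open>X\<close> for a
  nondegenerate \<open>X + X'\<close>, reduces to \<open>V\<close> irreducible or to \<open>V\<close> on which the \<open>l\<close>-part \<open>t\<close> of \<open>G\<close> is
  trivial. An inertia type group consists of the products \<open>h t\<^sup>i\<close> with \<open>h\<close> in a normal subgroup \<open>H\<close> of
  order prime to \<open>l\<close>. Take a maximal stable lattice \<open>T\<close> on which \<open>f\<close> is integral, so that
  \<open>\<pi> T* \<subseteq> T \<subseteq> T*\<close> for the dual \<open>T*\<close>. If the projection of \<open>T / \<pi> T\<close> onto the radical \<open>\<pi> T* / \<pi> T\<close> lifts to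
  an equivariant \<open>P\<close>, then \<open>f(x, y) + \<pi>\<inverse> f(P x, P y)\<close> is perfect on \<open>T\<close>. Averaging over \<open>H\<close> gives such a \<open>P\<close>
  commuting with \<open>H\<close>, which settles trivial \<open>t\<close>.

  For irreducible \<open>V\<close> the cases \<open>T = T*\<close> and \<open>T = \<pi> T*\<close> are served by \<open>P = 0\<close> and \<open>P = 1\<close>. Otherwise \<open>P\<close>
  lifts to an idempotent, one of whose two images has dimension at most \<open>d\<close>. The bound
  \<open>l > d e + 1\<close> forces every operator of \<open>l\<close>-power order on a space of dimension at most \<open>d\<close> to be trivial:
  a nontrivial one makes \<open>l\<close> divisible by \<open>(t - 1)\<^bsup>l-1\<^esup>\<close> on some lattice, and there is no room for that. Applied
  to a norm of the compression of \<open>t\<close>, this makes \<open>t\<close> commute with \<open>H\<close>; then \<open>t - 1\<close> is a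
  uniformizer of the field \<open>K[t]\<close>, lattice chains of length at most \<open>2 d e\<close> leave no lattice strictly
  between \<open>T\<close> and \<open>(t - 1) T\<close>, and so \<open>T = T*\<close> after all.\<close>

section \<open>Polynomials in a linear operator\<close>

text \<open>Averaging over \<open>t\<close> is impossible on lattices, since the order of
  \<open>t\<close> is not a unit; it is harmless over \<open>K\<close>, where equivariant
  complements exist. So \<open>P\<close> commutes with \<open>H\<close> only, and the task is to
  recover \<open>t\<close>. As \<open>t\<close> preserves both \<open>T\<close> and the radical, it
  is triangular modulo the uniformizer with respect to the two images of the idempotent, so its
  compression \<open>s\<close> to either image is injective. But \<open>s\<close> need not have
  finite order, and it commutes with \<open>H\<close> only up to the twist given by conjugation with
  \<open>t\<close>. The norm supplies an \<open>n\<close> commuting with \<open>H\<close> such that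
  \<open>s ^^ m\<close> and \<open>n\<close> have the same \<open>l ^ k\<close>-th power; their
  quotient has \<open>l\<close>-power order, so it is trivial, and \<open>m < l\<close> leads from
  \<open>t ^^ m\<close> back to \<open>t\<close>.

  The bound on \<open>l\<close> is used twice. A nontrivial operator forces
  \<open>l - 1 \<le> e * dim\<close>, which is excluded in dimension at most \<open>d\<close>, the
  half that an idempotent or an isotropic subspace leaves. In dimension \<open>2 * d\<close> every
  step of the chain counts twice once an intermediate lattice exists, and
  \<open>2 * (l - 1) \<le> 2 * d * e\<close> is the same contradiction.\<close>

definition (in vector_space) poly_op :: "'a poly \<Rightarrow> ('b \<Rightarrow> 'b) \<Rightarrow> 'b \<Rightarrow> 'b" where
  "poly_op p g x = fold_coeffs (\<lambda>a y. scale a x + g y) p 0"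

lemma funpow_commute_on:
  assumes "\<And>x. x \<in> W \<Longrightarrow> f (g x) = g (f x)" "g ` W \<subseteq> W" "x \<in> W"
  shows "f ((g ^^ n) x) = (g ^^ n) (f x)"
  using assms(3)
proof (induction n arbitrary: x)
  case (Suc n)
  then show ?case using assms(1,2) by (simp add: funpow_swap1) (metis image_subset_iff)
qed simp

lemma funpow_image_subset: "g ` W \<subseteq> W \<Longrightarrow> (g ^^ n) ` W \<subseteq> W"
  by (induction n) auto

lemma funpow_fixes: "g x = x \<Longrightarrow> (g ^^ n) x = x"
  by (induction n) auto

lemma funpow_mult_fixes: "(g ^^ m) x = x \<Longrightarrow> (g ^^ (m * n)) x = x"
  by (simp add: funpow_fixes flip: funpow_mult)

context finite_dimensional_vector_space
begin

interpretation vsp: finite_dimensional_vector_space_pair scale Basis scale Basis ..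

lemma lin_I: "(\<And>x y. g (x + y) = g x + g y) \<Longrightarrow> (\<And>c x. g (scale c x) = scale c (g x)) \<Longrightarrow> Vector_Spaces.linear scale scale g"
  unfolding Vector_Spaces.linear_iff using vector_space_axioms by blast

context
  fixes g :: "'b \<Rightarrow> 'b"
  assumes g: "Vector_Spaces.linear scale scale g"
begin

lemma lin_funpow: "Vector_Spaces.linear scale scale (g ^^ n)"
  by (induction n) (auto intro!: lin_I simp: vsp.linear_add[OF g] vsp.linear_scale[OF g]
      vsp.linear_add vsp.linear_scale)

lemma poly_op_0: "poly_op 0 g x = 0"
  by (simp add: poly_op_def)

lemma poly_op_pCons: "poly_op (pCons a p) g x = scale a x + g (poly_op p g x)"
  by (cases "p = 0 \<and> a = 0") (auto simp: poly_op_def vsp.linear_0[OF g])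

lemma poly_op_add: "poly_op (p + q) g x = poly_op p g x + poly_op q g x"
proof (induction p arbitrary: q)
  case (pCons a p)
  then show ?case
    by (cases q) (simp_all add: poly_op_pCons poly_op_0 vsp.linear_add[OF g] vsp.linear_0[OF g] scale_left_distrib algebra_simps)
qed (simp add: poly_op_0)

lemma poly_op_smult: "poly_op (smult c p) g x = scale c (poly_op p g x)"
  by (induction p) (simp_all add: poly_op_pCons poly_op_0 vsp.linear_scale[OF g] scale_right_distrib)

lemma lin_poly_op: "Vector_Spaces.linear scale scale (poly_op p g)"
proof (induction p)
  case 0 show ?case by (rule lin_I) (auto simp: poly_op_0)
next
  case (pCons a p)
  show ?case
    by (rule lin_I) (simp_all add: poly_op_pCons vsp.linear_add[OF g] vsp.linear_scale[OF g]
      vsp.linear_add[OF pCons.IH] vsp.linear_scale[OF pCons.IH] scale_right_distrib mult.commute)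
qed

lemma poly_op_commute: "poly_op p g (g x) = g (poly_op p g x)"
  by (induction p) (simp_all add: poly_op_pCons poly_op_0 vsp.linear_add[OF g] vsp.linear_scale[OF g] vsp.linear_0[OF g])

lemma poly_op_mult: "poly_op (p * q) g x = poly_op p g (poly_op q g x)"
  by (induction p) (simp_all add: poly_op_pCons poly_op_0 poly_op_add poly_op_smult poly_op_commute vsp.linear_add[OF g])

lemma poly_op_1: "poly_op 1 g x = x"
  unfolding one_pCons by (simp add: poly_op_pCons poly_op_0 vsp.linear_0[OF g])

lemma poly_op_minus: "poly_op (- p) g x = - poly_op p g x"
  using poly_op_smult[of "-1" p x] by simp

lemma poly_op_diff: "poly_op (p - q) g x = poly_op p g x - poly_op q g x"
  using poly_op_add[of p "- q" x] poly_op_minus[of q x] by simp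

lemma poly_op_sum: "poly_op (sum F I) g x = (\<Sum>i\<in>I. poly_op (F i) g x)"
  by (induction I rule: infinite_finite_induct) (auto simp: poly_op_add poly_op_0)

lemma poly_op_power: "poly_op (p ^ n) g x = (poly_op p g ^^ n) x"
  by (induction n arbitrary: x) (simp_all add: poly_op_mult poly_op_1)

lemma poly_op_X_power: "poly_op ([:0, 1:] ^ n) g x = (g ^^ n) x"
proof -
  have "poly_op [:0, 1:] g = g" by (rule ext) (simp add: poly_op_pCons poly_op_0 vsp.linear_0[OF g])
  then show ?thesis by (simp add: poly_op_power)
qed

lemma poly_op_X_minus_1: "poly_op [:- 1, 1:] g = (\<lambda>x. g x - x)"
  by (rule ext) (simp add: poly_op_pCons poly_op_0 vsp.linear_0[OF g])

lemma poly_op_in_subspace: "subspace W \<Longrightarrow> g ` W \<subseteq> W \<Longrightarrow> x \<in> W \<Longrightarrow> poly_op p g x \<in> W"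
  by (induction p) (auto intro!: subspace_add subspace_scale simp: subspace_0 poly_op_pCons poly_op_0)

text \<open>Commutation is asked on \<open>W\<close> only: later \<open>h\<close> runs through
  operators that commute with \<open>g\<close> just on a minimal stable subspace.\<close>

lemma poly_op_commute_on:
  assumes "Vector_Spaces.linear scale scale h" "subspace W" "\<And>x. x \<in> W \<Longrightarrow> h (g x) = g (h x)" "g ` W \<subseteq> W" "x \<in> W"
  shows "h (poly_op p g x) = poly_op p g (h x)"
  using assms(5)
  by (induction p)
    (auto simp: poly_op_pCons poly_op_0 vsp.linear_add[OF assms(1)] vsp.linear_0[OF assms(1)] vsp.linear_scale[OF assms(1)] assms(3)
      poly_op_in_subspace[OF assms(2,4)])

end

end

section \<open>Lattices over a complete discrete valuation ring\<close>

context discrete_valuation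
begin

lemma v_one [simp]: "v 1 = 0"
  using mult[of 1 1] by simp

lemma v_minus_one [simp]: "v (- 1) = 0"
  using mult[of "-1" "-1"] by simp

lemma v_minus [simp]: "v (- x) = v x"
  using mult[of "-1" x] by (cases "x = 0") auto

lemma v_inverse: "x \<noteq> 0 \<Longrightarrow> v (inverse x) = - v x"
  using mult[of x "inverse x"] by simp

lemma v_divide: "x \<noteq> 0 \<Longrightarrow> y \<noteq> 0 \<Longrightarrow> v (x / y) = v x - v y"
  using mult[of x "inverse y"] v_inverse[of y] by (simp add: divide_inverse)

lemma v_power: "x \<noteq> 0 \<Longrightarrow> v (x ^ n) = int n * v x"
  by (induction n) (auto simp: mult algebra_simps)

lemma val_ge_0 [simp]: "0 \<in> val_ge v n"
  by (simp add: val_ge_def)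

lemma val_ge_add: "x \<in> val_ge v n \<Longrightarrow> y \<in> val_ge v n \<Longrightarrow> x + y \<in> val_ge v n"
  using add[of x y] by (cases "x = 0"; cases "y = 0"; cases "x + y = 0") (auto simp: val_ge_def)

lemma val_ge_minus: "x \<in> val_ge v n \<Longrightarrow> - x \<in> val_ge v n"
  by (auto simp: val_ge_def)

lemma val_ge_diff: "x \<in> val_ge v n \<Longrightarrow> y \<in> val_ge v n \<Longrightarrow> x - y \<in> val_ge v n"
  using val_ge_add[of x n "- y"] val_ge_minus[of y n] by simp

lemma val_ge_mult: "x \<in> val_ge v m \<Longrightarrow> y \<in> val_ge v n \<Longrightarrow> x * y \<in> val_ge v (m + n)"
  by (cases "x = 0"; cases "y = 0") (auto simp: val_ge_def mult)

lemma val_ge_mono: "m \<le> n \<Longrightarrow> val_ge v n \<subseteq> val_ge v m"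
  by (auto simp: val_ge_def)

abbreviation "\<O> \<equiv> val_ring v"

lemma O_0 [simp]: "0 \<in> \<O>"
  and O_1 [simp]: "1 \<in> \<O>"
  and O_add: "x \<in> \<O> \<Longrightarrow> y \<in> \<O> \<Longrightarrow> x + y \<in> \<O>"
  and O_minus: "x \<in> \<O> \<Longrightarrow> - x \<in> \<O>"
  and O_diff: "x \<in> \<O> \<Longrightarrow> y \<in> \<O> \<Longrightarrow> x - y \<in> \<O>"
  and O_mult: "x \<in> \<O> \<Longrightarrow> y \<in> \<O> \<Longrightarrow> x * y \<in> \<O>"
  unfolding val_ring_def
  using val_ge_mult[of x 0 y 0]
  by (auto intro: val_ge_add val_ge_minus val_ge_diff) (simp add: val_ge_def)

lemma O_iff: "x \<noteq> 0 \<Longrightarrow> x \<in> \<O> \<longleftrightarrow> v x \<ge> 0"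
  by (simp add: val_ring_def val_ge_def)

lemma O_power: "x \<in> \<O> \<Longrightarrow> x ^ n \<in> \<O>"
  by (induction n) (auto intro: O_mult)

lemma O_sum: "(\<And>i. i \<in> I \<Longrightarrow> g i \<in> \<O>) \<Longrightarrow> sum g I \<in> \<O>"
  by (induction I rule: infinite_finite_induct) (auto intro: O_add)

lemma O_of_nat [simp]: "of_nat n \<in> \<O>"
  by (induction n) (auto intro: O_add)

definition unif :: 'k where "unif = (SOME x. x \<noteq> 0 \<and> v x = 1)"

lemma unif: "unif \<noteq> 0" "v unif = 1"
proof -
  have "1 \<in> v ` (UNIV - {0})" using normalized by simp
  then have "\<exists>x. x \<noteq> 0 \<and> v x = 1" by auto
  then show "unif \<noteq> 0" "v unif = 1"
    unfolding unif_def by (metis (mono_tags, lifting) someI_ex)+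
qed

declare unif [simp]

lemma O_unif [simp]: "unif \<in> \<O>"
  by (simp add: O_iff)

lemma v_unif_power [simp]: "v (unif ^ n) = int n"
  by (simp add: v_power)

lemma val_ge_iff: "x \<in> val_ge v (int n) \<longleftrightarrow> (\<exists>a\<in>\<O>. x = unif ^ n * a)"
proof
  assume x: "x \<in> val_ge v (int n)"
  have "x / unif ^ n \<in> \<O>"
  proof (cases "x = 0")
    case False
    then have "v (x / unif ^ n) \<ge> 0" using x by (simp add: v_divide val_ge_def)
    with False show ?thesis by (subst O_iff) auto
  qed simp
  moreover have "x = unif ^ n * (x / unif ^ n)" by simp
  ultimately show "\<exists>a\<in>\<O>. x = unif ^ n * a" by blast
next
  assume "\<exists>a\<in>\<O>. x = unif ^ n * a"
  then obtain a where "a \<in> \<O>" "x = unif ^ n * a" by blast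
  then show "x \<in> val_ge v (int n)"
    by (cases "a = 0") (auto simp: val_ge_def O_iff mult)
qed

lemma scale_into_O: "\<exists>n. unif ^ n * x \<in> \<O>"
proof (cases "x = 0")
  case False
  then have "v (unif ^ nat (- v x) * x) \<ge> 0" by (subst mult) auto
  with False have "unif ^ nat (- v x) * x \<in> \<O>" by (subst O_iff) auto
  then show ?thesis ..
qed simp

lemma inter_val_ge: "(\<And>n. x \<in> val_ge v (int n)) \<Longrightarrow> x = 0"
proof (rule ccontr)
  assume *: "\<And>n. x \<in> val_ge v (int n)" and "x \<noteq> 0"
  from *[of "nat (v x + 1)"] \<open>x \<noteq> 0\<close> show False by (auto simp: val_ge_def split: if_splits)
qed

text \<open>A coefficient of least valuation divides all the others, which makes it a pivot for
  integral elimination in a linear relation.\<close>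

lemma exists_min_v:
  assumes "finite I" "i0 \<in> I" "c i0 \<noteq> 0"
  shows "\<exists>i\<in>I. c i \<noteq> 0 \<and> (\<forall>j\<in>I. c j / c i \<in> \<O>)"
proof -
  let ?J = "{i \<in> I. c i \<noteq> 0}"
  obtain i where i: "i \<in> ?J" "\<forall>j\<in>?J. v (c i) \<le> v (c j)"
    using arg_min_if_finite[of ?J "\<lambda>i. v (c i)"] assms by (auto simp: not_less)
  have "c j / c i \<in> \<O>" if "j \<in> I" for j
    using i that by (cases "c j = 0") (auto simp: O_iff v_divide)
  with i show ?thesis by auto
qed

end

section \<open>Submodules and finite spans over the valuation ring\<close>

locale val_space = finite_dimensional_vector_space scale Basis + complete_discrete_valuation v
  for scale :: "'k::field_char_0 \<Rightarrow> 'v::ab_group_add \<Rightarrow> 'v" (infixr \<open>*s\<close> 75)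
    and Basis :: "'v set" and v :: "'k \<Rightarrow> int"
begin

sublocale vsp: finite_dimensional_vector_space_pair scale Basis scale Basis ..

abbreviation "lin \<equiv> Vector_Spaces.linear scale scale"

definition osub :: "'v set \<Rightarrow> bool" where
  "osub X \<longleftrightarrow> 0 \<in> X \<and> (\<forall>x\<in>X. \<forall>y\<in>X. x + y \<in> X) \<and> (\<forall>c\<in>\<O>. \<forall>x\<in>X. c *s x \<in> X)"

text \<open>The sum runs over all of \<open>S\<close>, so this is the generated \<O>-module for
  finite \<open>S\<close> but the zero module for infinite \<open>S\<close>; hence the finiteness
  assumptions below.\<close>

definition ospan :: "'v set \<Rightarrow> 'v set" where
  "ospan S = {\<Sum>b\<in>S. c b *s b | c. \<forall>b\<in>S. c b \<in> \<O>}"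

lemma osub_0: "osub X \<Longrightarrow> 0 \<in> X"
  and osub_add: "osub X \<Longrightarrow> x \<in> X \<Longrightarrow> y \<in> X \<Longrightarrow> x + y \<in> X"
  and osub_scale: "osub X \<Longrightarrow> c \<in> \<O> \<Longrightarrow> x \<in> X \<Longrightarrow> c *s x \<in> X"
  by (auto simp: osub_def)

lemma osub_minus: "osub X \<Longrightarrow> x \<in> X \<Longrightarrow> - x \<in> X"
  using osub_scale[of X "- 1" x] O_minus[OF O_1] by simp

lemma osub_diff: "osub X \<Longrightarrow> x \<in> X \<Longrightarrow> y \<in> X \<Longrightarrow> x - y \<in> X"
  using osub_add[of X x "- y"] osub_minus[of X y] by simp

lemma osub_sum: "osub X \<Longrightarrow> (\<And>i. i \<in> I \<Longrightarrow> g i \<in> X) \<Longrightarrow> sum g I \<in> X"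
  by (induction I rule: infinite_finite_induct) (auto intro: osub_add osub_0)

lemma osub_subspace: "subspace X \<Longrightarrow> osub X"
  by (auto simp: osub_def subspace_def)

lemma osub_Int: "osub X \<Longrightarrow> osub Y \<Longrightarrow> osub (X \<inter> Y)"
  by (auto simp: osub_def)

lemma osub_plus:
  assumes "osub X" "osub Y"
  shows "osub {x + y | x y. x \<in> X \<and> y \<in> Y}"
  unfolding osub_def
proof (intro conjI ballI)
  show "0 \<in> {x + y | x y. x \<in> X \<and> y \<in> Y}"
    using assms[THEN osub_0] by (auto intro!: exI[of _ 0])
next
  fix x y assume "x \<in> {x + y | x y. x \<in> X \<and> y \<in> Y}" "y \<in> {x + y | x y. x \<in> X \<and> y \<in> Y}"
  then obtain a b c d where "x = a + b" "y = c + d" "a \<in> X" "b \<in> Y" "c \<in> X" "d \<in> Y" by auto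
  moreover from this have "x + y = (a + c) + (b + d)" by (simp add: algebra_simps)
  ultimately show "x + y \<in> {x + y | x y. x \<in> X \<and> y \<in> Y}"
    using assms osub_add by blast
next
  fix c x assume "c \<in> \<O>" "x \<in> {x + y | x y. x \<in> X \<and> y \<in> Y}"
  then obtain a b where "x = a + b" "a \<in> X" "b \<in> Y" by auto
  moreover from this have "c *s x = c *s a + c *s b" by (simp add: scale_right_distrib)
  ultimately show "c *s x \<in> {x + y | x y. x \<in> X \<and> y \<in> Y}"
    using assms osub_scale \<open>c \<in> \<O>\<close> by blast
qed

lemma osub_image:
  assumes g: "lin g" and X: "osub X"
  shows "osub (g ` X)"
  unfolding osub_def
proof (intro conjI ballI)
  show "0 \<in> g ` X" using osub_0[OF X] vsp.linear_0[OF g] by (metis imageI)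
next
  fix x y assume "x \<in> g ` X" "y \<in> g ` X"
  then obtain a b where ab: "x = g a" "y = g b" "a \<in> X" "b \<in> X" by blast
  then have "x + y = g (a + b)" using vsp.linear_add[OF g] by simp
  then show "x + y \<in> g ` X" using osub_add[OF X] ab by blast
next
  fix c x assume "c \<in> \<O>" "x \<in> g ` X"
  then obtain a where a: "x = g a" "a \<in> X" by blast
  then have "c *s x = g (c *s a)" using vsp.linear_scale[OF g] by simp
  then show "c *s x \<in> g ` X" using osub_scale[OF X \<open>c \<in> \<O>\<close>] a by blast
qed

lemma osub_ospan: "osub (ospan S)"
  unfolding osub_def
proof (intro conjI ballI)
  show "0 \<in> ospan S" unfolding ospan_def by (auto intro!: exI[of _ "\<lambda>_. 0"])
next
  fix x y assume "x \<in> ospan S" "y \<in> ospan S"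
  then obtain c d where "x = (\<Sum>b\<in>S. c b *s b)" "y = (\<Sum>b\<in>S. d b *s b)"
    "\<forall>b\<in>S. c b \<in> \<O>" "\<forall>b\<in>S. d b \<in> \<O>" unfolding ospan_def by blast
  then show "x + y \<in> ospan S" unfolding ospan_def
    by (auto intro!: exI[of _ "\<lambda>b. c b + d b"] O_add simp: scale_left_distrib sum.distrib)
next
  fix a x assume "a \<in> \<O>" "x \<in> ospan S"
  then obtain c where "x = (\<Sum>b\<in>S. c b *s b)" "\<forall>b\<in>S. c b \<in> \<O>" unfolding ospan_def by blast
  with \<open>a \<in> \<O>\<close> show "a *s x \<in> ospan S" unfolding ospan_def
    by (auto intro!: exI[of _ "\<lambda>b. a * c b"] O_mult simp: scale_sum_right)
qed

lemma ospan_least: "osub X \<Longrightarrow> S \<subseteq> X \<Longrightarrow> ospan S \<subseteq> X"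
  unfolding ospan_def by (auto intro!: osub_sum osub_scale)

lemma ospan_superset:
  assumes "finite S" shows "S \<subseteq> ospan S"
proof
  fix x assume "x \<in> S"
  have "x = (\<Sum>b\<in>S. (if b = x then 1 else 0) *s b)"
    using assms \<open>x \<in> S\<close> by (simp add: if_distrib[of "\<lambda>c. c *s _"] cong: if_cong)
  then show "x \<in> ospan S" unfolding ospan_def
    by (auto intro!: exI[of _ "\<lambda>b. if b = x then 1 else 0"])
qed

lemma ospan_mono: "finite T \<Longrightarrow> S \<subseteq> T \<Longrightarrow> ospan S \<subseteq> ospan T"
  using ospan_least[OF osub_ospan] ospan_superset by blast

lemma span_ospan: "finite S \<Longrightarrow> span (ospan S) = span S"
  using span_mono[OF ospan_superset]
    span_minimal[OF ospan_least[OF osub_subspace[OF subspace_span] span_superset] subspace_span]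
  by (intro equalityI)

lemma ospan_subset_span: "ospan S \<subseteq> span S"
  by (rule ospan_least[OF osub_subspace[OF subspace_span] span_superset])

lemma ospan_insert:
  assumes "finite S"
  shows "x \<in> ospan (insert b S) \<longleftrightarrow> (\<exists>c\<in>\<O>. \<exists>y\<in>ospan S. x = c *s b + y)"
proof
  have fin: "finite (insert b S)" using assms by simp
  assume "\<exists>c\<in>\<O>. \<exists>y\<in>ospan S. x = c *s b + y"
  then show "x \<in> ospan (insert b S)"
    by (elim bexE, hypsubst, intro osub_add osub_ospan osub_scale)
      (use ospan_superset[OF fin] ospan_mono[OF fin, of S] in auto)
next
  have "osub {x. \<exists>c\<in>\<O>. \<exists>y\<in>ospan S. x = c *s b + y}" (is "osub ?X")
    unfolding osub_def
  proof (safe)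
    show "\<exists>c\<in>\<O>. \<exists>y\<in>ospan S. 0 = c *s b + y"
      by (rule bexI[of _ 0], rule bexI[of _ 0]) (auto intro: osub_0[OF osub_ospan])
  next
    fix c y d z assume "c \<in> \<O>" "y \<in> ospan S" "d \<in> \<O>" "z \<in> ospan S"
    then show "\<exists>a\<in>\<O>. \<exists>w\<in>ospan S. c *s b + y + (d *s b + z) = a *s b + w"
      by (intro bexI[of _ "c + d"] bexI[of _ "y + z"])
        (auto intro: O_add osub_add[OF osub_ospan] simp: scale_left_distrib algebra_simps)
  next
    fix a c y assume "a \<in> \<O>" "c \<in> \<O>" "y \<in> ospan S"
    then show "\<exists>d\<in>\<O>. \<exists>w\<in>ospan S. a *s (c *s b + y) = d *s b + w"
      by (intro bexI[of _ "a * c"] bexI[of _ "a *s y"])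
        (auto intro: O_mult osub_scale[OF osub_ospan] simp: scale_right_distrib)
  qed
  moreover have "insert b S \<subseteq> ?X"
  proof -
    have "b = 1 *s b + 0" by simp
    then have "b \<in> ?X" using O_1 osub_0[OF osub_ospan] by blast
    moreover have "s \<in> ?X" if "s \<in> S" for s
    proof -
      have "s = 0 *s b + s" by simp
      then show ?thesis using that ospan_superset[OF assms] O_0 by blast
    qed
    ultimately show ?thesis by blast
  qed
  moreover assume "x \<in> ospan (insert b S)"
  ultimately show "\<exists>c\<in>\<O>. \<exists>y\<in>ospan S. x = c *s b + y"
    using ospan_least[of ?X "insert b S"] by blast
qed

text \<open>Induction on the generators: the coefficients of \<open>s\<close> in elements of
  \<open>X\<close> form an ideal, generated by one of least valuation. An element of
  \<open>X\<close> realizing it, together with generators of \<open>X \<inter> ospan S\<close>,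
  generates \<open>X\<close>.\<close>

lemma osub_finitely_generated:
  assumes "finite S" "osub X" "X \<subseteq> ospan S"
  shows "\<exists>S'. finite S' \<and> X = ospan S'"
  using assms
proof (induction S arbitrary: X rule: finite_induct)
  case empty
  then have "X = ospan {}" using osub_0[of X] by (auto simp: ospan_def)
  then show ?case by blast
next
  case (insert s S)
  let ?C = "{c \<in> \<O>. \<exists>y\<in>ospan S. c *s s + y \<in> X}"
  have dec: "\<exists>c\<in>?C. \<exists>y\<in>ospan S. x = c *s s + y" if "x \<in> X" for x
  proof -
    from that insert.prems(2) have "x \<in> ospan (insert s S)" by blast
    then obtain c y where "c \<in> \<O>" "y \<in> ospan S" "x = c *s s + y"
      unfolding ospan_insert[OF insert.hyps(1)] by blast
    with that show ?thesis by blast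
  qed
  have Xi: "osub (X \<inter> ospan S)" by (intro osub_Int insert.prems osub_ospan)
  obtain S0 where S0: "finite S0" "X \<inter> ospan S = ospan S0"
    using insert.IH[OF Xi] by blast
  show ?case
  proof (cases "\<forall>c\<in>?C. c = 0")
    case True
    then have "X \<subseteq> ospan S" using dec by fastforce
    then show ?thesis using S0 by (metis Int_absorb2)
  next
    case False
    then obtain c1 where c1: "c1 \<in> ?C" "c1 \<noteq> 0" by blast
    define n where "n = (LEAST n. \<exists>c\<in>?C. c \<noteq> 0 \<and> v c = int n)"
    have "\<exists>n. \<exists>c\<in>?C. c \<noteq> 0 \<and> v c = int n"
      using c1 by (intro exI[of _ "nat (v c1)"] bexI[of _ c1]) (auto simp: O_iff)
    then have "\<exists>c\<in>?C. c \<noteq> 0 \<and> v c = int n" unfolding n_def by (rule LeastI_ex)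
    then obtain c0 where c0: "c0 \<in> ?C" "c0 \<noteq> 0" "v c0 = int n" by blast
    have min: "c / c0 \<in> \<O>" if "c \<in> ?C" for c
    proof (cases "c = 0")
      case False
      have "n \<le> nat (v c)" unfolding n_def
        using that False by (intro Least_le bexI[of _ c]) (auto simp: O_iff)
      then show ?thesis using False c0 that by (auto simp: O_iff v_divide)
    qed simp
    obtain y0 where y0: "y0 \<in> ospan S" "c0 *s s + y0 \<in> X" using c0 by blast
    define x0 where "x0 = c0 *s s + y0"
    have "X = ospan (insert x0 S0)"
    proof
      show "X \<subseteq> ospan (insert x0 S0)"
      proof
        fix x assume x: "x \<in> X"
        then obtain c y where cy: "c \<in> ?C" "y \<in> ospan S" "x = c *s s + y" using dec by blast
        have "x - (c / c0) *s x0 \<in> X"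
          using x y0 min[OF cy(1)] insert.prems unfolding x0_def
          by (intro osub_diff osub_scale) auto
        moreover have "x - (c / c0) *s x0 = y - (c / c0) *s y0"
          using c0 by (simp add: cy(3) x0_def scale_right_distrib)
        moreover have "y - (c / c0) *s y0 \<in> ospan S"
          using y0 cy min by (intro osub_diff osub_scale osub_ospan) auto
        ultimately have "x - (c / c0) *s x0 \<in> ospan S0" using S0 by auto
        then show "x \<in> ospan (insert x0 S0)"
          unfolding ospan_insert[OF S0(1)] using min[OF cy(1)]
          by (intro bexI[of _ "c / c0"] bexI[of _ "x - (c / c0) *s x0"]) auto
      qed
      have "S0 \<subseteq> X" using S0 ospan_superset by blast
      then show "ospan (insert x0 S0) \<subseteq> X"
        using y0 insert.prems by (intro ospan_least) (auto simp: x0_def)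
    qed
    then show ?thesis using S0(1) by (intro exI[of _ "insert x0 S0"]) auto
  qed
qed

lemma ospan_basis_exists:
  assumes "finite S"
  shows "\<exists>B\<subseteq>S. independent B \<and> ospan B = ospan S"
  using assms
proof (induction "card S" arbitrary: S rule: less_induct)
  case less
  show ?case
  proof (cases "independent S")
    case False
    then obtain c where c: "(\<Sum>b\<in>S. c b *s b) = 0" "\<exists>b\<in>S. c b \<noteq> 0"
      using less.prems independent_explicit by blast
    then obtain b where b: "b \<in> S" "c b \<noteq> 0" "\<forall>j\<in>S. c j / c b \<in> \<O>"
      using exists_min_v[of S _ c] less.prems by blast
    have "c b *s b + (\<Sum>j\<in>S - {b}. c j *s j) = 0"
      using c(1) b(1) less.prems by (simp add: sum.remove)
    then have "inverse (c b) *s (c b *s b + (\<Sum>j\<in>S - {b}. c j *s j)) = 0" by simp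
    then have "b + (\<Sum>j\<in>S - {b}. (c j / c b) *s j) = 0"
      using b(2) by (simp add: scale_right_distrib scale_sum_right divide_inverse mult.commute)
    then have "b = - (\<Sum>j\<in>S - {b}. (c j / c b) *s j)" by (simp add: eq_neg_iff_add_eq_0)
    also have "\<dots> \<in> ospan (S - {b})"
      using b less.prems ospan_superset[of "S - {b}"]
      by (intro osub_minus osub_sum osub_scale osub_ospan) auto
    finally have "S \<subseteq> ospan (S - {b})" using ospan_superset[of "S - {b}"] less.prems by blast
    then have eq: "ospan (S - {b}) = ospan S"
      using ospan_mono[of S "S - {b}"] ospan_least[OF osub_ospan] less.prems by blast
    have "card (S - {b}) < card S" using b less.prems by (metis card_Diff1_less)
    from less.hyps[OF this] less.prems obtain B where "B \<subseteq> S - {b}" "independent B"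
      "ospan B = ospan (S - {b})" by auto
    then show ?thesis using eq by blast
  qed blast
qed

lemma scale_into_ospan:
  assumes "finite S" "x \<in> span S"
  shows "\<exists>n. unif ^ n *s x \<in> ospan S"
proof -
  have "subspace {x. \<exists>n. unif ^ n *s x \<in> ospan S}"
    unfolding subspace_def
    proof (safe)
      show "\<exists>n. unif ^ n *s 0 \<in> ospan S" by (simp add: osub_0[OF osub_ospan])
    next
      fix x y m n assume *: "unif ^ m *s x \<in> ospan S" "unif ^ n *s y \<in> ospan S"
      have "unif ^ n *s (unif ^ m *s x) + unif ^ m *s (unif ^ n *s y) \<in> ospan S"
        using *[THEN osub_scale[OF osub_ospan O_power[OF O_unif]]] osub_add[OF osub_ospan] by blast
      then have "unif ^ (m + n) *s (x + y) \<in> ospan S"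
        by (simp add: power_add scale_right_distrib mult.commute)
      then show "\<exists>n. unif ^ n *s (x + y) \<in> ospan S" ..
    next
      fix c x n assume *: "unif ^ n *s x \<in> ospan S"
      obtain m where "unif ^ m * c \<in> \<O>" using scale_into_O by blast
      then have "(unif ^ m * c) *s (unif ^ n *s x) \<in> ospan S"
        using * osub_scale[OF osub_ospan] by blast
      then have "unif ^ (m + n) *s (c *s x) \<in> ospan S"
        by (simp add: power_add mult.commute mult.left_commute)
      then show "\<exists>n. unif ^ n *s (c *s x) \<in> ospan S" ..
    qed
  moreover have "S \<subseteq> {x. \<exists>n. unif ^ n *s x \<in> ospan S}"
    using ospan_superset[OF assms(1)] by (auto intro!: exI[of _ 0])
  ultimately show ?thesis using span_minimal assms(2) by blast
qed

lemma lin_scale: "lin (scale c)"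
  by (rule lin_I) (auto simp: scale_right_distrib mult.commute)

lemma lin_ident: "lin (\<lambda>x. x)"
  by (rule lin_I) auto

lemma osub_vimage:
  assumes "lin g" "osub X"
  shows "osub {x. g x \<in> X}"
  using assms(2) unfolding osub_def
  by (auto simp: vsp.linear_add[OF assms(1)] vsp.linear_scale[OF assms(1)] vsp.linear_0[OF assms(1)])

lemma osub_scale_image: "osub X \<Longrightarrow> osub (scale c ` X)"
  by (rule osub_image[OF lin_scale])

lemma scale_image_subset: "osub X \<Longrightarrow> c \<in> \<O> \<Longrightarrow> scale c ` X \<subseteq> X"
  by (auto intro: osub_scale)

lemma scale_image_iff: "c \<noteq> 0 \<Longrightarrow> x \<in> scale c ` X \<longleftrightarrow> inverse c *s x \<in> X"
  by (metis (no_types, lifting) imageE image_eqI scale_one scale_scale left_inverse right_inverse)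

text \<open>\<open>\<mu> X\<close> plays the role of the length of \<open>ospan S / X\<close>.\<close>

lemma ospan_chain_measure:
  assumes "finite S"
  shows "\<exists>\<mu>::'v set \<Rightarrow> nat.
    (\<forall>X. osub X \<longrightarrow> scale (unif ^ e) ` ospan S \<subseteq> X \<longrightarrow> X \<subseteq> ospan S \<longrightarrow> \<mu> X \<le> e * card S) \<and>
    (\<forall>X Y. osub X \<longrightarrow> osub Y \<longrightarrow> scale (unif ^ e) ` ospan S \<subseteq> X \<longrightarrow> X \<subset> Y \<longrightarrow> Y \<subseteq> ospan S \<longrightarrow> \<mu> Y < \<mu> X)"
  using assms
proof (induction S rule: finite_induct)
  case empty
  have "ospan {} = {0}" by (auto simp: ospan_def)
  then show ?case by (intro exI[of _ "\<lambda>_. 0"]) (auto dest: osub_0)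
next
  case (insert s S)
  obtain \<mu> :: "'v set \<Rightarrow> nat" where
    \<mu>1: "\<And>X. osub X \<Longrightarrow> scale (unif ^ e) ` ospan S \<subseteq> X \<Longrightarrow> X \<subseteq> ospan S \<Longrightarrow> \<mu> X \<le> e * card S" and
    \<mu>2: "\<And>X Y. osub X \<Longrightarrow> osub Y \<Longrightarrow> scale (unif ^ e) ` ospan S \<subseteq> X \<Longrightarrow> X \<subset> Y \<Longrightarrow> Y \<subseteq> ospan S \<Longrightarrow> \<mu> Y < \<mu> X"
    using insert.IH by blast
  let ?T = "ospan (insert s S)"
  \<comment> \<open>\<open>I X\<close> will be the exponent of the ideal of
    \<open>s\<close>-coefficients of \<open>X\<close>, at most \<open>e\<close> because
    \<open>X\<close> contains \<open>unif ^ e *s s\<close>. Length is additive along the projection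
    to this coefficient, hence the measure \<open>I X + \<mu> (X \<inter> ospan S)\<close>.\<close>
  define Q where "Q X n \<longleftrightarrow> (\<exists>c\<in>\<O>. \<exists>y\<in>ospan S. c *s s + y \<in> X \<and> c \<noteq> 0 \<and> v c = int n)" for X n
  define I where "I X = (LEAST n. Q X n)" for X
  have sub: "ospan S \<subseteq> ?T" using insert.hyps by (intro ospan_mono) auto
  have sT: "s \<in> ?T" using insert.hyps ospan_superset[of "insert s S"] by auto
  have Qe: "Q X e" if "scale (unif ^ e) ` ?T \<subseteq> X" for X
  proof -
    have "unif ^ e *s s + 0 \<in> X" using that sT by auto
    then show ?thesis unfolding Q_def
      using osub_0[OF osub_ospan] by (intro bexI[of _ "unif ^ e"] bexI[of _ 0]) (auto intro: O_power)
  qed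
  have Ie: "I X \<le> e" and QI: "Q X (I X)" if "scale (unif ^ e) ` ?T \<subseteq> X" for X
    using Qe[OF that] unfolding I_def by (auto intro: Least_le LeastI)
  have IS: "scale (unif ^ e) ` ospan S \<subseteq> X \<inter> ospan S" if "scale (unif ^ e) ` ?T \<subseteq> X" for X
    using that sub scale_image_subset[OF osub_ospan O_power[OF O_unif]] by blast
  show ?case
  proof (intro exI[of _ "\<lambda>X. I X + \<mu> (X \<inter> ospan S)"] conjI allI impI)
    fix X assume X: "osub X" "scale (unif ^ e) ` ?T \<subseteq> X" "X \<subseteq> ?T"
    have "\<mu> (X \<inter> ospan S) \<le> e * card S"
      by (intro \<mu>1 osub_Int X osub_ospan IS) auto
    with Ie[OF X(2)] insert.hyps show "I X + \<mu> (X \<inter> ospan S) \<le> e * card (insert s S)" by simp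
  next
    fix X Y assume XY: "osub X" "osub Y" "scale (unif ^ e) ` ?T \<subseteq> X" "X \<subset> Y" "Y \<subseteq> ?T"
    have IYX: "I Y \<le> I X" unfolding I_def[of Y]
      using QI[OF XY(3)] XY(4) by (intro Least_le) (auto simp: Q_def)
    show "I Y + \<mu> (Y \<inter> ospan S) < I X + \<mu> (X \<inter> ospan S)"
    proof (cases "X \<inter> ospan S = Y \<inter> ospan S")
      case False
      then have "\<mu> (Y \<inter> ospan S) < \<mu> (X \<inter> ospan S)"
        using XY by (intro \<mu>2 osub_Int osub_ospan IS) auto
      with IYX show ?thesis by simp
    next
      case True
      have "I Y \<noteq> I X"
      proof
        assume eq: "I Y = I X"
        obtain c0 y0 where c0: "c0 \<in> \<O>" "y0 \<in> ospan S" "c0 *s s + y0 \<in> X" "c0 \<noteq> 0" "v c0 = int (I X)"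
          using QI[OF XY(3)] unfolding Q_def by blast
        \<comment> \<open>Equal coefficient ideals and equal kernels force equality: subtracting a
          multiple of an element of \<open>X\<close> with minimal \<open>s\<close>-coefficient moves
          \<open>y\<close> into \<open>Y \<inter> ospan S\<close>, which lies in
          \<open>X\<close>.\<close>
        have "Y \<subseteq> X"
        proof
          fix y assume y: "y \<in> Y"
          then obtain c y' where c: "c \<in> \<O>" "y' \<in> ospan S" "y = c *s s + y'"
            using XY(5) ospan_insert[OF insert.hyps(1)] by blast
          have "c / c0 \<in> \<O>"
          proof (cases "c = 0")
            case False
            have "I Y \<le> nat (v c)" unfolding I_def using c y False
              by (intro Least_le) (auto simp: Q_def O_iff intro!: bexI[of _ c] bexI[of _ y'])
            then show ?thesis using eq c0 c False by (simp add: O_iff v_divide)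
          qed simp
          note m = this
          have "y - (c / c0) *s (c0 *s s + y0) \<in> Y"
            using y c0 XY m by (intro osub_diff osub_scale) auto
          moreover have "y - (c / c0) *s (c0 *s s + y0) = y' - (c / c0) *s y0"
            using c0 by (simp add: c(3) scale_right_distrib)
          moreover have "y' - (c / c0) *s y0 \<in> ospan S"
            using c c0 m by (intro osub_diff osub_scale osub_ospan) auto
          ultimately have "y - (c / c0) *s (c0 *s s + y0) \<in> X" using True by auto
          from osub_add[OF XY(1) this osub_scale[OF XY(1) m c0(3)]] show "y \<in> X" by simp
        qed
        with XY show False by blast
      qed
      with IYX True show ?thesis by simp
    qed
  qed
qed

text \<open>An \<open>\<O>\<close>-linear retraction onto \<open>X\<close> modulo the uniformizer, built by echelon reduction.\<close>

lemma split_mod_unif: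
  assumes "finite B" "independent B" "osub X" "scale unif ` ospan B \<subseteq> X" "X \<subseteq> ospan B"
  shows "\<exists>P. lin P \<and> P ` ospan B \<subseteq> X \<and> (\<forall>x\<in>X. P x - x \<in> scale unif ` ospan B)"
  using assms
proof (induction B arbitrary: X rule: finite_induct)
  case empty
  have "ospan {} = {0}" by (auto simp: ospan_def)
  then show ?case using empty by (intro exI[of _ "\<lambda>x. x"]) (auto intro: lin_ident)
next
  case (insert b B)
  let ?T = "ospan (insert b B)"
  note dec = ospan_insert[OF insert.hyps(1)]
  have sub: "ospan B \<subseteq> ?T" using insert.hyps by (intro ospan_mono) auto
  have bT: "b \<in> ?T" using insert.hyps ospan_superset[of "insert b B"] by auto
  have indB: "independent B" using insert.prems(1) by (rule independent_mono) auto
  have "scale unif ` ospan B \<subseteq> X \<inter> ospan B"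
    using sub insert.prems(3) scale_image_subset[OF osub_ospan O_unif] by blast
  then obtain P' where P': "lin P'" "P' ` ospan B \<subseteq> X \<inter> ospan B"
    "\<forall>x\<in>X \<inter> ospan B. P' x - x \<in> scale unif ` ospan B"
    using insert.IH[of "X \<inter> ospan B"] indB osub_Int[OF insert.prems(2) osub_ospan] by auto
  have ext: "\<exists>P. lin P \<and> P b = z \<and> (\<forall>y\<in>span B. P y = P' y)" for z
  proof -
    obtain P where P: "lin P" "\<forall>x\<in>insert b B. P x = (if x = b then z else P' x)"
      using vsp.linear_independent_extend[OF insert.prems(1), of "\<lambda>x. if x = b then z else P' x"] by blast
    have "P b' = P' b'" if "b' \<in> B" for b'
      using P(2) insert.hyps(2) that by auto
    then have "P y = P' y" if "y \<in> span B" for y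
      using vsp.linear_eq_on[OF P(1) P'(1) that] by blast
    with P show ?thesis by auto
  qed
  have uT: "scale unif ` ospan B \<subseteq> scale unif ` ?T" using sub by blast
  have spB: "y \<in> span B" if "y \<in> ospan B" for y using that ospan_subset_span by blast
  show ?case
  proof (cases "\<exists>c\<in>\<O>. \<exists>y\<in>ospan B. c *s b + y \<in> X \<and> c \<noteq> 0 \<and> v c = 0")
    case True
    then obtain c0 y0 where c0: "c0 \<in> \<O>" "y0 \<in> ospan B" "c0 *s b + y0 \<in> X" "c0 \<noteq> 0" "v c0 = 0" by blast
    then have ic: "inverse c0 \<in> \<O>" by (simp add: O_iff v_inverse)
    define y where "y = inverse c0 *s y0"
    define x0 where "x0 = b + y"
    have y: "y \<in> ospan B" unfolding y_def by (intro osub_scale osub_ospan ic c0)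
    have "x0 = inverse c0 *s (c0 *s b + y0)" using c0 by (simp add: x0_def y_def scale_right_distrib)
    then have x0: "x0 \<in> X" using osub_scale[OF insert.prems(2) ic c0(3)] by simp
    \<comment> \<open>\<open>X\<close> has an element with unit \<open>b\<close>-coefficient,
      normalized to \<open>x0 = b + y\<close>. The value at \<open>b\<close> is chosen so that
      \<open>P\<close> fixes \<open>x0\<close>, which may replace \<open>b\<close> as a
      generator.\<close>
    obtain P where P: "lin P" "P b = x0 - P' y" "\<forall>y\<in>span B. P y = P' y" using ext by blast
    have "P (b + y) = (x0 - P' y) + P' y"
      using P(2,3) spB[OF y] by (simp only: vsp.linear_add[OF P(1)])
    then have Px0: "P x0 = x0" by (simp add: x0_def)
    have Pz: "P (c *s x0 + z) = c *s x0 + P' z" if "z \<in> ospan B" for c z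
      using that P spB Px0 by (simp add: vsp.linear_add[OF P(1)] vsp.linear_scale[OF P(1)])
    have dec': "\<exists>c\<in>\<O>. \<exists>z\<in>ospan B. x = c *s x0 + z" if "x \<in> ?T" for x
    proof -
      obtain c z where cz: "c \<in> \<O>" "z \<in> ospan B" "x = c *s b + z" using \<open>x \<in> ?T\<close> dec by blast
      then have "x = c *s x0 + (z - c *s y)" by (simp add: x0_def scale_right_distrib)
      moreover have "z - c *s y \<in> ospan B" using cz y by (intro osub_diff osub_scale osub_ospan)
      ultimately show ?thesis using cz by blast
    qed
    show ?thesis
    proof (intro exI[of _ P] conjI ballI)
      show "P ` ?T \<subseteq> X"
      proof (rule image_subsetI)
        fix x assume "x \<in> ?T"
        then obtain c z where cz: "c \<in> \<O>" "z \<in> ospan B" "x = c *s x0 + z" using dec' by blast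
        then have "P' z \<in> X" using P' by blast
        with cz x0 show "P x \<in> X" unfolding cz(3) Pz[OF cz(2)]
          by (intro osub_add osub_scale insert.prems)
      qed
      fix x assume x: "x \<in> X"
      then obtain c z where cz: "c \<in> \<O>" "z \<in> ospan B" "x = c *s x0 + z" using dec' insert.prems by blast
      have "z = x - c *s x0" by (simp add: cz)
      also have "\<dots> \<in> X" using x x0 cz by (intro osub_diff osub_scale insert.prems)
      finally have "P' z - z \<in> scale unif ` ospan B" using P' cz by blast
      then show "P x - x \<in> scale unif ` ?T" using uT by (auto simp: cz(3) Pz[OF cz(2)])
    qed (rule P)
  next
    case False
    \<comment> \<open>All \<open>b\<close>-coefficients of \<open>X\<close> are now divisible by the
      uniformizer, so modulo it \<open>X\<close> lives in \<open>ospan B\<close> and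
      \<open>b\<close> can be sent to 0.\<close>
    obtain P where P: "lin P" "P b = 0" "\<forall>y\<in>span B. P y = P' y" using ext by blast
    have Pz: "P (c *s b + z) = P' z" if "z \<in> ospan B" for c z
      using that P spB by (simp add: vsp.linear_add[OF P(1)] vsp.linear_scale[OF P(1)])
    show ?thesis
    proof (intro exI[of _ P] conjI ballI)
      show "P ` ?T \<subseteq> X"
      proof (rule image_subsetI)
        fix x assume "x \<in> ?T"
        then obtain c z where cz: "c \<in> \<O>" "z \<in> ospan B" "x = c *s b + z" using dec by blast
        then show "P x \<in> X" unfolding cz(3) Pz[OF cz(2)] using P' by blast
      qed
      fix x assume x: "x \<in> X"
      then obtain c z where cz: "c \<in> \<O>" "z \<in> ospan B" "x = c *s b + z" using dec insert.prems by blast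
      have "c \<in> val_ge v (int 1)"
      proof (cases "c = 0")
        case nz: False
        have "v c \<ge> 0" using cz nz O_iff by blast
        moreover have "v c \<noteq> 0" using False cz x nz by blast
        ultimately show ?thesis by (simp add: val_ge_def)
      qed simp
      then obtain c' where c': "c' \<in> \<O>" "c = unif * c'" using val_ge_iff[of c 1] by auto
      have ub: "unif *s b \<in> X" using insert.prems bT by blast
      have "z = x - c' *s (unif *s b)" by (simp add: cz c' mult.commute)
      also have "\<dots> \<in> X" using osub_diff[OF insert.prems(2) x osub_scale[OF insert.prems(2) c'(1) ub]] .
      finally have "P' z - z \<in> scale unif ` ospan B" using P' cz by blast
      then obtain w where w: "w \<in> ospan B" "P' z - z = unif *s w" by blast
      have "P x - x = unif *s (w - c' *s b)"
      proof -
        have "P x - x = (P' z - z) - c *s b" unfolding cz(3) Pz[OF cz(2)] by (simp add: algebra_simps)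
        then show ?thesis unfolding w(2) by (simp add: scale_right_diff_distrib c'(2))
      qed
      moreover have "w - c' *s b \<in> ?T" using w sub bT c' by (intro osub_diff osub_scale osub_ospan) auto
      ultimately show "P x - x \<in> scale unif ` ?T" by blast
    qed (rule P)
  qed
qed

section \<open>Lattices of a subspace\<close>

definition lattice :: "'v set \<Rightarrow> 'v set \<Rightarrow> bool" where
  "lattice W T \<longleftrightarrow> (\<exists>S. finite S \<and> span S = W \<and> T = ospan S)"

text \<open>Lattices are defined by spanning sets, so that they can be generated by orbits; thinning
  a spanning set integrally to an independent one yields the \<O>-basis of \<open>dim W\<close>
  vectors needed for coordinates.\<close>

lemma lattice_basis:
  assumes "lattice W T"
  shows "\<exists>B. finite B \<and> independent B \<and> span B = W \<and> T = ospan B \<and> card B = dim W"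
proof -
  obtain S where S: "finite S" "span S = W" "T = ospan S" using assms unfolding lattice_def by blast
  obtain B where B: "B \<subseteq> S" "independent B" "ospan B = ospan S" using ospan_basis_exists[OF S(1)] by blast
  have "finite B" using B S finite_subset by blast
  moreover from this have "span B = W" using span_ospan[of B] span_ospan[of S] B S by simp
  ultimately show ?thesis using B S dim_span_eq_card_independent by metis
qed

lemma lattice_osub: "lattice W T \<Longrightarrow> osub T"
  and lattice_subset: "lattice W T \<Longrightarrow> T \<subseteq> W"
  and lattice_subspace: "lattice W T \<Longrightarrow> subspace W"
  and lattice_span: "lattice W T \<Longrightarrow> span T = W"
  unfolding lattice_def using osub_ospan ospan_subset_span subspace_span span_ospan by auto

lemma lattice_absorbs: "lattice W T \<Longrightarrow> x \<in> W \<Longrightarrow> \<exists>n. unif ^ n *s x \<in> T"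
  unfolding lattice_def using scale_into_ospan by blast

lemma osub_unif_power_le: "osub X \<Longrightarrow> unif ^ m *s x \<in> X \<Longrightarrow> m \<le> n \<Longrightarrow> unif ^ n *s x \<in> X"
  using osub_scale[of X "unif ^ (n - m)" "unif ^ m *s x"] O_power[OF O_unif]
  by (simp flip: power_add)

lemma unif_power_image_mono:
  assumes "osub T" "m \<le> n" shows "scale (unif ^ n) ` T \<subseteq> scale (unif ^ m) ` T"
proof (rule image_subsetI)
  fix x assume "x \<in> T"
  have "unif ^ n *s x = unif ^ m *s (unif ^ (n - m) *s x)" using assms(2) by (simp flip: power_add)
  moreover have "unif ^ (n - m) *s x \<in> T" using assms(1) \<open>x \<in> T\<close> by (intro osub_scale O_power) auto
  ultimately show "unif ^ n *s x \<in> scale (unif ^ m) ` T" by blast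
qed

lemma lattice_absorbs_lattice:
  assumes "lattice W T" "lattice W T'"
  shows "\<exists>n. scale (unif ^ n) ` T' \<subseteq> T"
proof -
  obtain S where S: "finite S" "span S = W" "T' = ospan S" using assms unfolding lattice_def by blast
  have "\<forall>s\<in>S. \<exists>n. unif ^ n *s s \<in> T"
    using lattice_absorbs[OF assms(1)] S span_superset by blast
  then obtain n where n: "\<And>s. s \<in> S \<Longrightarrow> unif ^ n s *s s \<in> T" by metis
  define N where "N = Max (insert 0 (n ` S))"
  have "unif ^ N *s s \<in> T" if "s \<in> S" for s
    using n[OF that] S(1) that osub_unif_power_le[OF lattice_osub[OF assms(1)]] by (simp add: N_def)
  then have "S \<subseteq> {x. unif ^ N *s x \<in> T}" by blast
  moreover have "osub {x. unif ^ N *s x \<in> T}"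
    by (rule osub_vimage[OF lin_scale lattice_osub[OF assms(1)]])
  ultimately have "T' \<subseteq> {x. unif ^ N *s x \<in> T}" using ospan_least S by metis
  then show ?thesis by blast
qed

lemma lattice_between:
  assumes "lattice W T1" "lattice W T2" "osub X" "T1 \<subseteq> X" "X \<subseteq> T2"
  shows "lattice W X"
proof -
  obtain S where "finite S" "T2 = ospan S" using assms(2) unfolding lattice_def by blast
  with assms osub_finitely_generated[of S X] obtain S' where S': "finite S'" "X = ospan S'" by auto
  have "span S' = span X" using S' span_ospan by simp
  also have "\<dots> = W" using lattice_span[OF assms(1)] lattice_span[OF assms(2)]
    span_mono[OF assms(4)] span_mono[OF assms(5)] by blast
  finally show ?thesis using S' unfolding lattice_def by blast
qed

lemma lattice_scale:
  assumes "lattice W T" "c \<noteq> 0"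
  shows "lattice W (scale c ` T)"
proof -
  obtain S where S: "finite S" "span S = W" "T = ospan S" using assms unfolding lattice_def by blast
  have inj: "inj_on (scale c) S" using assms(2) by (auto intro: inj_onI)
  have "scale c ` ospan S = ospan (scale c ` S)"
  proof
    have "osub {x. c *s x \<in> ospan (scale c ` S)}"
      by (rule osub_vimage[OF lin_scale osub_ospan])
    moreover have "S \<subseteq> {x. c *s x \<in> ospan (scale c ` S)}"
      using ospan_superset[of "scale c ` S"] S by auto
    ultimately show "scale c ` ospan S \<subseteq> ospan (scale c ` S)" using ospan_least by blast
    show "ospan (scale c ` S) \<subseteq> scale c ` ospan S"
      using ospan_superset[OF S(1)] by (intro ospan_least osub_scale_image osub_ospan) auto
  qed
  moreover have "span (scale c ` S) = W"
    using span_image_scale[of S "\<lambda>_. c"] S assms(2) by simp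
  ultimately show ?thesis unfolding lattice_def using S by (metis finite_imageI)
qed

text \<open>Lattices are separated: each coordinate of \<open>x\<close> in an \<O>-basis is
  divisible by every power of the uniformizer, hence zero.\<close>

lemma lattice_inter:
  assumes "lattice W T" "\<And>n. inverse (unif ^ n) *s x \<in> T"
  shows "x = 0"
proof (rule ccontr)
  assume x: "x \<noteq> 0"
  obtain B where B: "finite B" "independent B" "span B = W" "T = ospan B"
    using lattice_basis[OF assms(1)] by blast
  have "x \<in> span B" using assms(2)[of 0] lattice_subset[OF assms(1)] B by auto
  define r where "r = representation B x"
  have lin: "\<And>c. c \<noteq> 0 \<Longrightarrow> representation B (c *s x) = (\<lambda>b. c * r b)"
    unfolding r_def using representation_scale[OF B(2) \<open>x \<in> span B\<close>] by auto
  have O: "representation B y b \<in> \<O>" if y: "y \<in> ospan B" and "b \<in> B" for y b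
  proof -
    obtain c where c: "y = (\<Sum>b\<in>B. c b *s b)" "\<forall>b\<in>B. c b \<in> \<O>" using y unfolding ospan_def by blast
    have "representation B y = (\<lambda>b. if b \<in> B then c b else 0)"
    proof (rule representation_eqI[OF B(2)])
      show "y \<in> span B" using y ospan_subset_span by blast
      show "sum (\<lambda>b. (if b \<in> B then c b else 0) *s b) {b. (if b \<in> B then c b else 0) \<noteq> 0} = y"
        unfolding c(1) using B(1) by (intro sum.mono_neutral_cong_left) auto
      show "finite {b. (if b \<in> B then c b else 0) \<noteq> 0}" using B(1) by simp
    qed (auto split: if_splits)
    then show ?thesis using c that by simp
  qed
  have "r b = 0" if b: "b \<in> B" for b
  proof (rule inter_val_ge)
    fix n
    have "inverse (unif ^ n) * r b \<in> \<O>"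
      using O[OF _ b, of "inverse (unif ^ n) *s x"] assms(2)[of n] lin[of "inverse (unif ^ n)"] B by simp
    then show "r b \<in> val_ge v (int n)"
      unfolding val_ge_iff by (intro bexI[of _ "inverse (unif ^ n) * r b"]) auto
  qed
  moreover have "x = (\<Sum>b\<in>B. r b *s b)"
    unfolding r_def using sum_representation_eq[OF B(2) \<open>x \<in> span B\<close> B(1)] by simp
  ultimately show False using x by simp
qed

text \<open>The images of a basis under \<Gamma> are finitely many and are carried into one another.
  Closure under composition is required on \<open>W\<close> only, so that the powers of an operator
  of finite order just on \<open>W\<close> qualify.\<close>

lemma stable_lattice_exists:
  assumes "subspace W" "finite \<Gamma>" "\<And>g. g \<in> \<Gamma> \<Longrightarrow> lin g" "\<And>g. g \<in> \<Gamma> \<Longrightarrow> g ` W \<subseteq> W"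
    "\<And>g h x. g \<in> \<Gamma> \<Longrightarrow> h \<in> \<Gamma> \<Longrightarrow> \<exists>k\<in>\<Gamma>. \<forall>x\<in>W. g (h x) = k x" "(\<lambda>x. x) \<in> \<Gamma>"
  shows "\<exists>T. lattice W T \<and> (\<forall>g\<in>\<Gamma>. g ` T \<subseteq> T)"
proof -
  obtain B where "B \<subseteq> W" "independent B" "W \<subseteq> span B" using basis_exists[of W] by metis
  then have B: "finite B" "span B = W" "B \<subseteq> W"
    using finiteI_independent[of B] span_minimal[OF _ assms(1), of B] by auto
  define S where "S = (\<Union>g\<in>\<Gamma>. g ` B)"
  have fin: "finite S" unfolding S_def using assms B by blast
  have SW: "S \<subseteq> W" unfolding S_def using assms(4) B(3) by blast
  have "B \<subseteq> S" unfolding S_def using assms(6) by force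
  then have "span S = W" using SW B span_mono[of B S] span_minimal[OF SW assms(1)] by blast
  then have "lattice W (ospan S)" using fin unfolding lattice_def by blast
  moreover have "g ` ospan S \<subseteq> ospan S" if g: "g \<in> \<Gamma>" for g
  proof -
    have "g s \<in> S" if s: "s \<in> S" for s
    proof -
      obtain h b where "h \<in> \<Gamma>" "b \<in> B" "s = h b" using s unfolding S_def by blast
      then show ?thesis using assms(5)[OF g, of h] B(3) unfolding S_def by fastforce
    qed
    then have "S \<subseteq> {x. g x \<in> ospan S}" using ospan_superset[OF fin] by blast
    moreover have "osub {x. g x \<in> ospan S}"
      by (rule osub_vimage[OF assms(3)[OF g] osub_ospan])
    ultimately show ?thesis using ospan_least by blast
  qed
  ultimately show ?thesis by blast
qed

section \<open>Operators of prime power order\<close>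

definition O_poly :: "'k poly \<Rightarrow> bool" where
  "O_poly p \<longleftrightarrow> (\<forall>i. coeff p i \<in> \<O>)"

lemma O_poly_add: "O_poly p \<Longrightarrow> O_poly q \<Longrightarrow> O_poly (p + q)"
  and O_poly_minus: "O_poly p \<Longrightarrow> O_poly (- p)"
  and O_poly_diff: "O_poly p \<Longrightarrow> O_poly q \<Longrightarrow> O_poly (p - q)"
  and O_poly_mult: "O_poly p \<Longrightarrow> O_poly q \<Longrightarrow> O_poly (p * q)"
  and O_poly_0 [simp]: "O_poly 0"
  by (auto simp: O_poly_def O_add O_minus O_diff coeff_mult intro!: O_sum O_mult)

lemma O_poly_pCons [simp]: "O_poly (pCons a p) \<longleftrightarrow> a \<in> \<O> \<and> O_poly p"
  unfolding O_poly_def by (auto simp: coeff_pCons split: nat.splits)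

lemma O_poly_1 [simp]: "O_poly 1"
  unfolding one_pCons by simp

lemma O_poly_X_minus_1: "O_poly [:- 1, 1:]"
  using O_minus[OF O_1] by (simp del: O_poly_1)

lemma O_poly_of_nat [simp]: "O_poly (of_nat n)"
  by (induction n) (auto intro: O_poly_add)

lemma O_poly_power: "O_poly p \<Longrightarrow> O_poly (p ^ n)"
  by (induction n) (auto intro: O_poly_mult)

lemma O_poly_sum: "(\<And>i. i \<in> I \<Longrightarrow> O_poly (F i)) \<Longrightarrow> O_poly (sum F I)"
  by (induction I rule: infinite_finite_induct) (auto intro: O_poly_add)

lemma poly_op_in_osub: "lin g \<Longrightarrow> osub X \<Longrightarrow> g ` X \<subseteq> X \<Longrightarrow> O_poly p \<Longrightarrow> x \<in> X \<Longrightarrow> poly_op p g x \<in> X"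
  by (induction p) (auto intro!: osub_add osub_scale simp: osub_0 poly_op_0 poly_op_pCons)

section \<open>Nakayama's lemma and chains of lattices under an endomorphism\<close>

lemma lattice_image:
  assumes "lattice W T" "lin h" "h ` W \<subseteq> W" "\<And>x. x \<in> W \<Longrightarrow> h x = 0 \<Longrightarrow> x = 0"
  shows "lattice W (h ` T)"
proof -
  obtain S where S: "finite S" "span S = W" "T = ospan S" using assms unfolding lattice_def by blast
  have "h ` ospan S = ospan (h ` S)"
  proof
    have "S \<subseteq> {x. h x \<in> ospan (h ` S)}"
      using ospan_superset[of "h ` S"] S by auto
    with osub_vimage[OF assms(2) osub_ospan] show "h ` ospan S \<subseteq> ospan (h ` S)" using ospan_least by blast
    show "ospan (h ` S) \<subseteq> h ` ospan S"
      using ospan_superset[OF S(1)] by (intro ospan_least osub_image assms osub_ospan) auto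
  qed
  moreover have "span (h ` S) = W"
  proof -
    have sub: "subspace W" using lattice_subspace[OF assms(1)] .
    have inj: "inj_on h W"
    proof (rule inj_onI)
      fix x y assume "x \<in> W" "y \<in> W" "h x = h y"
      then have "h (x - y) = 0" "x - y \<in> W" by (auto simp: vsp.linear_diff[OF assms(2)] subspace_diff[OF sub])
      then show "x = y" using assms(4) by force
    qed
    have "span W = W" using sub by (rule span_eq_iff[THEN iffD2])
    then have "dim (h ` W) = dim W" using vsp.dim_image_eq[OF assms(2), of W] inj by metis
    then have "h ` W = W"
      using subspace_dim_equal[of "h ` W" W] assms(3) sub vsp.linear_subspace_image[OF assms(2) sub] by simp
    moreover have "h ` W = span (h ` S)" using S vsp.linear_span_image[OF assms(2)] by simp
    ultimately show ?thesis by simp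
  qed
  ultimately show ?thesis unfolding lattice_def using S by (metis finite_imageI)
qed

text \<open>Iterating the congruence gives \<open>T = X + unif ^ n T\<close> for every
  \<open>n\<close>; for large \<open>n\<close> the second summand lies in \<open>X\<close> because
  both are lattices of \<open>W\<close>.\<close>

lemma lattice_nakayama:
  assumes "lattice W T" "lattice W X" "\<And>x. x \<in> T \<Longrightarrow> \<exists>y\<in>X. x - y \<in> scale unif ` T" "X \<subseteq> T"
  shows "X = T"
proof -
  note oT = lattice_osub[OF assms(1)] and oX = lattice_osub[OF assms(2)]
  have *: "\<exists>y\<in>X. x - y \<in> scale (unif ^ n) ` T" if "x \<in> T" for x n
    using that
  proof (induction n arbitrary: x)
    case 0
    then show ?case by (intro bexI[of _ 0]) (auto intro: osub_0[OF oX])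
  next
    case (Suc n)
    then obtain y z where y: "y \<in> X" "z \<in> T" "x - y = unif ^ n *s z" by blast
    then obtain y' z' where y': "y' \<in> X" "z' \<in> T" "z - y' = unif *s z'" using assms(3) by blast
    have "unif ^ n *s (unif *s z') = unif ^ n *s z - unif ^ n *s y'"
      unfolding y'(3)[symmetric] by (simp add: scale_right_diff_distrib)
    then have "x - (y + unif ^ n *s y') = unif ^ Suc n *s z'"
      unfolding y(3)[symmetric] by (simp add: algebra_simps)
    then show ?case using y y' osub_add[OF oX] osub_scale[OF oX O_power[OF O_unif]] by blast
  qed
  obtain n where n: "scale (unif ^ n) ` T \<subseteq> X" using lattice_absorbs_lattice[OF assms(2,1)] by blast
  have "T \<subseteq> X"
  proof
    fix x assume "x \<in> T"
    then obtain y where "y \<in> X" "x - y \<in> X" using *[of x n] n by blast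
    then show "x \<in> X" using osub_add[OF oX, of "x - y" y] by simp
  qed
  with assms show ?thesis by blast
qed

lemma lattice_unif_proper:
  assumes "lattice W T" "scale unif ` T = T"
  shows "W = {0}"
proof -
  have "inverse (unif ^ n) *s x \<in> T" if "x \<in> T" for x n
  proof (induction n)
    case (Suc n)
    then obtain y where "y \<in> T" "inverse (unif ^ n) *s x = unif *s y" using assms(2) by blast
    then have "inverse unif *s (inverse (unif ^ n) *s x) = y" by simp
    then show ?case using \<open>y \<in> T\<close> by (simp add: mult.commute)
  qed (use that in simp)
  then have "T \<subseteq> {0}" using lattice_inter[OF assms(1)] by blast
  then have "span T = {0}" using lattice_osub[OF assms(1)] osub_0
    by (metis span_empty span_insert_0 subset_singletonD empty_iff)
  then show ?thesis using lattice_span[OF assms(1)] by simp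
qed

text \<open>The second bound refines the chain of the \<open>(\<psi> ^^ i) ` T\<close> by the \<open>(\<psi> ^^ i) ` Y\<close>.\<close>

lemma chain_bound:
  assumes T: "lattice W T" and \<psi>: "lin \<psi>" "\<And>x. x \<in> W \<Longrightarrow> \<psi> x = 0 \<Longrightarrow> x = 0" "\<psi> ` T \<subseteq> T"
    and m: "scale (unif ^ e) ` T \<subseteq> (\<psi> ^^ m) ` T"
    and Y: "osub Y" "\<psi> ` T \<subseteq> Y" "Y \<subset> T"
  shows "m \<le> e * dim W" "Y \<noteq> \<psi> ` T \<Longrightarrow> 2 * m \<le> e * dim W"
proof -
  obtain B where B: "finite B" "T = ospan B" "card B = dim W" using lattice_basis[OF T] by blast
  obtain \<mu> :: "'v set \<Rightarrow> nat" where
    \<mu>1: "\<And>X. osub X \<Longrightarrow> scale (unif ^ e) ` T \<subseteq> X \<Longrightarrow> X \<subseteq> T \<Longrightarrow> \<mu> X \<le> e * dim W" and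
    \<mu>2: "\<And>X Y. osub X \<Longrightarrow> osub Y \<Longrightarrow> scale (unif ^ e) ` T \<subseteq> X \<Longrightarrow> X \<subset> Y \<Longrightarrow> Y \<subseteq> T \<Longrightarrow> \<mu> Y < \<mu> X"
    using ospan_chain_measure[OF B(1), of e] B(2,3) by metis
  note oT = lattice_osub[OF T]
  have o: "osub ((\<psi> ^^ i) ` X)" if "osub X" for i X
    by (rule osub_image[OF lin_funpow[OF \<psi>(1)] that])
  have inj: "\<psi> x = \<psi> y \<Longrightarrow> x = y" if "x \<in> T" "y \<in> T" for x y
    using \<psi>(2)[of "x - y"] that lattice_subset[OF T] subspace_diff[OF lattice_subspace[OF T], of x y]
    by (auto simp: vsp.linear_diff[OF \<psi>(1)])
  have st: "(\<psi> ^^ i) ` T \<subseteq> T" for i using funpow_image_subset[OF \<psi>(3)] .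
  have injn: "(\<psi> ^^ i) x = (\<psi> ^^ i) y \<Longrightarrow> x = y" if "x \<in> T" "y \<in> T" for x y i
  proof (induction i)
    case (Suc i)
    then show ?case using inj[of "(\<psi> ^^ i) x" "(\<psi> ^^ i) y"] st[of i] that by auto
  qed simp
  have step: "(\<psi> ^^ i) ` X \<subset> (\<psi> ^^ i) ` X'" if XX: "X \<subset> X'" "X' \<subseteq> T" for i X X'
  proof -
    obtain x where x: "x \<in> X'" "x \<notin> X" using XX by blast
    then have "(\<psi> ^^ i) x \<notin> (\<psi> ^^ i) ` X" using injn[of x] XX by blast
    then show ?thesis using x XX by blast
  qed
  have Sx: "(\<psi> ^^ Suc i) ` T = (\<psi> ^^ i) ` (\<psi> ` T)" for i
    by (auto simp: funpow_swap1)
  have dec: "(\<psi> ^^ m) ` T \<subseteq> (\<psi> ^^ i) ` T" if "i \<le> m" for i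
  proof -
    have "(\<psi> ^^ m) ` T = (\<psi> ^^ i) ` ((\<psi> ^^ (m - i)) ` T)"
      using that by (simp add: image_comp flip: funpow_add)
    then show ?thesis using st by blast
  qed
  have low: "scale (unif ^ e) ` T \<subseteq> (\<psi> ^^ i) ` T" if "i \<le> m" for i using m dec[OF that] by blast
  have \<mu>i: "i \<le> \<mu> ((\<psi> ^^ i) ` T)" if "i \<le> m" for i
    using that
  proof (induction i)
    case (Suc i)
    have "\<psi> ` T \<subset> T" using Y by blast
    then have "(\<psi> ^^ Suc i) ` T \<subset> (\<psi> ^^ i) ` T" unfolding Sx by (rule step) simp
    then have "\<mu> ((\<psi> ^^ i) ` T) < \<mu> ((\<psi> ^^ Suc i) ` T)"
      by (intro \<mu>2 o oT low Suc.prems st)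
    with Suc show ?case by simp
  qed simp
  show "m \<le> e * dim W" using \<mu>i[of m] \<mu>1[OF o[OF oT] low[of m] st] by simp
  assume ne: "Y \<noteq> \<psi> ` T"
  have \<mu>2i: "2 * i \<le> \<mu> ((\<psi> ^^ i) ` T)" if "i \<le> m" for i
    using that
  proof (induction i)
    case (Suc i)
    have 1: "(\<psi> ^^ Suc i) ` T \<subset> (\<psi> ^^ i) ` Y" unfolding Sx using Y ne by (intro step) auto
    have 2: "(\<psi> ^^ i) ` Y \<subset> (\<psi> ^^ i) ` T" using Y by (intro step) auto
    have "\<mu> ((\<psi> ^^ i) ` Y) < \<mu> ((\<psi> ^^ Suc i) ` T)"
      using 2 st[of i] by (intro \<mu>2 o oT Y low Suc.prems 1) blast
    moreover have "\<mu> ((\<psi> ^^ i) ` T) < \<mu> ((\<psi> ^^ i) ` Y)"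
      using 1 low[OF Suc.prems] by (intro \<mu>2 o oT Y 2 st) blast
    ultimately show ?case using Suc by simp
  qed simp
  show "2 * m \<le> e * dim W" using \<mu>2i[of m] \<mu>1[OF o[OF oT] low[of m] st] by simp
qed

end

section \<open>Integral polynomials modulo \<open>l\<close> and the cyclotomic relation\<close>

locale mixed_val_space = val_space scale Basis v
  for scale :: "'k::field_char_0 \<Rightarrow> 'v::ab_group_add \<Rightarrow> 'v" (infixr \<open>*s\<close> 75)
    and Basis :: "'v set" and v :: "'k \<Rightarrow> int" +
  fixes l e :: nat
  assumes l: "prime l" "v (of_nat l) = int e" "e > 0"
begin

lemma scale_l_image: "osub T \<Longrightarrow> scale (of_nat l) ` T = scale (unif ^ e) ` T"
proof -
  assume T: "osub T"
  have l0: "(of_nat l :: 'k) \<noteq> 0" using l(1) by (simp add: prime_gt_0_nat)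
  define u :: 'k where "u = of_nat l / unif ^ e"
  have u0: "u \<noteq> 0" and u: "v u = 0" using l0 l(2) by (auto simp: u_def v_divide)
  have uO: "u \<in> \<O>" "inverse u \<in> \<O>" using u u0 by (auto simp: O_iff v_inverse)
  have lu: "of_nat l = unif ^ e * u" by (simp add: u_def)
  show ?thesis
  proof
    show "scale (of_nat l) ` T \<subseteq> scale (unif ^ e) ` T"
      using osub_scale[OF T uO(1)] by (auto simp: lu simp flip: scale_scale)
    show "scale (unif ^ e) ` T \<subseteq> scale (of_nat l) ` T"
    proof (rule image_subsetI)
      fix x assume "x \<in> T"
      moreover have "unif ^ e *s x = of_nat l *s (inverse u *s x)" using u0 by (simp add: lu)
      ultimately show "unif ^ e *s x \<in> scale (of_nat l) ` T" using osub_scale[OF T uO(2)] by blast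
    qed
  qed
qed

lemma scale_l_unif: "osub T \<Longrightarrow> scale (of_nat l) ` T \<subseteq> scale unif ` T"
  using scale_l_image[of T] unif_power_image_mono[of T 1 e] l(3) by simp

text \<open>The middle binomial coefficients are divisible by the prime \<open>l\<close>; the point
  is that the quotient \<open>G\<close> is again integral.\<close>

lemma O_poly_dream:
  assumes "O_poly p" "O_poly q"
  shows "\<exists>G. O_poly G \<and> (p + q) ^ l = p ^ l + q ^ l + of_nat l * G"
proof -
  have l2: "l \<ge> 2" using l(1) by (rule prime_ge_2_nat)
  have set: "{..l} = insert 0 (insert l {1..<l})" using l2 by auto
  have c: "of_nat (l choose k) = (of_nat l * of_nat ((l choose k) div l) :: 'k poly)" if "k \<in> {1..<l}" for k
  proof -
    have "l dvd (l choose k)" using that l(1) by (intro dvd_choose_prime) auto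
    then show ?thesis by (simp flip: of_nat_mult)
  qed
  have "(p + q) ^ l = (\<Sum>k\<le>l. of_nat (l choose k) * p ^ k * q ^ (l - k))" by (rule binomial_ring)
  also have "\<dots> = p ^ l + q ^ l + (\<Sum>k\<in>{1..<l}. of_nat (l choose k) * p ^ k * q ^ (l - k))"
    unfolding set using l2 by (subst sum.insert, simp, simp)+ (simp add: algebra_simps)
  also have "(\<Sum>k\<in>{1..<l}. of_nat (l choose k) * p ^ k * q ^ (l - k)) =
    of_nat l * (\<Sum>k\<in>{1..<l}. of_nat ((l choose k) div l) * p ^ k * q ^ (l - k))"
    unfolding sum_distrib_left by (intro sum.cong refl) (simp add: c mult.assoc)
  finally have "(p + q) ^ l = p ^ l + q ^ l +
    of_nat l * (\<Sum>k\<in>{1..<l}. of_nat ((l choose k) div l) * p ^ k * q ^ (l - k))" .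
  moreover have "O_poly (\<Sum>k\<in>{1..<l}. of_nat ((l choose k) div l) * p ^ k * q ^ (l - k))"
    by (intro O_poly_sum O_poly_mult O_poly_power O_poly_of_nat assms)
  ultimately show ?thesis by (intro exI conjI)
qed

text \<open>Start from X = (X - 1) + 1 and take \<open>l\<close>-th powers repeatedly; modulo
  \<open>l\<close> each is additive. Evaluated at \<open>t\<close>, this compares
  \<open>t ^^ (l ^ k)\<close> with the same power of \<open>t - 1\<close>.\<close>

lemma O_poly_X_power:
  "\<exists>G. O_poly G \<and> [:0, 1:] ^ (l ^ k) = [:- 1, 1:] ^ (l ^ k) + 1 + of_nat l * G"
proof (induction k)
  case 0
  show ?case by (intro exI[of _ 0]) (simp add: one_pCons)
next
  case (Suc k)
  then obtain G :: "'k poly" where G: "O_poly G" "[:0, 1:] ^ (l ^ k) = [:- 1, 1:] ^ (l ^ k) + 1 + of_nat l * G" by blast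
  define P :: "'k poly" where "P = [:- 1, 1:] ^ (l ^ k)"
  have P: "O_poly P" unfolding P_def by (rule O_poly_power[OF O_poly_X_minus_1])
  obtain G1 where G1: "O_poly G1" "(P + 1 + of_nat l * G) ^ l = (P + 1) ^ l + (of_nat l * G) ^ l + of_nat l * G1"
    using O_poly_dream[OF O_poly_add[OF P O_poly_1] O_poly_mult[OF O_poly_of_nat G(1)]] by blast
  obtain G2 where G2: "O_poly G2" "(P + 1) ^ l = P ^ l + 1 ^ l + of_nat l * G2"
    using O_poly_dream[OF P O_poly_1] by blast
  obtain n where n: "l = Suc n" using l(1) by (metis not_prime_0 nat.exhaust)
  have "[:0, 1:] ^ (l ^ Suc k) = ([:0, 1:] ^ (l ^ k)) ^ l" by (simp add: mult.commute flip: power_mult)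
  also have "\<dots> = (P ^ l + 1 + of_nat l * G2) + (of_nat l * G) ^ l + of_nat l * G1"
    unfolding G(2) P_def[symmetric] G1(2) G2(2) by simp
  also have "(of_nat l * G) ^ l = of_nat l * (G * (of_nat l * G) ^ n)"
    using power_Suc[of "of_nat l * G" n] by (simp only: n[symmetric] mult.assoc)
  also have "P ^ l = [:- 1, 1:] ^ (l ^ Suc k)" by (simp add: P_def mult.commute flip: power_mult)
  finally have "[:0, 1:] ^ (l ^ Suc k) =
    [:- 1, 1:] ^ (l ^ Suc k) + 1 + of_nat l * (G2 + G * (of_nat l * G) ^ n + G1)"
    by (simp only: distrib_left add.assoc)
  moreover have "O_poly (G2 + G * (of_nat l * G) ^ n + G1)"
    by (intro O_poly_add O_poly_mult O_poly_power O_poly_of_nat G(1) G1(1) G2(1))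
  ultimately show ?case by (intro exI conjI)
qed

text \<open>The sum is ((1 + Z) ^ l - 1) / Z, and the binomial theorem gives the Eisenstein shape:
  leading term \<open>Z ^ (l - 1)\<close>, all other terms divisible by \<open>l\<close>, and lowest
  term exactly \<open>l\<close>.\<close>

lemma O_poly_cyclotomic:
  assumes "O_poly Z" "Z \<noteq> 0"
  shows "\<exists>G. O_poly G \<and> (\<Sum>i<l. (1 + Z) ^ i) = Z ^ (l - 1) + of_nat l * (1 + Z * G)"
proof -
  have l2: "l \<ge> 2" using l(1) by (rule prime_ge_2_nat)
  have set: "{..l} = insert 0 (insert 1 (insert l {2..<l}))" using l2 by auto
  have c: "of_nat (l choose k) = (of_nat l * of_nat ((l choose k) div l) :: 'k poly)" if "k \<in> {2..<l}" for k
  proof -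
    have "l dvd (l choose k)" using that l(1) by (intro dvd_choose_prime) auto
    then show ?thesis by (simp flip: of_nat_mult)
  qed
  define G where "G = (\<Sum>k\<in>{2..<l}. of_nat ((l choose k) div l) * Z ^ (k - 2))"
  have "Z * (\<Sum>i<l. (1 + Z) ^ i) = (1 + Z) ^ l - 1" using power_diff_1_eq[of "1 + Z" l] by simp
  also have "(1 + Z) ^ l = (\<Sum>k\<le>l. of_nat (l choose k) * Z ^ k * 1 ^ (l - k))"
    unfolding binomial_ring[symmetric] by (simp add: add.commute)
  also have "\<dots> = 1 + of_nat l * Z + Z ^ l + (\<Sum>k\<in>{2..<l}. of_nat (l choose k) * Z ^ k)"
    unfolding set using l2 by (subst sum.insert, simp, simp)+ (simp add: algebra_simps)
  also have "(\<Sum>k\<in>{2..<l}. of_nat (l choose k) * Z ^ k) = of_nat l * (Z * (Z * G))"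
    unfolding G_def sum_distrib_left
  proof (intro sum.cong refl)
    fix k assume k: "k \<in> {2..<l}"
    then have "2 + (k - 2) = k" by auto
    from power_add[of Z 2 "k - 2", unfolded this] have "Z ^ k = Z * (Z * Z ^ (k - 2))"
      by (simp only: power2_eq_square mult.assoc)
    then show "of_nat (l choose k) * Z ^ k = of_nat l * (Z * (Z * (of_nat ((l choose k) div l) * Z ^ (k - 2))))"
      unfolding c[OF k] by (simp only: ac_simps)
  qed
  also have "Z ^ l = Z * Z ^ (l - 1)" using l2 by (simp flip: power_Suc)
  finally have "Z * (\<Sum>i<l. (1 + Z) ^ i) = Z * (Z ^ (l - 1) + of_nat l * (1 + Z * G))"
    by (simp add: algebra_simps)
  with assms(2) have "(\<Sum>i<l. (1 + Z) ^ i) = Z ^ (l - 1) + of_nat l * (1 + Z * G)" by simp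
  moreover have "O_poly G" unfolding G_def using assms(1)
    by (intro O_poly_sum O_poly_mult O_poly_power) auto
  ultimately show ?thesis by blast
qed

text \<open>As \<open>t\<close> has \<open>l\<close>-power order on \<open>W\<close>, the
  \<open>l ^ k\<close>-th power of \<open>t - 1\<close> is \<open>l\<close> times an integral
  polynomial in \<open>t\<close>, and \<open>l\<close> is divisible by the uniformizer.\<close>

lemma unipotent_mod_unif:
  assumes T: "lattice W T" and t: "lin t" "t ` T \<subseteq> T" and pow: "\<And>x. x \<in> W \<Longrightarrow> (t ^^ (l ^ k)) x = x"
  shows "((\<lambda>x. t x - x) ^^ (l ^ k)) ` T \<subseteq> scale unif ` T"
proof (rule image_subsetI)
  fix x assume x: "x \<in> T"
  note \<psi> = poly_op_X_minus_1[OF t(1)]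
  obtain G :: "'k poly" where G: "O_poly G" "[:0, 1:] ^ (l ^ k) = [:- 1, 1:] ^ (l ^ k) + 1 + of_nat l * G"
    using O_poly_X_power by blast
  have "x = (t ^^ (l ^ k)) x" using pow x lattice_subset[OF T] by auto
  also have "\<dots> = poly_op ([:- 1, 1:] ^ (l ^ k)) t x + x + of_nat l *s poly_op G t x"
    unfolding poly_op_X_power[OF t(1), symmetric] G(2)
    by (simp add: poly_op_add[OF t(1)] poly_op_1[OF t(1)] of_nat_poly poly_op_smult[OF t(1)])
  finally have "((\<lambda>x. t x - x) ^^ (l ^ k)) x = of_nat l *s (- poly_op G t x)"
    unfolding poly_op_power[OF t(1)] \<psi> by (simp add: eq_neg_iff_add_eq_0)
  moreover have "- poly_op G t x \<in> T"
    using lattice_osub[OF T] t G x by (intro osub_minus poly_op_in_osub) auto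
  ultimately show "((\<lambda>x. t x - x) ^^ (l ^ k)) x \<in> scale unif ` T"
    using scale_l_unif[OF lattice_osub[OF T]] by auto
qed

text \<open>On a vector fixed by \<open>t ^^ q\<close> the sum is multiplication by
  \<open>l\<close>, which is nonzero in characteristic 0. So \<open>t ^^ q - 1\<close>, and with it
  \<open>t - 1\<close>, is injective on \<open>W\<close>.\<close>

lemma cyclotomic_inj:
  fixes t :: "'v \<Rightarrow> 'v"
  assumes "\<And>x. x \<in> W \<Longrightarrow> (\<Sum>i<l. (t ^^ (q * i)) x) = 0" "x \<in> W" "(t ^^ q) x = x"
  shows "x = 0"
proof -
  have "of_nat l *s x = (\<Sum>i<l. (t ^^ (q * i)) x)"
    using funpow_mult_fixes[OF assms(3)] by (simp add: sum_constant_scale)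
  then have "of_nat l *s x = 0" using assms by simp
  moreover have "(of_nat l :: 'k) \<noteq> 0" using l(1) by (simp add: prime_gt_0_nat)
  ultimately show ?thesis by simp
qed

text \<open>With Z = t^q - 1 the Eisenstein relation reads Z^(l-1) = - l E, where E = 1 + Z G. As Z
  is nilpotent modulo the uniformizer, E is bijective on \<open>T\<close>, so l T = Z^(l-1) T; and Z
  is an integral multiple of t - 1.\<close>

lemma cyclotomic_lattice:
  assumes T: "lattice W T" and t: "lin t" "t ` T \<subseteq> T" "t ` W \<subseteq> W" and q: "q > 0"
    and cyc: "\<And>x. x \<in> W \<Longrightarrow> (\<Sum>i<l. (t ^^ (q * i)) x) = 0"
  shows "scale (unif ^ e) ` T \<subseteq> ((\<lambda>x. t x - x) ^^ (l - 1)) ` T"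
proof -
  note p = poly_op_add[OF t(1)] poly_op_1[OF t(1)] poly_op_smult[OF t(1)] poly_op_mult[OF t(1)]
    poly_op_diff[OF t(1)] poly_op_minus[OF t(1)]
  note oT = lattice_osub[OF T]
  have W: "subspace W" using lattice_subspace[OF T] .
  have l0: "(of_nat l :: 'k) \<noteq> 0" using l(1) by (simp add: prime_gt_0_nat)
  note \<psi> = poly_op_X_minus_1[OF t(1)]
  \<comment> \<open>\<open>Z\<close> becomes \<open>t ^^ q - 1\<close> at \<open>t\<close>, and
    \<open>R\<close> is the cofactor of \<open>X - 1\<close> in it.\<close>
  define X Z R :: "'k poly" where "X = [:0, 1:]" and "Z = X ^ q - 1" and "R = (\<Sum>i<q. X ^ i)"
  have ZR: "Z = [:- 1, 1:] * R"
    unfolding Z_def R_def power_diff_1_eq by (simp add: X_def one_pCons)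
  have OX: "O_poly X" by (simp add: X_def)
  have OZ: "O_poly Z" unfolding Z_def by (intro O_poly_diff O_poly_power OX O_poly_1)
  have OR: "O_poly R" unfolding R_def by (intro O_poly_sum O_poly_power OX)
  have "degree (X ^ q) = q" unfolding X_def by (simp add: degree_power_eq)
  then have "Z \<noteq> 0" unfolding Z_def using q by auto
  from O_poly_cyclotomic[OF OZ this] obtain G where G: "O_poly G"
    "(\<Sum>i<l. (X ^ q) ^ i) = Z ^ (l - 1) + of_nat l * (1 + Z * G)" by (auto simp: Z_def)
  define E where "E = 1 + Z * G"
  have OE: "O_poly E" unfolding E_def by (intro O_poly_add O_poly_mult OZ G O_poly_1)
  have key: "poly_op (Z ^ (l - 1)) t x = - (of_nat l *s poly_op E t x)" if "x \<in> W" for x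
  proof -
    have "0 = poly_op (\<Sum>i<l. (X ^ q) ^ i) t x"
      using cyc[OF that] by (simp add: poly_op_sum[OF t(1)] X_def poly_op_X_power[OF t(1)] flip: power_mult)
    also have "\<dots> = poly_op (Z ^ (l - 1)) t x + of_nat l *s poly_op E t x"
      unfolding G(2) E_def by (simp add: p of_nat_poly)
    finally show ?thesis by (simp add: eq_neg_iff_add_eq_0)
  qed
  have Zi: "x = 0" if "x \<in> W" "poly_op Z t x = 0" for x
    using cyclotomic_inj[where W = W and t = t and q = q, OF cyc that(1)] that(2)
    unfolding Z_def by (simp add: p X_def poly_op_X_power[OF t(1)])
  have Ei: "x = 0" if "x \<in> W" "poly_op E t x = 0" for x
  proof -
    have *: "(poly_op Z t ^^ n) x = 0 \<Longrightarrow> x = 0" for n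
    proof (induction n)
      case (Suc n)
      have "(poly_op Z t ^^ n) x \<in> W"
        using funpow_image_subset[of "poly_op Z t" W n] poly_op_in_subspace[OF t(1) W t(3)] that(1) by blast
      with Suc Zi show ?case by simp
    qed simp
    show ?thesis using key[OF that(1)] that(2) *[of "l - 1"] by (simp add: poly_op_power[OF t(1)])
  qed
  have EW: "poly_op E t ` W \<subseteq> W" using poly_op_in_subspace[OF t(1) W t(3)] by blast
  have ET: "poly_op E t ` T \<subseteq> T" using poly_op_in_osub[OF t(1) oT t(2) OE] by blast
  have surj: "poly_op E t ` T = T"
  proof (rule lattice_nakayama[OF T lattice_image[OF T lin_poly_op[OF t(1)] EW Ei] _ ET])
    fix x assume x: "x \<in> T"
    \<comment> \<open>\<open>S\<close> is the truncated geometric series for the inverse of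
      \<open>E = 1 + Z * G\<close>. The remainder contains \<open>Z ^ (l - 1)\<close>, which acts as
      \<open>- l * E\<close>, so \<open>S\<close> inverts \<open>E\<close> modulo the uniformizer
      and Nakayama applies.\<close>
    define S where "S = (\<Sum>i<l - 1. (- (Z * G)) ^ i)"
    have OS: "O_poly S" unfolding S_def by (intro O_poly_sum O_poly_power O_poly_minus O_poly_mult OZ G)
    have "(- (Z * G)) ^ (l - 1) - 1 = (- (Z * G) - 1) * S" unfolding S_def by (rule power_diff_1_eq)
    then have "E * S = 1 - (- (Z * G)) ^ (l - 1)"
      by (simp add: E_def algebra_simps)
    also have "(- (Z * G)) ^ (l - 1) = (- 1) ^ (l - 1) * G ^ (l - 1) * Z ^ (l - 1)"
      by (subst power_minus) (simp only: power_mult_distrib mult_ac)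
    finally have "E * S = 1 - (- 1) ^ (l - 1) * G ^ (l - 1) * Z ^ (l - 1)" .
    then have "poly_op (E * S) t x = x - poly_op ((- 1) ^ (l - 1) * G ^ (l - 1)) t (poly_op (Z ^ (l - 1)) t x)"
      by (simp only: p)
    also have "poly_op (Z ^ (l - 1)) t x = of_nat l *s (- poly_op E t x)"
      using key x lattice_subset[OF T] by auto
    also have "poly_op ((- 1) ^ (l - 1) * G ^ (l - 1)) t (of_nat l *s (- poly_op E t x))
      = of_nat l *s poly_op ((- 1) ^ (l - 1) * G ^ (l - 1)) t (- poly_op E t x)"
      by (rule vsp.linear_scale[OF lin_poly_op[OF t(1)]])
    finally have "x - poly_op E t (poly_op S t x) = of_nat l *s poly_op ((- 1) ^ (l - 1) * G ^ (l - 1)) t (- poly_op E t x)"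
      by (simp add: p)
    moreover have "poly_op ((- 1) ^ (l - 1) * G ^ (l - 1)) t (- poly_op E t x) \<in> T"
    proof (rule poly_op_in_osub[OF t(1) oT t(2)])
      show "O_poly ((- 1) ^ (l - 1) * G ^ (l - 1))"
        by (intro O_poly_mult O_poly_power O_poly_minus O_poly_1 G)
      show "- poly_op E t x \<in> T" using ET x by (intro osub_minus[OF oT]) auto
    qed
    ultimately have "x - poly_op E t (poly_op S t x) \<in> scale unif ` T"
      using scale_l_unif[OF oT] by auto
    moreover have "poly_op S t x \<in> T" by (rule poly_op_in_osub[OF t(1) oT t(2) OS x])
    ultimately show "\<exists>y\<in>poly_op E t ` T. x - y \<in> scale unif ` T" by blast
  qed
  show ?thesis
  proof -
    have "of_nat l *s x \<in> ((\<lambda>x. t x - x) ^^ (l - 1)) ` T" if "x \<in> T" for x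
    proof -
      have "x \<in> poly_op E t ` T" unfolding surj by (rule that)
      then obtain y where y: "y \<in> T" "x = poly_op E t y" by (rule imageE)
      have "of_nat l *s x = - poly_op (Z ^ (l - 1)) t y"
        using key y lattice_subset[OF T] by auto
      also have "Z ^ (l - 1) = [:- 1, 1:] ^ (l - 1) * R ^ (l - 1)" by (simp only: ZR power_mult_distrib)
      also have "- poly_op ([:- 1, 1:] ^ (l - 1) * R ^ (l - 1)) t y =
        poly_op ([:- 1, 1:] ^ (l - 1)) t (- poly_op (R ^ (l - 1)) t y)"
        by (simp only: p vsp.linear_neg[OF lin_poly_op[OF t(1)]])
      also have "\<dots> = ((\<lambda>x. t x - x) ^^ (l - 1)) (- poly_op (R ^ (l - 1)) t y)"
        unfolding poly_op_power[OF t(1)] \<psi> ..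
      finally have "of_nat l *s x = ((\<lambda>x. t x - x) ^^ (l - 1)) (- poly_op (R ^ (l - 1)) t y)" .
      moreover have "- poly_op (R ^ (l - 1)) t y \<in> T"
        by (rule osub_minus[OF oT poly_op_in_osub[OF t(1) oT t(2) O_poly_power[OF OR] y(1)]])
      ultimately show ?thesis by (rule image_eqI)
    qed
    then have "scale (of_nat l) ` T \<subseteq> ((\<lambda>x. t x - x) ^^ (l - 1)) ` T" by (rule image_subsetI)
    then show ?thesis unfolding scale_l_image[OF oT] .
  qed
qed

text \<open>By induction \<open>g ^^ l\<close> is already trivial on \<open>Y\<close>, so
  \<open>g\<close> has order dividing \<open>l\<close> there. Then the image of \<open>g - 1\<close>
  lies in the kernel \<open>W\<close> of 1 + g + ... + g^(l-1), where the cyclotomic relation with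
  \<open>q = 1\<close> holds; if \<open>W\<close> were nonzero, the chain bound would give
  \<open>l - 1 \<le> e * dim W\<close>.\<close>

lemma small_dim_trivial:
  assumes Y: "subspace Y" and g: "lin g" "g ` Y \<subseteq> Y" and pow: "\<And>x. x \<in> Y \<Longrightarrow> (g ^^ (l ^ k)) x = x"
    and small: "e * dim Y < l - 1" and x: "x \<in> Y"
  shows "g x = x"
  using g pow x
proof (induction k arbitrary: g x)
  case 0
  from "0.prems"(3)[OF "0.prems"(4)] show ?case
    by (simp only: power_0 One_nat_def funpow.simps comp_apply id_apply)
next
  case (Suc k)
  note g = Suc.prems(1,2) and pow = Suc.prems(3)
  have gl: "(g ^^ l) x = x" if "x \<in> Y" for x
  proof (rule Suc.IH[OF lin_funpow[OF g(1)] funpow_image_subset[OF g(2)] _ that])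
    fix x assume "x \<in> Y"
    then show "((g ^^ l) ^^ (l ^ k)) x = x" using pow by (simp add: funpow_mult)
  qed
  define W where "W = {x \<in> Y. (\<Sum>i<l. (g ^^ i) x) = 0}"
  have lsum: "lin (\<lambda>x. \<Sum>i<l. (g ^^ i) x)"
    by (intro lin_I) (simp_all add: vsp.linear_add[OF lin_funpow[OF g(1)]] vsp.linear_scale[OF lin_funpow[OF g(1)]]
        sum.distrib scale_sum_right)
  have gsum: "(\<Sum>i<l. (g ^^ i) (g x)) = g (\<Sum>i<l. (g ^^ i) x)" for x
    by (simp add: vsp.linear_sum[OF g(1)] funpow_swap1)
  have subW: "subspace W"
  proof -
    have "W = Y \<inter> {x. (\<Sum>i<l. (g ^^ i) x) = 0}" by (auto simp: W_def)
    then show ?thesis using Y vsp.linear_subspace_kernel[OF lsum] subspace_inter by metis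
  qed
  have gW: "g ` W \<subseteq> W" using g(2) by (auto simp: W_def gsum vsp.linear_0[OF g(1)])
  have l2: "l \<ge> 2" using l(1) by (rule prime_ge_2_nat)
  have "W = {0}"
  proof (rule ccontr)
    assume W0: "W \<noteq> {0}"
    define \<Gamma> where "\<Gamma> = (\<lambda>i. g ^^ i) ` {..<l}"
    have "\<exists>T. lattice W T \<and> (\<forall>g\<in>\<Gamma>. g ` T \<subseteq> T)"
    proof (rule stable_lattice_exists[OF subW])
      show "finite \<Gamma>" by (simp add: \<Gamma>_def)
      show "lin h" if "h \<in> \<Gamma>" for h using that lin_funpow[OF g(1)] by (auto simp: \<Gamma>_def)
      show "h ` W \<subseteq> W" if "h \<in> \<Gamma>" for h using that funpow_image_subset[OF gW] by (auto simp: \<Gamma>_def)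
      show "(\<lambda>x. x) \<in> \<Gamma>"
      proof -
        have "g ^^ 0 \<in> \<Gamma>" unfolding \<Gamma>_def using l2 by (intro imageI) simp
        then show ?thesis by (simp add: id_def)
      qed
      show "\<exists>k\<in>\<Gamma>. \<forall>x\<in>W. h (h' x) = k x" if hh: "h \<in> \<Gamma>" "h' \<in> \<Gamma>" for h h'
      proof -
        obtain i j where ij: "h = g ^^ i" "h' = g ^^ j" using hh by (auto simp: \<Gamma>_def)
        have "h (h' x) = (g ^^ ((i + j) mod l)) x" if "x \<in> W" for x
        proof -
          have "(g ^^ l) x = x" using gl that by (simp add: W_def)
          from funpow_mod_eq[OF this, of "i + j"] show ?thesis by (simp add: ij funpow_add)
        qed
        moreover have "g ^^ ((i + j) mod l) \<in> \<Gamma>" unfolding \<Gamma>_def using l2 by (intro imageI) simp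
        ultimately show ?thesis by blast
      qed
    qed
    then obtain T where T: "lattice W T" "\<forall>g\<in>\<Gamma>. g ` T \<subseteq> T" by blast
    have gT: "g ` T \<subseteq> T"
    proof -
      have "g ^^ 1 \<in> \<Gamma>" unfolding \<Gamma>_def using l2 by (intro imageI) simp
      then show ?thesis using T(2) by simp
    qed
    note oT = lattice_osub[OF T(1)]
    define \<psi> where "\<psi> x = g x - x" for x
    have \<psi>: "lin \<psi>" unfolding \<psi>_def
      by (rule lin_I) (simp_all add: vsp.linear_add[OF g(1)] vsp.linear_scale[OF g(1)] scale_right_diff_distrib)
    have \<psi>T: "\<psi> ` T \<subseteq> T" using gT oT by (auto simp: \<psi>_def intro!: osub_diff)
    have sumW: "(\<Sum>i<l. (g ^^ (1 * i)) x) = 0" if "x \<in> W" for x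
      using that by (simp add: W_def)
    have \<psi>i: "x = 0" if "x \<in> W" "\<psi> x = 0" for x
    proof (rule cyclotomic_inj[OF sumW that(1)])
      show "(g ^^ 1) x = x" using that(2) by (simp add: \<psi>_def)
    qed
    have up: "scale (unif ^ e) ` T \<subseteq> (\<psi> ^^ (l - 1)) ` T"
      unfolding \<psi>_def
      by (rule cyclotomic_lattice[OF T(1) g(1) gT gW, of 1]) (use sumW in auto)
    \<comment> \<open>Surjectivity would pass to all powers of \<psi>, while
      \<open>\<psi> ^^ l\<close> maps \<open>T\<close> into \<open>unif T\<close>.\<close>
    have "\<psi> ` T \<noteq> T"
    proof
      assume "\<psi> ` T = T"
      have \<psi>n: "(\<psi> ^^ n) ` T = T" for n
      proof (induction n)
        case (Suc n)
        have "(\<psi> ^^ Suc n) ` T = \<psi> ` (\<psi> ^^ n) ` T" by (simp only: funpow.simps image_comp)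
        then show ?case by (simp only: Suc.IH \<open>\<psi> ` T = T\<close>)
      qed simp
      have "T \<subseteq> scale unif ` T"
      proof -
        have "(g ^^ (l ^ 1)) x = x" if "x \<in> W" for x using gl that by (simp add: W_def)
        from unipotent_mod_unif[OF T(1) g(1) gT this] show ?thesis
          unfolding \<psi>_def[symmetric] \<psi>n .
      qed
      with scale_image_subset[OF oT O_unif] have "scale unif ` T = T" by (rule equalityI)
      then show False using lattice_unif_proper[OF T(1)] W0 by simp
    qed
    then have "l - 1 \<le> e * dim W"
      using \<psi>T by (intro chain_bound(1)[OF T(1) \<psi> \<psi>i \<psi>T up osub_image[OF \<psi> oT] order_refl]) auto
    also have "\<dots> \<le> e * dim Y" by (intro mult_left_mono dim_subset) (auto simp: W_def)
    finally show False using small by simp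
  qed
  moreover have "g x - x \<in> W"
  proof -
    have "(\<Sum>i<l. (g ^^ i) (g x - x)) = (\<Sum>i<l. (g ^^ Suc i) x - (g ^^ i) x)"
      by (intro sum.cong refl) (simp add: vsp.linear_diff[OF lin_funpow[OF g(1)]] funpow_swap1)
    also have "\<dots> = (g ^^ l) x - x" using sum_lessThan_telescope[of "\<lambda>i. (g ^^ i) x" l] by simp
    also have "\<dots> = 0" using gl Suc.prems(4) by simp
    finally show ?thesis using g(2) Suc.prems(4) Y by (auto simp: W_def intro: subspace_diff)
  qed
  ultimately show ?case by simp
qed

end

section \<open>Roots of powers via the norm\<close>

text \<open>\<open>I\<close> is given by the closure properties of an ideal, so no quotient ring has
  to be formed. It will be the annihilator of a module in the ring of polynomials.\<close>

lemma det_diff_in_ideal: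
  fixes A B :: "'a::comm_ring_1 mat"
  assumes "A \<in> carrier_mat n n" "B \<in> carrier_mat n n"
    and "0 \<in> I" and add: "\<And>x y. x \<in> I \<Longrightarrow> y \<in> I \<Longrightarrow> x + y \<in> I"
    and mult: "\<And>c x. x \<in> I \<Longrightarrow> c * x \<in> I"
    and diff: "\<And>i j. i < n \<Longrightarrow> j < n \<Longrightarrow> A $$ (i, j) - B $$ (i, j) \<in> I"
  shows "det A - det B \<in> I"
proof -
  have prod: "(\<Prod>i\<in>S. f i) - (\<Prod>i\<in>S. g i) \<in> I" if "finite S" "\<And>i. i \<in> S \<Longrightarrow> f i - g i \<in> I"
    for f g :: "nat \<Rightarrow> 'a" and S
    using that
  proof (induction S rule: finite_induct)
    case (insert i S)
    have "(\<Prod>i\<in>insert i S. f i) - (\<Prod>i\<in>insert i S. g i) =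
      (\<Prod>i\<in>S. f i) * (f i - g i) + g i * ((\<Prod>i\<in>S. f i) - (\<Prod>i\<in>S. g i))"
      using insert.hyps by (simp add: algebra_simps)
    also have "\<dots> \<in> I" using insert by (intro add mult) auto
    finally show ?case .
  qed (simp add: \<open>0 \<in> I\<close>)
  have sum: "sum f S \<in> I" if "\<And>i. i \<in> S \<Longrightarrow> f i \<in> I" for f :: "(nat \<Rightarrow> nat) \<Rightarrow> 'a" and S
    using that by (induction S rule: infinite_finite_induct) (auto simp: \<open>0 \<in> I\<close> intro: add)
  have "det A - det B = (\<Sum>p | p permutes {0..<n}.
      signof p * ((\<Prod>i = 0..<n. A $$ (i, p i)) - (\<Prod>i = 0..<n. B $$ (i, p i))))"
    unfolding det_def'[OF assms(1)] det_def'[OF assms(2)] by (simp add: sum_subtractf right_diff_distrib)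
  also have "\<dots> \<in> I"
    by (intro sum mult prod diff) (auto simp: permutes_in_image)
  finally show ?thesis .
qed

lemma det_pow_mat:
  fixes A :: "'a::comm_ring_1 mat"
  assumes "A \<in> carrier_mat n n"
  shows "det (A ^\<^sub>m k) = det A ^ k"
  using assms by (induction k) (simp_all add: det_mult[of _ n] mult.commute)

context finite_dimensional_vector_space
begin

interpretation vsp: finite_dimensional_vector_space_pair scale Basis scale Basis ..

lemma inj_endo_surj:
  assumes C: "subspace C" and h: "Vector_Spaces.linear scale scale h" "h ` C \<subseteq> C"
    and inj: "\<And>x. x \<in> C \<Longrightarrow> h x = 0 \<Longrightarrow> x = 0"
  shows "h ` C = C"
proof -
  have "inj_on h C"
  proof (rule inj_onI)
    fix x y assume xy: "x \<in> C" "y \<in> C" "h x = h y"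
    then have "h (x - y) = 0" by (simp add: vsp.linear_diff[OF h(1)])
    moreover have "x - y \<in> C" using xy by (intro subspace_diff[OF C])
    ultimately show "x = y" using inj by force
  qed
  moreover have "span C = C" using C by (rule span_eq_iff[THEN iffD2])
  ultimately have "dim (h ` C) = dim C" using vsp.dim_image_eq[OF h(1), of C] by metis
  then show ?thesis
    using subspace_dim_equal[of "h ` C" C] h C vsp.linear_subspace_image[OF h(1) C] by simp
qed

text \<open>If \<open>a = s ^ L\<close> generates a field acting on \<open>W\<close>, then taking the norm (the determinant of a
  companion matrix of \<open>s\<close> over \<open>K[a]\<close>) turns \<open>s ^ L = a\<close> into an \<open>L\<close>-th root of a power of \<open>a\<close>
  inside \<open>K[a]\<close>.\<close>

lemma norm_root_of_power:
  assumes W: "subspace W" and s: "Vector_Spaces.linear scale scale s" "s ` W \<subseteq> W" and w: "w \<in> W" "w \<noteq> 0"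
    and field: "\<And>p x y. x \<in> W \<Longrightarrow> x \<noteq> 0 \<Longrightarrow> poly_op p (s ^^ L) x = 0 \<Longrightarrow> y \<in> W \<Longrightarrow> poly_op p (s ^^ L) y = 0"
  shows "\<exists>m N. 0 < m \<and> m \<le> dim W \<and> (\<forall>y\<in>W. (poly_op N (s ^^ L) ^^ L) y = ((s ^^ L) ^^ m) y)"
proof -
  define a where "a = s ^^ L"
  have a: "Vector_Spaces.linear scale scale a" unfolding a_def by (rule lin_funpow[OF s(1)])
  have aW: "a ` W \<subseteq> W" unfolding a_def by (rule funpow_image_subset[OF s(2)])
  define P where "P p = poly_op p a" for p
  have P: "Vector_Spaces.linear scale scale (P p)" for p unfolding P_def by (rule lin_poly_op[OF a])
  note Pl = vsp.linear_add[OF P] vsp.linear_scale[OF P] vsp.linear_sum[OF P] vsp.linear_0[OF P] vsp.linear_diff[OF P] vsp.linear_neg[OF P]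
  have Pp: "P (p + q) x = P p x + P q x" "P (p * q) x = P p (P q x)" "P (- p) x = - P p x" "P (p - q) x = P p x - P q x"
    "P 0 x = 0" "P 1 x = x" "P [:c:] x = scale c x" "P [:0, 1:] x = a x" for p q x c
    unfolding P_def by (simp_all add: poly_op_add[OF a] poly_op_mult[OF a] poly_op_minus[OF a] poly_op_diff[OF a] poly_op_1[OF a]
      poly_op_0[OF a] poly_op_pCons[OF a] vsp.linear_0[OF a])
  have PX: "P (pCons 0 1) x = a x" for x using Pp(8)[of x] by (simp only: one_pCons)
  have Psum: "P (sum F I) x = (\<Sum>i\<in>I. P (F i) x)" for F :: "nat \<Rightarrow> 'a poly" and I x
    unfolding P_def by (rule poly_op_sum[OF a])
  have PW: "P p x \<in> W" if "x \<in> W" for p x unfolding P_def by (rule poly_op_in_subspace[OF a W aW that])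
  have Ps: "s (P p x) = P p (s x)" for p x
    unfolding P_def
    by (rule poly_op_commute_on[OF a s(1) subspace_UNIV]) (auto simp: a_def funpow_swap1)
  have fld: "P p y = 0" if "x \<in> W" "x \<noteq> 0" "P p x = 0" "y \<in> W" for p x y
    using field[of x p y] that unfolding P_def a_def by blast
  define u where "u i = (s ^^ i) w" for i
  have u: "u i \<in> W" for i using funpow_image_subset[OF s(2)] w(1) unfolding u_def by blast
  have su: "s (u i) = u (Suc i)" for i by (simp add: u_def)
  \<comment> \<open>\<open>M m\<close> is the K[a]-span of the first \<open>m\<close> iterates of
    \<open>w\<close> under \<open>s\<close>.\<close>
  define M where "M m = {\<Sum>i<m. P (c i) (u i) | c. True}" for m :: nat
  have M: "subspace (M m)" for m unfolding subspace_def
  proof (intro conjI ballI allI)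
    show "0 \<in> M m" unfolding M_def by (auto intro!: exI[of _ "\<lambda>_. 0"] simp: Pp)
    show "x + y \<in> M m" if xy: "x \<in> M m" "y \<in> M m" for x y
    proof -
      obtain c d where "x = (\<Sum>i<m. P (c i) (u i))" "y = (\<Sum>i<m. P (d i) (u i))" using xy unfolding M_def by blast
      then show ?thesis unfolding M_def
        by (auto intro!: exI[of _ "\<lambda>i. c i + d i"] simp: Pp sum.distrib)
    qed
    show "scale k x \<in> M m" if x: "x \<in> M m" for k x
    proof -
      obtain c where "x = (\<Sum>i<m. P (c i) (u i))" using x unfolding M_def by blast
      then show ?thesis unfolding M_def
        by (auto intro!: exI[of _ "\<lambda>i. [:k:] * c i"] simp: Pp(2,7) scale_sum_right simp del: mult_pCons_left)
    qed
  qed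
  have uM: "u i \<in> M m" if "i < m" for i m
  proof -
    have "u i = (\<Sum>j<m. if j = i then u i else 0)" using that by simp
    also have "\<dots> = (\<Sum>j<m. P (if j = i then 1 else 0) (u j))" by (intro sum.cong refl) (simp add: Pp)
    finally show ?thesis unfolding M_def by (auto intro!: exI[of _ "\<lambda>j. if j = i then 1 else 0"])
  qed
  \<comment> \<open>Otherwise the iterates u 0, ..., u (dim W) would be linearly independent even
    over \<open>K\<close>, and there are too many of them.\<close>
  have "\<exists>m\<le>dim W. u m \<in> M m"
  proof (rule ccontr)
    assume *: "\<not> (\<exists>m\<le>dim W. u m \<in> M m)"
    have "independent (u ` {..<m}) \<and> card (u ` {..<m}) = m" if "m \<le> Suc (dim W)" for m
      using that
    proof (induction m)
      case 0 show ?case by (simp add: independent_empty)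
    next
      case (Suc m)
      have "span (u ` {..<m}) \<subseteq> M m" using uM by (intro span_minimal M) auto
      then have "u m \<notin> span (u ` {..<m})" using * Suc.prems by auto
      moreover from this have "u m \<notin> u ` {..<m}" using span_base[of "u m" "u ` {..<m}"] by auto
      moreover have "u ` {..<Suc m} = insert (u m) (u ` {..<m})" by (simp add: lessThan_Suc)
      moreover have "independent (u ` {..<m})" "card (u ` {..<m}) = m" using Suc by auto
      ultimately show ?case using independent_insertI[of "u m" "u ` {..<m}"] by simp
    qed
    from this[of "Suc (dim W)"] have "Suc (dim W) \<le> dim W"
      using independent_card_le_dim[of "u ` {..<Suc (dim W)}" W] u by auto
    then show False by simp
  qed
  then obtain m0 where m0: "m0 \<le> dim W" "u m0 \<in> M m0" by blast
  define m where "m = (LEAST m. u m \<in> M m)"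
  have m: "u m \<in> M m" unfolding m_def using m0(2) by (rule LeastI)
  have m_le: "m \<le> dim W" using m0 Least_le[of "\<lambda>m. u m \<in> M m" m0] unfolding m_def by simp
  have m_least: "u i \<notin> M i" if "i < m" for i using that not_less_Least unfolding m_def by blast
  have m_pos: "m > 0" using m w(2) by (cases m) (auto simp: M_def u_def)
  \<comment> \<open>The cyclic module K[a] w is finite-dimensional and \<open>P c\<close> is
    injective on it by \<open>field\<close>, so it reaches \<open>w\<close> there; the resulting
    inverse is valid on all of \<open>W\<close>.\<close>
  have inv: "\<exists>q. \<forall>y\<in>W. P q (P c y) = y" if c: "P c w \<noteq> 0" for c
  proof -
    define C where "C = {P p w | p. True}"
    have subC: "subspace C" unfolding subspace_def C_def
    proof (safe)
      show "\<exists>p. 0 = P p w \<and> True" by (intro exI[of _ 0]) (simp add: Pp)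
      show "\<exists>r. P p w + P q w = P r w \<and> True" for p q by (intro exI[of _ "p + q"]) (simp add: Pp)
      show "\<exists>r. scale k (P p w) = P r w \<and> True" for k p
        by (intro exI[of _ "[:k:] * p"]) (simp add: Pp(2,7) del: mult_pCons_left)
    qed
    have CW: "C \<subseteq> W" unfolding C_def using PW[OF w(1)] by auto
    have "P c ` C = C"
    proof (rule inj_endo_surj[OF subC P])
      show "P c ` C \<subseteq> C" unfolding C_def by (auto simp flip: Pp(2))
      show "x = 0" if "x \<in> C" "P c x = 0" for x
        using fld[of x c w] that CW c w(1) by auto
    qed
    moreover have "w \<in> C" unfolding C_def using Pp(6)[of w] by (intro CollectI exI[of _ 1]) simp
    ultimately obtain q where "w = P c (P q w)" unfolding C_def by blast
    then have "P (q * c - 1) w = 0" by (simp add: Pp(4,6) mult.commute[of q]) (simp add: Pp(2))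
    then have "P (q * c - 1) y = 0" if "y \<in> W" for y using fld[OF w] that by blast
    then have "\<forall>y\<in>W. P q (P c y) = y" by (simp add: Pp(2,4,6))
    then show ?thesis by (rule exI)
  qed
  \<comment> \<open>Linear independence over the field K[a]: inverting the last nonzero coefficient,
    at \<open>i0\<close>, would put \<open>u i0\<close> into \<open>M i0\<close>, against the
    minimality of \<open>m\<close>.\<close>
  have indep: "P (c i) y = 0" if c: "(\<Sum>i<m. P (c i) (u i)) = 0" and i: "i < m" and y: "y \<in> W" for c i y
  proof (rule ccontr)
    assume "P (c i) y \<noteq> 0"
    then have "P (c i) w \<noteq> 0" using fld[OF w] y by blast
    then obtain i0 where i0: "i0 < m" "P (c i0) w \<noteq> 0" "\<And>j. j < m \<Longrightarrow> i0 < j \<Longrightarrow> P (c j) w = 0"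
    proof -
      define J where "J = {j. j < m \<and> P (c j) w \<noteq> 0}"
      have "finite J" "i \<in> J" using i \<open>P (c i) w \<noteq> 0\<close> by (auto simp: J_def)
      then have "Max J \<in> J" and le: "\<And>j. j \<in> J \<Longrightarrow> j \<le> Max J" by (auto intro: Max_in)
      then have "Max J < m" "P (c (Max J)) w \<noteq> 0" by (auto simp: J_def)
      moreover have "P (c j) w = 0" if "j < m" "Max J < j" for j
      proof (rule ccontr)
        assume "P (c j) w \<noteq> 0"
        then have "j \<in> J" using that(1) by (simp add: J_def)
        then show False using le[of j] that(2) by simp
      qed
      ultimately show thesis by (rule that)
    qed
    obtain q where q: "\<forall>y\<in>W. P q (P (c i0) y) = y" using inv[OF i0(2)] by blast
    have z: "P (c j) (u j) = 0" if "j < m" "i0 < j" for j using fld[OF w i0(3)[OF that] u] .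
    have "{..<m} = insert i0 ({..<i0} \<union> {i0<..<m})" using i0(1) by auto
    then have "(\<Sum>i<m. P (c i) (u i)) = (\<Sum>i\<in>insert i0 ({..<i0} \<union> {i0<..<m}). P (c i) (u i))" by simp
    also have "\<dots> = P (c i0) (u i0) + (\<Sum>i<i0. P (c i) (u i))"
      using z by (subst sum.insert, simp, simp, subst sum.union_disjoint) auto
    finally have "P (c i0) (u i0) = - (\<Sum>i<i0. P (c i) (u i))" using c by (simp add: eq_neg_iff_add_eq_0)
    then have "P q (P (c i0) (u i0)) = (\<Sum>i<i0. P (- (q * c i)) (u i))"
      by (simp add: Pl Pp(2,3) sum_negf)
    then have "u i0 = (\<Sum>i<i0. P (- (q * c i)) (u i))" using q u by simp
    then have "u i0 \<in> M i0" unfolding M_def by (intro CollectI exI[of _ "\<lambda>i. - (q * c i)"] conjI TrueI)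
    with m_least[OF i0(1)] show False ..
  qed
  obtain c where c: "u m = (\<Sum>i<m. P (c i) (u i))" using m unfolding M_def by blast
  \<comment> \<open>Companion matrix with rows as coordinates: row \<open>i\<close> expresses
    \<open>s (u i)\<close> through the \<open>u j\<close>. Its entries are polynomials that stand
    for elements of K[a].\<close>
  define C where "C = mat m m (\<lambda>(i, j). if Suc i < m then (if j = Suc i then 1 else 0) else c j)"
  have C: "C \<in> carrier_mat m m" by (simp add: C_def)
  have sC: "s (u i) = (\<Sum>j<m. P (C $$ (i, j)) (u j))" if "i < m" for i
  proof (cases "Suc i < m")
    case True
    have "(\<Sum>j<m. P (C $$ (i, j)) (u j)) = (\<Sum>j<m. if j = Suc i then u j else 0)"
      using that True by (intro sum.cong refl) (simp add: C_def Pp)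
    then show ?thesis using True su by simp
  next
    case False
    then have "Suc i = m" using that by simp
    then show ?thesis using su[of i] c that by (simp add: C_def)
  qed
  have sCn: "(s ^^ n) (u i) = (\<Sum>j<m. P ((C ^\<^sub>m n) $$ (i, j)) (u j))" if "i < m" for n i
    using that
  proof (induction n)
    case 0
    have "(\<Sum>j<m. P ((C ^\<^sub>m 0) $$ (i, j)) (u j)) = (\<Sum>j<m. if j = i then u j else 0)"
      using 0 C by (intro sum.cong refl) (auto simp: Pp)
    then show ?case using 0 by simp
  next
    case (Suc n)
    have Cn: "C ^\<^sub>m n \<in> carrier_mat m m" using C by simp
    have "(s ^^ Suc n) (u i) = (\<Sum>j<m. P ((C ^\<^sub>m n) $$ (i, j)) (s (u j)))"
      using Suc by (simp add: vsp.linear_sum[OF s(1)] Ps)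
    also have "\<dots> = (\<Sum>j<m. \<Sum>k<m. P ((C ^\<^sub>m n) $$ (i, j) * C $$ (j, k)) (u k))"
      using sC by (intro sum.cong refl) (simp add: Pl Pp(2))
    also have "\<dots> = (\<Sum>k<m. \<Sum>j<m. P ((C ^\<^sub>m n) $$ (i, j) * C $$ (j, k)) (u k))" by (rule sum.swap)
    also have "\<dots> = (\<Sum>k<m. P ((C ^\<^sub>m Suc n) $$ (i, k)) (u k))"
    proof (intro sum.cong refl)
      fix k assume "k \<in> {..<m}"
      then have "(C ^\<^sub>m Suc n) $$ (i, k) = (\<Sum>j<m. (C ^\<^sub>m n) $$ (i, j) * C $$ (j, k))"
        using C Cn Suc.prems by (simp add: scalar_prod_def atLeast0LessThan)
      then show "(\<Sum>j<m. P ((C ^\<^sub>m n) $$ (i, j) * C $$ (j, k)) (u k)) = P ((C ^\<^sub>m Suc n) $$ (i, k)) (u k)"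
        by (simp only: Psum)
    qed
    finally show ?case .
  qed
  \<comment> \<open>\<open>I\<close> is the annihilator of \<open>W\<close>, so polynomials modulo
    \<open>I\<close> are the elements of K[a] acting on \<open>W\<close>. Modulo it
    \<open>C ^ L\<close> and the scalar matrix X agree, both describing \<open>s ^^ L = a\<close>;
    determinants then give \<open>det C ^ L = X ^ m\<close>.\<close>
  define I where "I = {p. \<forall>y\<in>W. P p y = 0}"
  let ?X = "[:0, 1:] :: 'a poly"
  have "det (C ^\<^sub>m L) - det (?X \<cdot>\<^sub>m 1\<^sub>m m) \<in> I"
  proof (rule det_diff_in_ideal)
    show "C ^\<^sub>m L \<in> carrier_mat m m" "?X \<cdot>\<^sub>m 1\<^sub>m m \<in> carrier_mat m m" using C by auto
    show "0 \<in> I" by (simp add: I_def Pp)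
    show "x + y \<in> I" if "x \<in> I" "y \<in> I" for x y using that by (simp add: I_def Pp)
    show "p * x \<in> I" if "x \<in> I" for p x using that by (simp add: I_def Pp(2) Pl)
    fix i j assume ij: "i < m" "j < m"
    let ?D = "\<lambda>j. (C ^\<^sub>m L) $$ (i, j) - (?X \<cdot>\<^sub>m 1\<^sub>m m) $$ (i, j)"
    have "(\<Sum>j<m. P (?D j) (u j)) = (s ^^ L) (u i) - (\<Sum>j<m. P ((?X \<cdot>\<^sub>m 1\<^sub>m m) $$ (i, j)) (u j))"
      unfolding sCn[OF ij(1)] by (simp only: Pp(4) sum_subtractf)
    also have "(\<Sum>j<m. P ((?X \<cdot>\<^sub>m 1\<^sub>m m) $$ (i, j)) (u j)) = (\<Sum>j<m. if j = i then a (u i) else 0)"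
      using ij by (intro sum.cong refl) (auto simp: Pp PX)
    also have "(s ^^ L) (u i) - \<dots> = 0" using ij by (simp add: a_def)
    finally show "?D j \<in> I" unfolding I_def using indep[of ?D j] ij(2) by blast
  qed
  then have "det C ^ L - ?X ^ m \<in> I" using C by (simp add: det_pow_mat[of _ m])
  then have "P (det C ^ L) y = P (?X ^ m) y" if "y \<in> W" for y
    using that by (simp add: I_def Pp(4))
  then have "(poly_op (det C) a ^^ L) y = (a ^^ m) y" if "y \<in> W" for y
    using that unfolding P_def poly_op_X_power[OF a] by (simp add: poly_op_power[OF a])
  with m_pos m_le show ?thesis unfolding a_def by blast
qed

end

section \<open>Integral forms and the dual lattice\<close>

text \<open>Only operators on the space are kept: \<open>H\<close> stands for the image of the
  subgroup of order prime to \<open>l\<close>, with \<open>H_card\<close> saying that its order is a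
  unit, and \<open>t\<close> is an operator of \<open>l\<close>-power order normalizing it. The
  group consists of products of these, so its stable lattices and invariant forms are those of
  \<open>H\<close> and \<open>t\<close>.\<close>

locale symplectic_val_space = mixed_val_space scale Basis v l e
  for scale :: "'k::field_char_0 \<Rightarrow> 'v::ab_group_add \<Rightarrow> 'v" (infixr \<open>*s\<close> 75)
    and Basis :: "'v set" and v :: "'k \<Rightarrow> int" and l e :: nat +
  fixes f :: "'v \<Rightarrow> 'v \<Rightarrow> 'k" and H :: "('v \<Rightarrow> 'v) set" and t :: "'v \<Rightarrow> 'v" and k d :: nat
  assumes f_add_left: "f (x + y) z = f x z + f y z"
    and f_add_right: "f x (y + z) = f x y + f x z"
    and f_scale_left: "f (c *s x) y = c * f x y"
    and f_scale_right: "f x (c *s y) = c * f x y"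
    and f_alt [simp]: "f x x = 0"
    and H_lin: "h \<in> H \<Longrightarrow> lin h"
    and H_finite: "finite H"
    and H_id: "(\<lambda>x. x) \<in> H"
    and H_comp: "h \<in> H \<Longrightarrow> h' \<in> H \<Longrightarrow> (\<lambda>x. h (h' x)) \<in> H"
    and H_inv: "h \<in> H \<Longrightarrow> \<exists>h'\<in>H. \<forall>x. h (h' x) = x \<and> h' (h x) = x"
    and H_card: "v (of_nat (card H)) = 0"
    and t_lin: "lin t"
    and t_pow: "(t ^^ (l ^ k)) x = x"
    and t_conj: "h \<in> H \<Longrightarrow> \<exists>h'\<in>H. \<forall>x. t (h x) = h' (t x)"
    and t_conj': "h \<in> H \<Longrightarrow> \<exists>h'\<in>H. \<forall>x. h (t x) = t (h' x)"
    and f_H: "h \<in> H \<Longrightarrow> f (h x) (h y) = f x y"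
    and f_t: "f (t x) (t y) = f x y"
    and l_bound: "d * e + 1 < l"
begin

definition bil :: "('v \<Rightarrow> 'v \<Rightarrow> 'k) \<Rightarrow> bool" where
  "bil g \<longleftrightarrow> (\<forall>x y z. g (x + y) z = g x z + g y z) \<and> (\<forall>x y z. g x (y + z) = g x y + g x z) \<and>
    (\<forall>c x y. g (c *s x) y = c * g x y) \<and> (\<forall>c x y. g x (c *s y) = c * g x y)"

definition stable :: "'v set \<Rightarrow> bool" where
  "stable X \<longleftrightarrow> (\<forall>h\<in>H. \<forall>x\<in>X. h x \<in> X) \<and> (\<forall>x\<in>X. t x \<in> X)"

text \<open>The last two clauses say that \<open>T\<close> is its own dual in \<open>U\<close> under
  \<open>f'\<close>, from which perfectness follows. \<open>f'\<close> is bilinear on the whole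
  space, but otherwise only its values on \<open>U\<close> count.\<close>

definition good :: "'v set \<Rightarrow> bool" where
  "good U \<longleftrightarrow> (\<exists>T f'. lattice U T \<and> stable T \<and> bil f' \<and> (\<forall>x\<in>U. f' x x = 0) \<and>
     (\<forall>h\<in>H. \<forall>x\<in>U. \<forall>y\<in>U. f' (h x) (h y) = f' x y) \<and> (\<forall>x\<in>U. \<forall>y\<in>U. f' (t x) (t y) = f' x y) \<and>
     (\<forall>x\<in>T. \<forall>y\<in>T. f' x y \<in> \<O>) \<and> (\<forall>x\<in>U. (\<forall>y\<in>T. f' x y \<in> \<O>) \<longrightarrow> x \<in> T))"

lemma f_zero [simp]: "f 0 x = 0" "f x 0 = 0"
  using f_scale_left[of 0 0 x] f_scale_right[of x 0 0] by simp_all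

lemma f_skew: "f x y = - f y x"
proof -
  have "f (x + y) (x + y) = (f x x + f x y) + (f y x + f y y)"
    by (simp only: f_add_left f_add_right ac_simps)
  then show ?thesis by (simp add: eq_neg_iff_add_eq_0)
qed

lemma f_minus [simp]: "f (- x) y = - f x y" "f x (- y) = - f x y"
  using f_scale_left[of "- 1" x y] f_scale_right[of x "- 1" y] by simp_all

lemma f_diff: "f (x - y) z = f x z - f y z" "f x (y - z) = f x y - f x z"
  using f_add_left[of x "- y" z] f_add_right[of x y "- z"] by simp_all

lemma f_sum: "f (\<Sum>i\<in>I. g i) x = (\<Sum>i\<in>I. f (g i) x)" "f x (\<Sum>i\<in>I. g i) = (\<Sum>i\<in>I. f x (g i))"
  by (induction I rule: infinite_finite_induct) (simp_all add: f_add_left f_add_right)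

lemma f_sym_O: "f x y \<in> \<O> \<longleftrightarrow> f y x \<in> \<O>"
  using O_minus[of "f x y"] O_minus[of "f y x"] f_skew[of x y] by auto

lemma f_sym_OD: "f x y \<in> \<O> \<Longrightarrow> f y x \<in> \<O>"
  by (simp only: f_sym_O)

lemma stableD: "stable X \<Longrightarrow> h \<in> H \<Longrightarrow> x \<in> X \<Longrightarrow> h x \<in> X" "stable X \<Longrightarrow> x \<in> X \<Longrightarrow> t x \<in> X"
  by (auto simp: stable_def)

lemma stableI: "(\<And>h x. h \<in> H \<Longrightarrow> x \<in> X \<Longrightarrow> h x \<in> X) \<Longrightarrow> (\<And>x. x \<in> X \<Longrightarrow> t x \<in> X) \<Longrightarrow> stable X"
  by (simp add: stable_def)

lemma stable_t_pow: "stable X \<Longrightarrow> x \<in> X \<Longrightarrow> (t ^^ n) x \<in> X"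
  by (induction n) (auto intro: stableD)

lemma stable_scale:
  assumes "stable X" shows "stable (scale c ` X)"
proof (rule stableI)
  fix h x assume h: "h \<in> H" and "x \<in> scale c ` X"
  then obtain y where y: "y \<in> X" "x = c *s y" by auto
  then have "h x = c *s h y" by (simp add: vsp.linear_scale[OF H_lin[OF h]])
  then show "h x \<in> scale c ` X" using stableD(1)[OF assms h y(1)] by (rule image_eqI)
next
  fix x assume "x \<in> scale c ` X"
  then obtain y where y: "y \<in> X" "x = c *s y" by auto
  then have "t x = c *s t y" by (simp add: vsp.linear_scale[OF t_lin])
  then show "t x \<in> scale c ` X" using stableD(2)[OF assms y(1)] by (rule image_eqI)
qed

lemma stable_plus:
  assumes "stable X" "stable Y"
  shows "stable {x + y | x y. x \<in> X \<and> y \<in> Y}"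
proof (rule stableI)
  fix h x assume h: "h \<in> H" and "x \<in> {x + y | x y. x \<in> X \<and> y \<in> Y}"
  then obtain a b where ab: "a \<in> X" "b \<in> Y" "x = a + b" by auto
  then have "h x = h a + h b" by (simp add: vsp.linear_add[OF H_lin[OF h]])
  then show "h x \<in> {x + y | x y. x \<in> X \<and> y \<in> Y}"
    using stableD(1)[OF assms(1) h ab(1)] stableD(1)[OF assms(2) h ab(2)] by auto
next
  fix x assume "x \<in> {x + y | x y. x \<in> X \<and> y \<in> Y}"
  then obtain a b where ab: "a \<in> X" "b \<in> Y" "x = a + b" by auto
  then have "t x = t a + t b" by (simp add: vsp.linear_add[OF t_lin])
  then show "t x \<in> {x + y | x y. x \<in> X \<and> y \<in> Y}"
    using stableD(2)[OF assms(1) ab(1)] stableD(2)[OF assms(2) ab(2)] by auto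
qed

lemma t_inverse: "t ((t ^^ (l ^ k - 1)) x) = x" "(t ^^ (l ^ k - 1)) (t x) = x"
proof -
  have "l ^ k = Suc (l ^ k - 1)" using l(1) by (simp add: prime_gt_0_nat)
  then show "t ((t ^^ (l ^ k - 1)) x) = x" using t_pow[of x] by (metis funpow.simps(2) comp_apply)
  then show "(t ^^ (l ^ k - 1)) (t x) = x" by (simp add: funpow_swap1)
qed

definition nondeg :: "'v set \<Rightarrow> bool" where
  "nondeg U \<longleftrightarrow> subspace U \<and> stable U \<and> (\<forall>x\<in>U. (\<forall>y\<in>U. f x y = 0) \<longrightarrow> x = 0)"

definition dual :: "'v set \<Rightarrow> 'v set \<Rightarrow> 'v set" where
  "dual U T = {x \<in> U. \<forall>y\<in>T. f x y \<in> \<O>}"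

lemma dual_osub: "subspace U \<Longrightarrow> osub (dual U T)"
  unfolding osub_def dual_def
  by (auto simp: subspace_0 subspace_add subspace_scale f_add_left f_scale_left intro: O_add O_mult)

lemma dual_stable:
  assumes "stable U" "stable T"
  shows "stable (dual U T)"
proof (rule stableI)
  fix h x assume h: "h \<in> H" and x: "x \<in> dual U T"
  obtain h' where h': "h' \<in> H" "\<And>x. h (h' x) = x" using H_inv[OF h] by blast
  have "f (h x) y \<in> \<O>" if "y \<in> T" for y
  proof -
    have "f (h x) y = f x (h' y)" using f_H[OF h, of x "h' y"] h'(2)[of y] by simp
    then show ?thesis using x stableD(1)[OF assms(2) h'(1) that] by (simp add: dual_def)
  qed
  then show "h x \<in> dual U T" using x stableD(1)[OF assms(1) h] by (simp add: dual_def)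
next
  fix x assume x: "x \<in> dual U T"
  have "f (t x) y \<in> \<O>" if "y \<in> T" for y
  proof -
    have "f (t x) y = f x ((t ^^ (l ^ k - 1)) y)" using f_t[of x "(t ^^ (l ^ k - 1)) y"] t_inverse[of y] by simp
    then show ?thesis using x stable_t_pow[OF assms(2) that] by (simp add: dual_def)
  qed
  then show "t x \<in> dual U T" using x stableD(2)[OF assms(1)] by (simp add: dual_def)
qed

text \<open>\<open>L\<close> turns the functional \<open>f x\<close> into a vector of
  \<open>U\<close>, so that nondegeneracy becomes injectivity of an endomorphism of
  \<open>U\<close>; preimages of the basis vectors under \<open>L\<close> form the dual
  basis.\<close>

lemma dual_basis_exists:
  assumes U: "nondeg U" and B: "finite B" "independent B" "span B = U"
  shows "\<exists>b'. \<forall>b\<in>B. b' b \<in> U \<and> (\<forall>c\<in>B. f (b' b) c = (if c = b then 1 else 0))"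
proof -
  define L where "L x = (\<Sum>b\<in>B. f x b *s b)" for x
  have L: "lin L" unfolding L_def
    by (rule lin_I) (simp_all add: f_add_left f_scale_left scale_left_distrib sum.distrib scale_sum_right)
  have sub: "subspace U" using U by (simp add: nondeg_def)
  have "L ` U = U"
  proof (rule inj_endo_surj[OF sub L])
    show "L ` U \<subseteq> U" unfolding L_def
      by (intro image_subsetI subspace_sum[OF sub] subspace_scale[OF sub]) (use B(3) span_base in auto)
    fix x assume x: "x \<in> U" "L x = 0"
    have z: "f x b = 0" if "b \<in> B" for b
      using x(2) B that unfolding L_def by (auto simp: independent_explicit)
    have "subspace {y. f x y = 0}" by (auto simp: subspace_def f_add_right f_scale_right)
    then have "span B \<subseteq> {y. f x y = 0}" using z by (intro span_minimal) auto
    then show "x = 0" using U x(1) B(3) by (auto simp: nondeg_def)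
  qed
  have "\<exists>y. y \<in> U \<and> (\<forall>c\<in>B. f y c = (if c = b then 1 else 0))" if b: "b \<in> B" for b
  proof -
    have "b \<in> L ` U" unfolding \<open>L ` U = U\<close> using b B(3) span_base by blast
    then obtain y where y: "y \<in> U" "b = L y" by (rule imageE)
    have "(\<Sum>c\<in>B. (f y c - (if c = b then 1 else 0)) *s c) = L y - (\<Sum>c\<in>B. (if c = b then 1 else 0) *s c)"
      by (simp add: L_def scale_left_diff_distrib sum_subtractf)
    also have "(\<Sum>c\<in>B. (if c = b then 1 else 0) *s c) = (\<Sum>c\<in>B. if c = b then b else 0)"
      by (intro sum.cong refl) auto
    also have "\<dots> = b" using b B(1) by simp
    finally have "(\<Sum>c\<in>B. (f y c - (if c = b then 1 else 0)) *s c) = 0" using y(2) by simp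
    then have "f y c - (if c = b then 1 else 0) = 0" if "c \<in> B" for c
      by (rule independentD[OF B(2,1) order_refl _ that])
    then show ?thesis using y(1) by (intro exI[of _ y]) simp
  qed
  then have "\<forall>b\<in>B. \<exists>y. y \<in> U \<and> (\<forall>c\<in>B. f y c = (if c = b then 1 else 0))" by blast
  from bchoice[OF this] show ?thesis .
qed

text \<open>In terms of a basis of \<open>T\<close>, the dual lattice is spanned by the dual basis,
  and pairing with that basis reads off coordinates, which gives biduality.\<close>

lemma dual_lattice:
  assumes U: "nondeg U" and T: "lattice U T"
  shows "lattice U (dual U T)" "dual U (dual U T) = T"
proof -
  have sub: "subspace U" using U by (simp add: nondeg_def)
  obtain B where B: "finite B" "independent B" "span B = U" "T = ospan B" using lattice_basis[OF T] by blast
  obtain b' where b': "\<And>b. b \<in> B \<Longrightarrow> b' b \<in> U"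
    "\<And>b c. b \<in> B \<Longrightarrow> c \<in> B \<Longrightarrow> f (b' b) c = (if c = b then 1 else 0)"
    using dual_basis_exists[OF U B(1-3)] by blast
  have BT: "B \<subseteq> T" using ospan_superset[OF B(1)] B(4) by simp
  have exp: "x = (\<Sum>b\<in>B. f x b *s b' b)" if x: "x \<in> U" for x
  proof -
    define z where "z = x - (\<Sum>b\<in>B. f x b *s b' b)"
    have zU: "z \<in> U" unfolding z_def
      by (intro subspace_diff[OF sub] x subspace_sum[OF sub] subspace_scale[OF sub] b')
    have "f z c = 0" if c: "c \<in> B" for c
    proof -
      have "f z c = f x c - (\<Sum>b\<in>B. if c = b then f x b else 0)"
        unfolding z_def f_diff f_sum f_scale_left using b' c by (auto intro!: sum.cong)
      then show ?thesis using c B(1) by simp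
    qed
    moreover have "subspace {y. f z y = 0}" by (auto simp: subspace_def f_add_right f_scale_right)
    ultimately have "span B \<subseteq> {y. f z y = 0}" by (intro span_minimal) auto
    then have "z = 0" using U zU B(3) by (auto simp: nondeg_def)
    then show ?thesis by (simp add: z_def)
  qed
  have b'D: "b' b \<in> dual U T" if b: "b \<in> B" for b
  proof -
    have "osub {y. f (b' b) y \<in> \<O>}" unfolding osub_def by (auto simp: f_add_right f_scale_right O_add O_mult)
    then have "T \<subseteq> {y. f (b' b) y \<in> \<O>}" unfolding B(4) using b'(2)[OF b] by (intro ospan_least) auto
    then show ?thesis using b'(1)[OF b] by (auto simp: dual_def)
  qed
  have fin: "finite (b' ` B)" using B by simp
  have D: "dual U T = ospan (b' ` B)"
  proof
    show "ospan (b' ` B) \<subseteq> dual U T" using b'D by (intro ospan_least dual_osub sub) auto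
    show "dual U T \<subseteq> ospan (b' ` B)"
    proof
      fix x assume x: "x \<in> dual U T"
      then have "x = (\<Sum>b\<in>B. f x b *s b' b)" using exp by (simp add: dual_def)
      also have "\<dots> \<in> ospan (b' ` B)"
        using x BT ospan_superset[OF fin] by (intro osub_sum[OF osub_ospan] osub_scale[OF osub_ospan]) (auto simp: dual_def)
      finally show "x \<in> ospan (b' ` B)" .
    qed
  qed
  have "span (b' ` B) = U"
  proof
    show "span (b' ` B) \<subseteq> U" using b'(1) by (intro span_minimal sub) auto
    show "U \<subseteq> span (b' ` B)"
    proof
      fix x assume "x \<in> U"
      then have "x = (\<Sum>b\<in>B. f x b *s b' b)" by (rule exp)
      also have "\<dots> \<in> span (b' ` B)" by (intro span_sum span_scale span_base imageI)
      finally show "x \<in> span (b' ` B)" .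
    qed
  qed
  with D fin show "lattice U (dual U T)" unfolding lattice_def by blast
  show "dual U (dual U T) = T"
  proof
    show "T \<subseteq> dual U (dual U T)"
      using lattice_subset[OF T] f_sym_O by (auto simp: dual_def)
    show "dual U (dual U T) \<subseteq> T"
    proof
      fix y assume y: "y \<in> dual U (dual U T)"
      then have "y \<in> span B" using B(3) by (simp add: dual_def)
      then obtain c where c: "y = (\<Sum>b\<in>B. c b *s b)" using span_finite[OF B(1)] by auto
      have "c b \<in> \<O>" if b: "b \<in> B" for b
      proof -
        have "f (b' b) y = (\<Sum>a\<in>B. if a = b then c b else 0)"
          unfolding c f_sum f_scale_right using b'(2)[OF b] by (intro sum.cong refl) auto
        then have "f (b' b) y = c b" using b B(1) by simp
        then show ?thesis using y b'D[OF b] f_sym_O[of y "b' b"] by (auto simp: dual_def)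
      qed
      then show "y \<in> T" unfolding B(4) ospan_def using c by blast
    qed
  qed
qed

text \<open>\<open>P\<close> lifts the projection of the reduction of \<open>T\<close> onto the radical of the reduced form.\<close>

lemma good_from_projection:
  assumes U: "nondeg U" and T: "lattice U T" "stable T"
    and TD: "T \<subseteq> dual U T" "scale unif ` dual U T \<subseteq> T"
    and P: "lin P" "\<And>x. x \<in> U \<Longrightarrow> P x \<in> U" "\<And>h x. h \<in> H \<Longrightarrow> x \<in> U \<Longrightarrow> P (h x) = h (P x)" "\<And>x. x \<in> U \<Longrightarrow> P (t x) = t (P x)"
      "\<And>x. x \<in> T \<Longrightarrow> P x \<in> scale unif ` dual U T"
      "\<And>x. x \<in> scale unif ` dual U T \<Longrightarrow> P x - x \<in> scale unif ` T"
  shows "good U"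
proof -
  let ?D = "dual U T"
  define f' where "f' x y = f x y + inverse unif * f (P x) (P y)" for x y
  have bil: "bil f'" unfolding bil_def f'_def
    by (simp add: vsp.linear_add[OF P(1)] vsp.linear_scale[OF P(1)] f_add_left f_add_right f_scale_left f_scale_right
      algebra_simps)
  have u0: "unif \<noteq> 0" by simp
  have iu: "inverse unif * (unif * a) = a" for a by (simp flip: mult.assoc)
  have Ddef: "f x y \<in> \<O>" if "x \<in> ?D" "y \<in> T" for x y using that by (simp add: dual_def)
  have Ddef': "f y x \<in> \<O>" if "x \<in> ?D" "y \<in> T" for x y using Ddef[OF that] f_sym_O by simp
  have fP: "inverse unif * f (P x) (P y) = f q (P y)" if "P x = unif *s q" for x y q
    using that by (simp add: f_scale_left)
  have int: "f' x y \<in> \<O>" if xy: "x \<in> T" "y \<in> T" for x y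
  proof -
    obtain q where q: "q \<in> ?D" "P x = unif *s q" using P(5)[OF xy(1)] by auto
    have "P y \<in> T" using P(5)[OF xy(2)] TD(2) by blast
    then have "f q (P y) \<in> \<O>" using Ddef q by blast
    moreover have "f x y \<in> \<O>" using TD(1) xy Ddef by blast
    ultimately show ?thesis unfolding f'_def fP[OF q(2)] by (rule O_add[rotated])
  qed
  \<comment> \<open>The reduction of \<open>f'\<close> is nondegenerate. Testing against
    \<open>y = unif *s z\<close> with \<open>z\<close> in the dual puts \<open>q\<close> into the
    bidual \<open>T\<close>; then arbitrary \<open>y\<close> show that \<open>x\<close> lies in
    \<open>unif\<close> times the dual, where \<open>P\<close> is the identity modulo
    \<open>unif T\<close>.\<close>
  have mod: "x \<in> scale unif ` T" if x: "x \<in> T" and F: "\<And>y. y \<in> T \<Longrightarrow> inverse unif * f' x y \<in> \<O>" for x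
  proof -
    obtain q where q: "q \<in> ?D" "P x = unif *s q" using P(5)[OF x] by auto
    have f'q: "f' x y = f x y + f q (P y)" for y unfolding f'_def fP[OF q(2)] ..
    have "q \<in> dual U ?D"
    proof -
      have "f q z \<in> \<O>" if z: "z \<in> ?D" for z
      proof -
        define y where "y = unif *s z"
        have yD: "y \<in> scale unif ` ?D" unfolding y_def using z by (rule imageI)
        then have yT: "y \<in> T" using TD(2) by blast
        obtain w where w: "w \<in> T" "P y - y = unif *s w" using P(6)[OF yD] by auto
        have Py: "P y = unif *s (z + w)" using w(2) by (simp add: y_def scale_right_distrib algebra_simps)
        have "inverse unif * f' x y = f x z + f q z + f q w"
          unfolding f'q Py by (simp add: y_def f_scale_right f_add_right distrib_left iu)
        then have "f q z = inverse unif * f' x y - f x z - f q w" by simp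
        also have "\<dots> \<in> \<O>" using F[OF yT] Ddef'[OF z x] Ddef[OF q(1) w(1)] by (intro O_diff)
        finally show ?thesis .
      qed
      then show ?thesis using q(1) by (simp add: dual_def)
    qed
    then have qT: "q \<in> T" using dual_lattice(2)[OF U T(1)] by simp
    have "inverse unif *s x \<in> ?D"
    proof -
      have "f (inverse unif *s x) y \<in> \<O>" if y: "y \<in> T" for y
      proof -
        obtain r where r: "r \<in> ?D" "P y = unif *s r" using P(5)[OF y] by auto
        have "f (inverse unif *s x) y = inverse unif * f' x y - f q r"
          unfolding f'q r(2) by (simp add: f_scale_left f_scale_right distrib_left iu)
        also have "\<dots> \<in> \<O>" using F[OF y] Ddef'[OF r(1) qT] by (intro O_diff)
        finally show ?thesis .
      qed
      moreover have "inverse unif *s x \<in> U"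
        using x lattice_subset[OF T(1)] U by (auto simp: nondeg_def intro: subspace_scale)
      ultimately show ?thesis by (simp add: dual_def)
    qed
    then have "x \<in> scale unif ` ?D" by (intro image_eqI[of _ _ "inverse unif *s x"]) auto
    from P(6)[OF this] obtain w where w: "w \<in> T" "P x - x = unif *s w" by auto
    have "x = unif *s (q - w)" using w(2) q(2) by (simp add: scale_right_diff_distrib algebra_simps)
    moreover have "q - w \<in> T" using qT w(1) lattice_osub[OF T(1)] by (intro osub_diff)
    ultimately show ?thesis by (rule image_eqI)
  qed
  \<comment> \<open>Descent on \<open>n\<close> with \<open>unif ^ n *s x\<close> in
    \<open>T\<close>: as long as \<open>n > 0\<close>, the previous claim removes a factor
    \<open>unif\<close>.\<close>
  have perf: "x \<in> T" if x: "x \<in> U" "\<And>y. y \<in> T \<Longrightarrow> f' x y \<in> \<O>" for x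
  proof -
    have "x \<in> T" if "unif ^ n *s x \<in> T" for n
      using that
    proof (induction n)
      case (Suc n)
      have "unif ^ Suc n *s x \<in> scale unif ` T"
      proof (rule mod[OF Suc.prems])
        fix y assume "y \<in> T"
        have "f' (unif ^ Suc n *s x) y = unif ^ Suc n * f' x y" using bil unfolding bil_def by blast
        then have "inverse unif * f' (unif ^ Suc n *s x) y = unif ^ n * f' x y" by simp
        then show "inverse unif * f' (unif ^ Suc n *s x) y \<in> \<O>"
          using x(2)[OF \<open>y \<in> T\<close>] by (simp add: O_mult O_power)
      qed
      then obtain z where z: "z \<in> T" "unif ^ Suc n *s x = unif *s z" by auto
      then have "unif *s (unif ^ n *s x) = unif *s z" by simp
      then have "unif ^ n *s x = z" using scale_left_imp_eq[OF u0] by blast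
      with z(1) Suc.IH show ?case by simp
    qed simp
    then show ?thesis using lattice_absorbs[OF T(1) x(1)] by blast
  qed
  show ?thesis unfolding good_def
  proof (intro exI conjI)
    show "lattice U T" "stable T" "bil f'" by (fact T bil)+
    show "\<forall>x\<in>U. f' x x = 0" by (simp add: f'_def)
    show "\<forall>h\<in>H. \<forall>x\<in>U. \<forall>y\<in>U. f' (h x) (h y) = f' x y" by (simp add: f'_def P f_H)
    show "\<forall>x\<in>U. \<forall>y\<in>U. f' (t x) (t y) = f' x y" by (simp add: f'_def P f_t)
    show "\<forall>x\<in>T. \<forall>y\<in>T. f' x y \<in> \<O>" using int by blast
    show "\<forall>x\<in>U. (\<forall>y\<in>T. f' x y \<in> \<O>) \<longrightarrow> x \<in> T" using perf by blast
  qed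
qed

section \<open>Stable lattices and maximal integral lattices\<close>

lemma t_pow_conj: "h \<in> H \<Longrightarrow> \<exists>h'\<in>H. \<forall>x. (t ^^ i) (h x) = h' ((t ^^ i) x)"
proof (induction i)
  case 0
  then show ?case by (intro bexI[of _ h]) auto
next
  case (Suc i)
  then obtain h' where h': "h' \<in> H" "\<And>x. (t ^^ i) (h x) = h' ((t ^^ i) x)" by blast
  obtain h'' where "h'' \<in> H" "\<And>x. t (h' x) = h'' (t x)" using t_conj[OF h'(1)] by blast
  with h' show ?case by (intro bexI[of _ h'']) auto
qed

lemma t_pow_conj': "h \<in> H \<Longrightarrow> \<exists>h'\<in>H. \<forall>x. h ((t ^^ i) x) = (t ^^ i) (h' x)"
proof (induction i arbitrary: h)
  case 0
  then show ?case by (intro bexI[of _ h]) auto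
next
  case (Suc i)
  obtain h' where h': "h' \<in> H" "\<And>x. h (t x) = t (h' x)" using t_conj'[OF Suc.prems] by blast
  obtain h'' where "h'' \<in> H" "\<And>x. h' ((t ^^ i) x) = (t ^^ i) (h'' x)" using Suc.IH[OF h'(1)] by blast
  with h' show ?case by (intro bexI[of _ h'']) auto
qed

lemma stable_lattice:
  assumes U: "subspace U" "stable U"
  shows "\<exists>T. lattice U T \<and> stable T"
proof -
  define \<Gamma> where "\<Gamma> = (\<lambda>(h, i) x. h ((t ^^ i) x)) ` (H \<times> {..<l ^ k})"
  have lk: "l ^ k > 0" using l(1) by (simp add: prime_gt_0_nat)
  have \<Gamma>I: "(\<lambda>x. h ((t ^^ i) x)) \<in> \<Gamma>" if "h \<in> H" for h i
  proof -
    have "(t ^^ i) x = (t ^^ (i mod l ^ k)) x" for x using funpow_mod_eq[OF t_pow, of i x] by simp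
    then have "(\<lambda>x. h ((t ^^ i) x)) = (\<lambda>(h, i) x. h ((t ^^ i) x)) (h, i mod l ^ k)" by simp
    moreover have "(h, i mod l ^ k) \<in> H \<times> {..<l ^ k}" using that lk by simp
    ultimately show ?thesis unfolding \<Gamma>_def by (rule image_eqI)
  qed
  have \<Gamma>E: "\<exists>h\<in>H. \<exists>i. g = (\<lambda>x. h ((t ^^ i) x))" if g: "g \<in> \<Gamma>" for g
  proof -
    obtain z where "g = (\<lambda>(h, i) x. h ((t ^^ i) x)) z" "z \<in> H \<times> {..<l ^ k}"
      using g unfolding \<Gamma>_def by (rule imageE)
    then show ?thesis
      by (intro bexI[of _ "fst z"] exI[of _ "snd z"]) (auto simp: case_prod_beta)
  qed
  have "\<exists>T. lattice U T \<and> (\<forall>g\<in>\<Gamma>. g ` T \<subseteq> T)"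
  proof (rule stable_lattice_exists[OF U(1)])
    show "finite \<Gamma>" unfolding \<Gamma>_def using H_finite by simp
    show "lin g" if g: "g \<in> \<Gamma>" for g
    proof -
      obtain h i where "h \<in> H" "g = (\<lambda>x. h ((t ^^ i) x))" using \<Gamma>E[OF g] by blast
      then show ?thesis
        by (auto intro!: lin_I simp: vsp.linear_add[OF lin_funpow[OF t_lin]] vsp.linear_scale[OF lin_funpow[OF t_lin]]
          vsp.linear_add[OF H_lin] vsp.linear_scale[OF H_lin])
    qed
    show "g ` U \<subseteq> U" if g: "g \<in> \<Gamma>" for g
    proof -
      obtain h i where "h \<in> H" "g = (\<lambda>x. h ((t ^^ i) x))" using \<Gamma>E[OF g] by blast
      then show ?thesis using stableD(1)[OF U(2)] stable_t_pow[OF U(2)] by auto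
    qed
    show "(\<lambda>x. x) \<in> \<Gamma>" using \<Gamma>I[OF H_id, of 0] by simp
    show "\<exists>g\<in>\<Gamma>. \<forall>x\<in>U. g1 (g2 x) = g x" if g: "g1 \<in> \<Gamma>" "g2 \<in> \<Gamma>" for g1 g2
    proof -
      obtain h i where 1: "h \<in> H" "g1 = (\<lambda>x. h ((t ^^ i) x))" using \<Gamma>E[OF g(1)] by blast
      obtain h' j where 2: "h' \<in> H" "g2 = (\<lambda>x. h' ((t ^^ j) x))" using \<Gamma>E[OF g(2)] by blast
      obtain h'' where h'': "h'' \<in> H" "\<And>x. (t ^^ i) (h' x) = h'' ((t ^^ i) x)"
        using t_pow_conj[OF 2(1)] by blast
      have "g1 (g2 x) = h (h'' ((t ^^ (i + j)) x))" for x by (simp add: 1 2 h'' funpow_add)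
      moreover have "(\<lambda>x. h (h'' ((t ^^ (i + j)) x))) \<in> \<Gamma>" using \<Gamma>I[OF H_comp[OF 1(1) h''(1)]] .
      ultimately show ?thesis by (intro bexI[of _ "\<lambda>x. h (h'' ((t ^^ (i + j)) x))"]) auto
    qed
  qed
  then obtain T where T: "lattice U T" "\<And>g x. g \<in> \<Gamma> \<Longrightarrow> x \<in> T \<Longrightarrow> g x \<in> T" by blast
  have "stable T"
  proof (rule stableI)
    show "h x \<in> T" if "h \<in> H" "x \<in> T" for h x using T(2)[OF \<Gamma>I[OF that(1), of 0] that(2)] by simp
    show "t x \<in> T" if "x \<in> T" for x using T(2)[OF \<Gamma>I[OF H_id, of 1] that] by simp
  qed
  with T(1) show ?thesis by blast
qed

text \<open>Zorn's lemma gives a maximal stable module \<open>T\<close> on which \<open>f\<close> is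
  integral. Maximality forces \<open>unif\<close> times the dual into \<open>T\<close>: otherwise
  adding a suitable multiple of the dual would keep the form integral.\<close>

lemma maximal_lattice:
  assumes U: "nondeg U"
  shows "\<exists>T. lattice U T \<and> stable T \<and> T \<subseteq> dual U T \<and> scale unif ` dual U T \<subseteq> T \<and>
    (\<forall>X. osub X \<longrightarrow> stable X \<longrightarrow> T \<subseteq> X \<longrightarrow> X \<subseteq> U \<longrightarrow> (\<forall>x\<in>X. \<forall>y\<in>X. f x y \<in> \<O>) \<longrightarrow> X = T)"
proof -
  have sub: "subspace U" and stU: "stable U" using U by (auto simp: nondeg_def)
  obtain T0 where T0: "lattice U T0" "stable T0" using stable_lattice[OF sub stU] by blast
  obtain n where n: "scale (unif ^ n) ` T0 \<subseteq> dual U T0"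
    using lattice_absorbs_lattice[OF dual_lattice(1)[OF U T0(1)] T0(1)] by blast
  define T1 where "T1 = scale (unif ^ n) ` T0"
  have T1: "lattice U T1" "stable T1" unfolding T1_def by (auto intro: lattice_scale T0 stable_scale)
  have int1: "f x y \<in> \<O>" if xy: "x \<in> T1" "y \<in> T1" for x y
  proof -
    obtain y' where y': "y' \<in> T0" "y = unif ^ n *s y'" using xy(2) unfolding T1_def by blast
    have "x \<in> dual U T0" using n xy(1) unfolding T1_def by blast
    then have "f x y' \<in> \<O>" using y' by (simp add: dual_def)
    then show ?thesis unfolding y'(2) f_scale_right by (intro O_mult O_power) auto
  qed
  define \<X> where "\<X> = {X. osub X \<and> stable X \<and> T1 \<subseteq> X \<and> X \<subseteq> U \<and> (\<forall>x\<in>X. \<forall>y\<in>X. f x y \<in> \<O>)}"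
  have "\<exists>M\<in>\<X>. \<forall>X\<in>\<X>. M \<subseteq> X \<longrightarrow> X = M"
  proof (rule subset_Zorn_nonempty)
    have "T1 \<in> \<X>" unfolding \<X>_def using T1 lattice_osub lattice_subset int1 by blast
    then show "\<X> \<noteq> {}" by blast
    fix \<C> assume C: "\<C> \<noteq> {}" "subset.chain \<X> \<C>"
    have CX: "X \<in> \<X>" if "X \<in> \<C>" for X using C(2) that by (auto simp: subset_chain_def)
    have two: "\<exists>X\<in>\<C>. x \<in> X \<and> y \<in> X" if xy: "x \<in> \<Union>\<C>" "y \<in> \<Union>\<C>" for x y
    proof -
      obtain X Y where XY: "X \<in> \<C>" "x \<in> X" "Y \<in> \<C>" "y \<in> Y" using xy by blast
      then have "X \<subseteq> Y \<or> Y \<subseteq> X" using C(2) by (auto simp: subset_chain_def)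
      then show ?thesis using XY by auto
    qed
    have "osub (\<Union>\<C>)" unfolding osub_def
    proof (intro conjI ballI)
      obtain X where "X \<in> \<C>" using C(1) by blast
      then show "0 \<in> \<Union>\<C>" using CX[of X] osub_0 by (auto simp: \<X>_def)
      show "x + y \<in> \<Union>\<C>" if xy: "x \<in> \<Union>\<C>" "y \<in> \<Union>\<C>" for x y
      proof -
        obtain X where X: "X \<in> \<C>" "x \<in> X" "y \<in> X" using two[OF xy] by blast
        then have "x + y \<in> X" using CX[OF X(1)] osub_add by (auto simp: \<X>_def)
        with X(1) show ?thesis by blast
      qed
      show "c *s x \<in> \<Union>\<C>" if cx: "c \<in> \<O>" "x \<in> \<Union>\<C>" for c x
      proof -
        obtain X where X: "X \<in> \<C>" "x \<in> X" using cx by blast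
        then have "c *s x \<in> X" using CX[OF X(1)] osub_scale cx(1) by (auto simp: \<X>_def)
        with X(1) show ?thesis by blast
      qed
    qed
    moreover have "stable (\<Union>\<C>)"
    proof (rule stableI)
      show "h x \<in> \<Union>\<C>" if hx: "h \<in> H" "x \<in> \<Union>\<C>" for h x
      proof -
        obtain X where X: "X \<in> \<C>" "x \<in> X" using hx by blast
        then have "h x \<in> X" using CX[OF X(1)] stableD(1) hx(1) by (auto simp: \<X>_def)
        with X(1) show ?thesis by blast
      qed
      show "t x \<in> \<Union>\<C>" if hx: "x \<in> \<Union>\<C>" for x
      proof -
        obtain X where X: "X \<in> \<C>" "x \<in> X" using hx by blast
        then have "t x \<in> X" using CX[OF X(1)] stableD(2) by (auto simp: \<X>_def)
        with X(1) show ?thesis by blast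
      qed
    qed
    moreover have "T1 \<subseteq> \<Union>\<C>"
    proof -
      obtain X where X: "X \<in> \<C>" using C(1) by blast
      then have "T1 \<subseteq> X" using CX[OF X] by (simp add: \<X>_def)
      then show ?thesis using Union_upper[OF X] by (rule subset_trans)
    qed
    moreover have "\<Union>\<C> \<subseteq> U"
      using CX unfolding \<X>_def by (intro Union_least) simp
    moreover have "f x y \<in> \<O>" if xy: "x \<in> \<Union>\<C>" "y \<in> \<Union>\<C>" for x y
    proof -
      obtain X where X: "X \<in> \<C>" "x \<in> X" "y \<in> X" using two[OF xy] by blast
      then show ?thesis using CX[OF X(1)] by (simp add: \<X>_def)
    qed
    ultimately show "\<Union>\<C> \<in> \<X>" unfolding \<X>_def by simp
  qed
  then obtain T where T: "T \<in> \<X>" and max: "\<And>X. X \<in> \<X> \<Longrightarrow> T \<subseteq> X \<Longrightarrow> X = T" by blast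
  have T': "osub T" "stable T" "T1 \<subseteq> T" "T \<subseteq> U" "\<And>x y. x \<in> T \<Longrightarrow> y \<in> T \<Longrightarrow> f x y \<in> \<O>"
    using T by (auto simp: \<X>_def)
  \<comment> \<open>Integrality against \<open>T1\<close> bounds \<open>T\<close> by the dual of
    \<open>T1\<close>, and a module between two lattices is a lattice.\<close>
  have "T \<subseteq> dual U T1" using T' by (auto simp: dual_def)
  then have lat: "lattice U T"
    using lattice_between[OF T1(1) dual_lattice(1)[OF U T1(1)] T'(1,3)] by blast
  have TD: "T \<subseteq> dual U T" using T' by (auto simp: dual_def)
  let ?D = "dual U T"
  note latD = dual_lattice(1)[OF U lat]
  have stD: "stable ?D" by (rule dual_stable[OF stU T'(2)])
  have DU: "?D \<subseteq> U" by (auto simp: dual_def)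
  \<comment> \<open>The exponents satisfy 2 (m + 1) = m + (m + 2), so \<open>T + Y\<close> is
    integral and hence equals \<open>T\<close>. The argument breaks down at exponent 0, so the
    descent ends at \<open>unif\<close> times the dual.\<close>
  have step: "scale (unif ^ Suc m) ` ?D \<subseteq> T" if m: "scale (unif ^ Suc (Suc m)) ` ?D \<subseteq> T" for m
  proof -
    define Y where "Y = scale (unif ^ Suc m) ` ?D"
    have Y: "osub Y" "stable Y" "Y \<subseteq> U"
      unfolding Y_def using stable_scale[OF stD] osub_scale_image[OF lattice_osub[OF latD]]
        subspace_scale[OF sub] DU by auto
    define X where "X = {x + y | x y. x \<in> T \<and> y \<in> Y}"
    have TX: "T \<subseteq> X"
    proof
      fix x assume "x \<in> T"
      then have "x + 0 \<in> X" unfolding X_def using osub_0[OF Y(1)] by blast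
      then show "x \<in> X" by simp
    qed
    have YX: "Y \<subseteq> X"
    proof
      fix x assume "x \<in> Y"
      then have "0 + x \<in> X" unfolding X_def using osub_0[OF T'(1)] by blast
      then show "x \<in> X" by simp
    qed
    have TY: "f x y \<in> \<O>" if "x \<in> T" "y \<in> Y" for x y
    proof -
      obtain z where z: "z \<in> ?D" "y = unif ^ Suc m *s z" using \<open>y \<in> Y\<close> unfolding Y_def by blast
      have "f z x \<in> \<O>" using z(1) \<open>x \<in> T\<close> by (simp add: dual_def)
      then have "f x z \<in> \<O>" by (rule f_sym_OD)
      then show ?thesis unfolding z(2) f_scale_right by (intro O_mult O_power) auto
    qed
    have YY: "f x y \<in> \<O>" if "x \<in> Y" "y \<in> Y" for x y
    proof -
      obtain z where z: "z \<in> ?D" "y = unif ^ Suc m *s z" using \<open>y \<in> Y\<close> unfolding Y_def by blast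
      obtain w where w: "w \<in> ?D" "x = unif ^ Suc m *s w" using \<open>x \<in> Y\<close> unfolding Y_def by blast
      have "unif ^ Suc (Suc m) *s z \<in> T" using m z(1) by blast
      then have "unif ^ m *s (unif ^ Suc (Suc m) *s z) \<in> T" by (rule osub_scale[OF T'(1) O_power[OF O_unif]])
      then have "f w (unif ^ m *s (unif ^ Suc (Suc m) *s z)) \<in> \<O>" using w(1) by (simp add: dual_def)
      then show ?thesis unfolding z(2) w(2) f_scale_right f_scale_left by (simp add: mult.commute mult.left_commute)
    qed
    have "X \<in> \<X>" unfolding \<X>_def
    proof (intro CollectI conjI ballI)
      show "osub X" unfolding X_def by (rule osub_plus[OF T'(1) Y(1)])
      show "stable X" unfolding X_def by (rule stable_plus[OF T'(2) Y(2)])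
      show "T1 \<subseteq> X" using T'(3) TX by simp
      show "X \<subseteq> U"
      proof
        fix z assume "z \<in> X"
        then obtain a b where "a \<in> T" "b \<in> Y" "z = a + b" unfolding X_def by auto
        then show "z \<in> U" using T'(4) Y(3) subspace_add[OF sub, of a b] by auto
      qed
      fix x y assume "x \<in> X" "y \<in> X"
      then obtain a b c d where abcd: "a \<in> T" "b \<in> Y" "x = a + b" "c \<in> T" "d \<in> Y" "y = c + d"
        unfolding X_def by auto
      have "f b c \<in> \<O>" using TY[OF abcd(4,2)] by (rule f_sym_OD)
      then show "f x y \<in> \<O>" unfolding abcd f_add_left f_add_right
        using T'(5)[OF abcd(1,4)] TY[OF abcd(1,5)] YY[OF abcd(2,5)] by (intro O_add)
    qed
    from max[OF this TX] YX show ?thesis unfolding Y_def by simp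
  qed
  have "scale unif ` ?D \<subseteq> T"
  proof -
    have "scale (unif ^ Suc 0) ` ?D \<subseteq> T" if "scale (unif ^ Suc m) ` ?D \<subseteq> T" for m
      using that
    proof (induction m)
      case (Suc m)
      from Suc.IH[OF step[OF Suc.prems]] show ?case .
    qed
    moreover obtain m where "scale (unif ^ m) ` ?D \<subseteq> T" using lattice_absorbs_lattice[OF lat latD] by blast
    then have "scale (unif ^ Suc m) ` ?D \<subseteq> T"
      using unif_power_image_mono[OF lattice_osub[OF latD], of m "Suc m"] by simp
    ultimately show ?thesis by simp
  qed
  moreover have "X = T" if "osub X" "stable X" "T \<subseteq> X" "X \<subseteq> U" "\<forall>x\<in>X. \<forall>y\<in>X. f x y \<in> \<O>" for X
    using max[of X] that T'(3) by (auto simp: \<X>_def)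
  ultimately show ?thesis using lat T'(2) TD by blast
qed

section \<open>Averaging over \<open>H\<close>, whose order is a unit\<close>

lemma H_card_pos: "card H > 0"
  using H_id H_finite by (auto simp: card_gt_0_iff)

abbreviation "Hinv h \<equiv> inv_into UNIV h"

lemma H_inv_mem: "h \<in> H \<Longrightarrow> Hinv h \<in> H" and H_inv_left: "h \<in> H \<Longrightarrow> Hinv h (h x) = x"
  and H_inv_right: "h \<in> H \<Longrightarrow> h (Hinv h x) = x"
proof -
  assume "h \<in> H"
  then obtain h' where h': "h' \<in> H" "\<And>x. h (h' x) = x" "\<And>x. h' (h x) = x" using H_inv by blast
  have "Hinv h = h'" by (rule inv_equality) (use h' in auto)
  then show "Hinv h \<in> H" "Hinv h (h x) = x" "h (Hinv h x) = x" using h' by auto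
qed

text \<open>The average of the conjugates of \<open>P\<close> by \<open>H\<close>, that is, the
  Reynolds operator on endomorphisms. It preserves integrality because the order of \<open>H\<close>
  is a unit.\<close>

definition avg :: "('v \<Rightarrow> 'v) \<Rightarrow> 'v \<Rightarrow> 'v" where
  "avg P x = inverse (of_nat (card H)) *s (\<Sum>h\<in>H. h (P (Hinv h x)))"

lemma avg_lin: "lin P \<Longrightarrow> lin (avg P)"
  unfolding avg_def
  by (rule lin_I) (simp_all add: vsp.linear_add[OF H_lin] vsp.linear_scale[OF H_lin] H_inv_mem
      vsp.linear_add[of P] vsp.linear_scale[of P] sum.distrib scale_right_distrib mult.commute flip: scale_sum_right)

lemma avg_commute:
  assumes g: "g \<in> H"
  shows "avg P (g x) = g (avg P x)"
proof -
  have "(\<Sum>h\<in>H. h (P (Hinv h (g x)))) = (\<Sum>h\<in>H. g (h (P (Hinv h x))))"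
  proof (rule sum.reindex_bij_witness[of _ "\<lambda>h x. g (h x)" "\<lambda>h x. Hinv g (h x)"])
    fix h assume h: "h \<in> H"
    show "(\<lambda>x. g (Hinv g (h x))) = h" "(\<lambda>x. Hinv g (g (h x))) = h"
      by (simp_all add: H_inv_left[OF g] H_inv_right[OF g])
    show gh: "(\<lambda>x. Hinv g (h x)) \<in> H" "(\<lambda>x. g (h x)) \<in> H"
      using H_comp g h H_inv_mem by blast+
    have "Hinv (\<lambda>x. Hinv g (h x)) x = Hinv h (g x)"
    proof -
      have "(\<lambda>x. Hinv g (h x)) (Hinv h (g x)) = x" by (simp add: H_inv_right[OF h] H_inv_left[OF g])
      then show ?thesis using H_inv_left[OF gh(1), of "Hinv h (g x)"] by simp
    qed
    then show "g (Hinv g (h (P (Hinv (\<lambda>x. Hinv g (h x)) x)))) = h (P (Hinv h (g x)))"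
      by (simp add: H_inv_right[OF g])
  qed
  then show ?thesis
    unfolding avg_def by (simp add: vsp.linear_scale[OF H_lin[OF g]] vsp.linear_sum[OF H_lin[OF g]])
qed

lemma inverse_card_O: "inverse (of_nat (card H)) \<in> \<O>"
  using H_card H_card_pos by (simp add: O_iff v_inverse)

lemma avg_in:
  assumes "osub Y" "\<And>h y. h \<in> H \<Longrightarrow> y \<in> Y \<Longrightarrow> h y \<in> Y" "\<And>h x. h \<in> H \<Longrightarrow> x \<in> X \<Longrightarrow> h x \<in> X"
    "\<And>x. x \<in> X \<Longrightarrow> P x \<in> Y" "x \<in> X"
  shows "avg P x \<in> Y"
  unfolding avg_def using assms H_inv_mem
  by (intro osub_scale[OF assms(1)] osub_sum[OF assms(1)] inverse_card_O) blast

lemma avg_id: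
  assumes "osub Y" "\<And>h y. h \<in> H \<Longrightarrow> y \<in> Y \<Longrightarrow> h y \<in> Y" "\<And>h x. h \<in> H \<Longrightarrow> x \<in> X \<Longrightarrow> h x \<in> X"
    "\<And>x. x \<in> X \<Longrightarrow> P x - x \<in> Y" "x \<in> X"
  shows "avg P x - x \<in> Y"
proof -
  have "avg (\<lambda>x. P x - x) x \<in> Y" by (rule avg_in[of Y X]) (use assms in blast)+
  moreover have "avg (\<lambda>x. P x - x) x = avg P x - x"
  proof -
    have "(\<Sum>h\<in>H. h (P (Hinv h x) - Hinv h x)) = (\<Sum>h\<in>H. h (P (Hinv h x)) - x)"
      by (intro sum.cong refl) (simp add: vsp.linear_diff[OF H_lin] H_inv_right)
    also have "\<dots> = (\<Sum>h\<in>H. h (P (Hinv h x))) - of_nat (card H) *s x"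
      by (simp add: sum_subtractf sum_constant_scale)
    finally show ?thesis using H_card_pos by (simp add: avg_def scale_right_diff_distrib)
  qed
  ultimately show ?thesis by simp
qed

text \<open>The retraction of \<open>T\<close> onto \<open>unif\<close> times the dual, modulo
  \<open>unif T\<close>, is averaged over \<open>H\<close>; all lattices involved are
  \<open>H\<close>-stable, so its congruences survive.\<close>

lemma H_projection:
  assumes U: "nondeg U" and T: "lattice U T" "stable T"
    and TD: "T \<subseteq> dual U T" "scale unif ` dual U T \<subseteq> T"
  shows "\<exists>P. lin P \<and> (\<forall>x\<in>U. P x \<in> U) \<and> (\<forall>h\<in>H. \<forall>x. P (h x) = h (P x)) \<and>
      (\<forall>x\<in>T. P x \<in> scale unif ` dual U T) \<and> (\<forall>x\<in>scale unif ` dual U T. P x - x \<in> scale unif ` T)"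
proof -
  let ?X = "scale unif ` dual U T"
  have stU: "stable U" and sub: "subspace U" using U by (auto simp: nondeg_def)
  have latD: "lattice U (dual U T)" by (rule dual_lattice(1)[OF U T(1)])
  have latX: "lattice U ?X" by (intro lattice_scale latD) simp
  have stX: "stable ?X" by (intro stable_scale dual_stable stU T(2))
  have stT: "stable (scale unif ` T)" by (intro stable_scale T(2))
  obtain B where B: "finite B" "independent B" "span B = U" "T = ospan B" using lattice_basis[OF T(1)] by blast
  have "scale unif ` T \<subseteq> ?X" using TD(1) by (rule image_mono)
  then obtain P where P: "lin P" "P ` T \<subseteq> ?X" "\<forall>x\<in>?X. P x - x \<in> scale unif ` T"
    using split_mod_unif[OF B(1,2) lattice_osub[OF latX]] TD(2) B(4) by blast
  have PU: "P x \<in> U" if "x \<in> U" for x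
  proof -
    have "B \<subseteq> {x. P x \<in> U}" using P(2) lattice_subset[OF latX] ospan_superset[OF B(1)] B(4) by blast
    then have "span B \<subseteq> {x. P x \<in> U}"
      by (intro span_minimal vsp.linear_subspace_vimage[OF P(1) sub, unfolded vimage_def])
    with that B(3) show ?thesis by blast
  qed
  show ?thesis
  proof (intro exI[of _ "avg P"] conjI ballI allI)
    show "lin (avg P)" by (rule avg_lin[OF P(1)])
    show "avg P x \<in> U" if xU: "x \<in> U" for x
      by (rule avg_in[of U U P x]) (use osub_subspace[OF sub] stableD(1)[OF stU] PU xU in auto)
    show "avg P (h x) = h (avg P x)" if h: "h \<in> H" for h x by (rule avg_commute[OF h])
    show "avg P x \<in> ?X" if xT: "x \<in> T" for x
      by (rule avg_in[of ?X T P x])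
        (use lattice_osub[OF latX] stableD(1)[OF stX] stableD(1)[OF T(2)] P(2) xT in blast)+
    show "avg P x - x \<in> scale unif ` T" if xX: "x \<in> ?X" for x
      by (rule avg_id[of "scale unif ` T" ?X P x])
        (use osub_scale_image[OF lattice_osub[OF T(1)]] stableD(1)[OF stT] stableD(1)[OF stX] P(3) xX in blast)+
  qed
qed

lemma good_of_trivial:
  assumes U: "nondeg U" and triv: "\<And>x. x \<in> U \<Longrightarrow> t x = x"
  shows "good U"
proof -
  obtain T where T: "lattice U T" "stable T" "T \<subseteq> dual U T" "scale unif ` dual U T \<subseteq> T"
    using maximal_lattice[OF U] by blast
  from H_projection[OF U T] obtain P where P: "lin P" "\<forall>x\<in>U. P x \<in> U" "\<forall>h\<in>H. \<forall>x. P (h x) = h (P x)"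
      "\<forall>x\<in>T. P x \<in> scale unif ` dual U T" "\<forall>x\<in>scale unif ` dual U T. P x - x \<in> scale unif ` T"
    by (elim exE conjE)
  show ?thesis
    by (rule good_from_projection[OF U T P(1)]) (use P triv in auto)
qed

text \<open>Direct sum of the two lattices and forms. Since \<open>bil\<close> speaks about the
  whole space, the forms are pulled back along a linear \<open>p\<close> that is 1 on
  \<open>U1\<close> and 0 on \<open>U2\<close>, and along \<open>q = 1 - p\<close>.\<close>

lemma good_sum:
  assumes 1: "good U1" "subspace U1" "stable U1" and 2: "good U2" "subspace U2" "stable U2"
    and disj: "U1 \<inter> U2 \<subseteq> {0}" and U: "U = {x + y | x y. x \<in> U1 \<and> y \<in> U2}"
  shows "good U"
proof -
  obtain T1 f1 where T1: "lattice U1 T1" "stable T1" "bil f1" "\<And>x. x \<in> U1 \<Longrightarrow> f1 x x = 0"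
     "\<And>h x y. h \<in> H \<Longrightarrow> x \<in> U1 \<Longrightarrow> y \<in> U1 \<Longrightarrow> f1 (h x) (h y) = f1 x y"
     "\<And>x y. x \<in> U1 \<Longrightarrow> y \<in> U1 \<Longrightarrow> f1 (t x) (t y) = f1 x y"
     "\<And>x y. x \<in> T1 \<Longrightarrow> y \<in> T1 \<Longrightarrow> f1 x y \<in> \<O>" "\<And>x. x \<in> U1 \<Longrightarrow> (\<And>y. y \<in> T1 \<Longrightarrow> f1 x y \<in> \<O>) \<Longrightarrow> x \<in> T1"
    using 1(1) unfolding good_def by auto
  obtain T2 f2 where T2: "lattice U2 T2" "stable T2" "bil f2" "\<And>x. x \<in> U2 \<Longrightarrow> f2 x x = 0"
     "\<And>h x y. h \<in> H \<Longrightarrow> x \<in> U2 \<Longrightarrow> y \<in> U2 \<Longrightarrow> f2 (h x) (h y) = f2 x y"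
     "\<And>x y. x \<in> U2 \<Longrightarrow> y \<in> U2 \<Longrightarrow> f2 (t x) (t y) = f2 x y"
     "\<And>x y. x \<in> T2 \<Longrightarrow> y \<in> T2 \<Longrightarrow> f2 x y \<in> \<O>" "\<And>x. x \<in> U2 \<Longrightarrow> (\<And>y. y \<in> T2 \<Longrightarrow> f2 x y \<in> \<O>) \<Longrightarrow> x \<in> T2"
    using 2(1) unfolding good_def by auto
  obtain B1 where B1: "finite B1" "independent B1" "span B1 = U1" "T1 = ospan B1" using lattice_basis[OF T1(1)] by blast
  obtain S2 where S2: "finite S2" "span S2 = U2" "T2 = ospan S2" using T2(1) unfolding lattice_def by blast
  obtain B2 where B2: "finite B2" "independent B2" "span B2 = U2" using lattice_basis[OF T2(1)] by blast
  have ind: "independent (B1 \<union> B2)"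
  proof -
    have "dim {x + y |x y. x \<in> U1 \<and> y \<in> U2} + dim (U1 \<inter> U2) = dim U1 + dim U2" by (rule dim_sums_Int[OF 1(2) 2(2)])
    moreover have "U1 \<inter> U2 = {0}" using disj subspace_0[OF 1(2)] subspace_0[OF 2(2)] by blast
    moreover have "dim {0} = 0" by simp
    moreover have "card B1 = dim U1" "card B2 = dim U2"
      using dim_span_eq_card_independent B1 B2 by metis+
    ultimately have du: "dim U = card B1 + card B2" unfolding U by simp
    have "U \<subseteq> span (B1 \<union> B2)"
    proof
      fix z assume "z \<in> U"
      then obtain x y where xy: "z = x + y" "x \<in> span B1" "y \<in> span B2" unfolding U B1(3) B2(3) by blast
      moreover have "span B1 \<subseteq> span (B1 \<union> B2)" "span B2 \<subseteq> span (B1 \<union> B2)" by (auto intro!: span_mono)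
      ultimately show "z \<in> span (B1 \<union> B2)" using span_add by blast
    qed
    moreover have "B1 \<union> B2 \<subseteq> U"
    proof
      fix z assume "z \<in> B1 \<union> B2"
      then have "(z \<in> U1 \<and> 0 \<in> U2) \<or> (0 \<in> U1 \<and> z \<in> U2)"
        using B1(3) B2(3) span_base subspace_0[OF 1(2)] subspace_0[OF 2(2)] by auto
      then show "z \<in> U" unfolding U by force
    qed
    ultimately show ?thesis
      using card_le_dim_spanning[of "B1 \<union> B2" U] B1(1) B2(1) du card_Un_le[of B1 B2] by auto
  qed
  have disjB: "b \<notin> B1" if "b \<in> B2" for b
  proof
    assume "b \<in> B1"
    then have "b \<in> U1 \<inter> U2" using that B1(3) B2(3) span_base by blast
    then have "b = 0" using disj by blast
    then show False using \<open>b \<in> B1\<close> B1(2) dependent_zero by blast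
  qed
  obtain p where p: "lin p" "\<forall>b\<in>B1 \<union> B2. p b = (if b \<in> B1 then b else 0)"
    using vsp.linear_independent_extend[OF ind, of "\<lambda>b. if b \<in> B1 then b else 0"] by blast
  have p1: "p x = x" if "x \<in> U1" for x
    using vsp.linear_eq_on[OF p(1) lin_ident, of x B1] p(2) B1(3) that by auto
  have p2: "p x = 0" if "x \<in> U2" for x
  proof -
    have "lin (\<lambda>x. 0)" by (rule lin_I) auto
    from vsp.linear_eq_on[OF p(1) this, of x B2] show ?thesis using p(2) B2(3) that disjB by auto
  qed
  define q where "q x = x - p x" for x
  have q: "lin q" unfolding q_def
    by (rule lin_I) (simp_all add: vsp.linear_add[OF p(1)] vsp.linear_scale[OF p(1)] scale_right_diff_distrib)
  have pq: "p (x + y) = x" "q (x + y) = y" if "x \<in> U1" "y \<in> U2" for x y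
    using that by (simp_all add: q_def vsp.linear_add[OF p(1)] p1 p2)
  define f' where "f' x y = f1 (p x) (p y) + f2 (q x) (q y)" for x y
  have f': "f' (x + y) (x' + y') = f1 x x' + f2 y y'" if "x \<in> U1" "y \<in> U2" "x' \<in> U1" "y' \<in> U2" for x y x' y'
    using that by (simp add: f'_def pq)
  have f10: "f1 x 0 = 0" "f2 x 0 = 0" for x using T1(3) T2(3) unfolding bil_def
    by (metis mult_zero_left scale_zero_left)+
  define T where "T = {x + y | x y. x \<in> T1 \<and> y \<in> T2}"
  have TU: "T1 \<subseteq> U1" "T2 \<subseteq> U2" using lattice_subset T1 T2 by auto
  have UE: "\<exists>a b. a \<in> U1 \<and> b \<in> U2 \<and> x = a + b" if "x \<in> U" for x using that unfolding U by blast
  have TE: "\<exists>a b. a \<in> T1 \<and> b \<in> T2 \<and> x = a + b" if "x \<in> T" for x using that unfolding T_def by blast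
  have oT: "osub T" unfolding T_def by (rule osub_plus[OF lattice_osub[OF T1(1)] lattice_osub[OF T2(1)]])
  have T1T: "T1 \<subseteq> T" and T2T: "T2 \<subseteq> T"
    using osub_0[OF lattice_osub[OF T1(1)]] osub_0[OF lattice_osub[OF T2(1)]] unfolding T_def by force+
  have lat: "lattice U T"
  proof -
    have fin: "finite (B1 \<union> S2)" using B1 S2 by simp
    have "T = ospan (B1 \<union> S2)"
    proof
      have "B1 \<subseteq> T" "S2 \<subseteq> T" using T1T T2T ospan_superset B1 S2 by auto
      then show "ospan (B1 \<union> S2) \<subseteq> T" by (intro ospan_least[OF oT]) auto
      show "T \<subseteq> ospan (B1 \<union> S2)"
      proof
        fix x assume "x \<in> T"
        then obtain a b where ab: "a \<in> T1" "b \<in> T2" "x = a + b" using TE by blast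
        moreover have "T1 \<subseteq> ospan (B1 \<union> S2)" "T2 \<subseteq> ospan (B1 \<union> S2)"
          unfolding B1(4) S2(3) by (intro ospan_mono fin; simp)+
        ultimately show "x \<in> ospan (B1 \<union> S2)" using osub_add[OF osub_ospan] by blast
      qed
    qed
    moreover have "span (B1 \<union> S2) = U" unfolding span_Un B1(3) S2(2) U by blast
    ultimately show ?thesis using fin unfolding lattice_def by blast
  qed
  show ?thesis unfolding good_def
  proof (intro exI conjI ballI impI)
    show "lattice U T" by (rule lat)
    show "stable T" unfolding T_def by (rule stable_plus[OF T1(2) T2(2)])
    show "bil f'" using T1(3) T2(3) unfolding bil_def f'_def
      by (simp add: vsp.linear_add[OF p(1)] vsp.linear_scale[OF p(1)] vsp.linear_add[OF q] vsp.linear_scale[OF q] algebra_simps)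
    show "f' x x = 0" if "x \<in> U" for x
      using UE[OF that] T1(4) T2(4) f' by (metis add_0_left)
    show "f' (h x) (h y) = f' x y" if h: "h \<in> H" "x \<in> U" "y \<in> U" for h x y
    proof -
      obtain a b c d where ab: "a \<in> U1" "b \<in> U2" "x = a + b" "c \<in> U1" "d \<in> U2" "y = c + d"
        using UE[OF h(2)] UE[OF h(3)] by blast
      have "f' (h x) (h y) = f1 (h a) (h c) + f2 (h b) (h d)"
        unfolding ab vsp.linear_add[OF H_lin[OF h(1)]] using ab h(1) stableD(1)[OF 1(3)] stableD(1)[OF 2(3)]
        by (intro f') auto
      also have "\<dots> = f1 a c + f2 b d" using T1(5)[OF h(1) ab(1,4)] T2(5)[OF h(1) ab(2,5)] by simp
      also have "\<dots> = f' x y" unfolding ab by (rule f'[symmetric, OF ab(1,2,4,5)])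
      finally show ?thesis .
    qed
    show "f' (t x) (t y) = f' x y" if h: "x \<in> U" "y \<in> U" for x y
    proof -
      obtain a b c d where ab: "a \<in> U1" "b \<in> U2" "x = a + b" "c \<in> U1" "d \<in> U2" "y = c + d"
        using UE[OF h(1)] UE[OF h(2)] by blast
      have "f' (t x) (t y) = f1 (t a) (t c) + f2 (t b) (t d)"
        unfolding ab vsp.linear_add[OF t_lin] using ab stableD(2)[OF 1(3)] stableD(2)[OF 2(3)]
        by (intro f') auto
      also have "\<dots> = f1 a c + f2 b d" using T1(6)[OF ab(1,4)] T2(6)[OF ab(2,5)] by simp
      also have "\<dots> = f' x y" unfolding ab by (rule f'[symmetric, OF ab(1,2,4,5)])
      finally show ?thesis .
    qed
    show "f' x y \<in> \<O>" if h: "x \<in> T" "y \<in> T" for x y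
    proof -
      obtain a b c d where ab: "a \<in> T1" "b \<in> T2" "x = a + b" "c \<in> T1" "d \<in> T2" "y = c + d"
        using TE[OF h(1)] TE[OF h(2)] by blast
      have "f' x y = f1 a c + f2 b d" unfolding ab using ab TU by (intro f') auto
      then show ?thesis using T1(7)[OF ab(1,4)] T2(7)[OF ab(2,5)] O_add by simp
    qed
    show "x \<in> T" if h: "x \<in> U" "\<forall>y\<in>T. f' x y \<in> \<O>" for x
    proof -
      obtain a b where ab: "a \<in> U1" "b \<in> U2" "x = a + b" using UE[OF h(1)] by blast
      have "a \<in> T1"
      proof (rule T1(8)[OF ab(1)])
        fix y assume y: "y \<in> T1"
        have "f' x (y + 0) = f1 a y + f2 b 0" unfolding ab(3) using ab y TU subspace_0[OF 2(2)] by (intro f') auto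
        moreover have "f' x y \<in> \<O>" using h(2) y T1T by blast
        ultimately show "f1 a y \<in> \<O>" by (simp add: f10)
      qed
      moreover have "b \<in> T2"
      proof (rule T2(8)[OF ab(2)])
        fix y assume y: "y \<in> T2"
        have "f' x (0 + y) = f1 a 0 + f2 b y" unfolding ab(3) using ab y TU subspace_0[OF 1(2)] by (intro f') auto
        moreover have "f' x y \<in> \<O>" using h(2) y T2T by blast
        ultimately show "f2 b y \<in> \<O>" by (simp add: f10)
      qed
      ultimately show ?thesis unfolding T_def ab(3) by blast
    qed
  qed
qed

end

section \<open>Limits in lattices, lifting of idempotents, pairings\<close>

context val_space
begin

text \<open>The coordinates are partial sums of series with terms of growing valuation, hence
  Cauchy; this is where completeness of \<open>v\<close> enters. The exponent \<open>Suc n\<close>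
  in the conclusion reflects that all increments from \<open>x n\<close> on are divisible by
  \<open>unif ^ Suc n\<close>.\<close>

lemma lattice_complete:
  assumes T: "lattice W T" and x0: "x 0 \<in> T" and step: "\<And>n. x (Suc n) - x n \<in> scale (unif ^ Suc n) ` T"
  shows "\<exists>y\<in>T. \<forall>n. y - x n \<in> scale (unif ^ Suc n) ` T"
proof -
  obtain B where B: "finite B" "T = ospan B" using T unfolding lattice_def by blast
  obtain c where c: "x 0 = (\<Sum>b\<in>B. c b *s b)" "\<And>b. b \<in> B \<Longrightarrow> c b \<in> \<O>"
    using x0 unfolding B(2) ospan_def by blast
  have "\<exists>c. x (Suc n) - x n = (\<Sum>b\<in>B. (unif ^ Suc n * c b) *s b) \<and> (\<forall>b\<in>B. c b \<in> \<O>)" for n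
  proof -
    obtain z where z: "z \<in> ospan B" "x (Suc n) - x n = unif ^ Suc n *s z" using step[of n] unfolding B(2) by blast
    then obtain c where "z = (\<Sum>b\<in>B. c b *s b)" "\<forall>b\<in>B. c b \<in> \<O>" unfolding ospan_def by blast
    with z(2) show ?thesis by (intro exI[of _ c]) (simp add: scale_sum_right)
  qed
  then obtain \<delta> where \<delta>: "\<And>n. x (Suc n) - x n = (\<Sum>b\<in>B. (unif ^ Suc n * \<delta> n b) *s b)"
    "\<And>n b. b \<in> B \<Longrightarrow> \<delta> n b \<in> \<O>" by metis
  define a where "a b n = c b + (\<Sum>i<n. unif ^ Suc i * \<delta> i b)" for b n
  have xa: "x n = (\<Sum>b\<in>B. a b n *s b)" for n
  proof (induction n)
    case 0 show ?case by (simp add: a_def c(1))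
  next
    case (Suc n)
    have "x (Suc n) = (\<Sum>b\<in>B. (unif ^ Suc n * \<delta> n b) *s b) + x n"
      using \<delta>(1)[of n] by (simp only: diff_eq_eq)
    also have "\<dots> = (\<Sum>b\<in>B. a b n *s b + (unif ^ Suc n * \<delta> n b) *s b)"
      unfolding Suc sum.distrib by (rule add.commute)
    also have "\<dots> = (\<Sum>b\<in>B. a b (Suc n) *s b)"
      by (intro sum.cong refl) (simp add: a_def scale_left_distrib[symmetric])
    finally show ?case .
  qed
  have diff: "a b m - a b n \<in> val_ge v (int (Suc n))" if "b \<in> B" "n \<le> m" for b m n
    using that(2)
  proof (induction m rule: dec_induct)
    case (step m)
    have "a b (Suc m) - a b n = (a b m - a b n) + unif ^ Suc m * \<delta> m b" by (simp add: a_def)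
    also have "\<dots> \<in> val_ge v (int (Suc n))"
    proof (rule val_ge_add[OF step.IH])
      have "unif ^ Suc m * \<delta> m b \<in> val_ge v (int (Suc m))"
        unfolding val_ge_iff using \<delta>(2)[OF that(1)] by (intro bexI[of _ "\<delta> m b"]) auto
      then show "unif ^ Suc m * \<delta> m b \<in> val_ge v (int (Suc n))" using val_ge_mono[of "int (Suc n)" "int (Suc m)"] step by auto
    qed
    finally show ?case .
  qed simp
  have "\<exists>z. \<forall>n. z - a b n \<in> val_ge v (int (Suc n))" if b: "b \<in> B" for b
  proof -
    have "val_Cauchy v (a b)" unfolding val_Cauchy_def
    proof (intro allI exI impI)
      fix N m n assume *: "nat N \<le> m" "nat N \<le> n"
      have "a b m - a b n \<in> val_ge v (int (Suc (nat N)))"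
        using val_ge_diff[OF diff[OF b *(1)] diff[OF b *(2)]] by simp
      moreover have "N \<le> int (Suc (nat N))" by linarith
      ultimately show "a b m - a b n \<in> val_ge v N" using val_ge_mono by blast
    qed
    from complete[OF this] obtain z where z: "val_tendsto v (a b) z" by blast
    have "z - a b n \<in> val_ge v (int (Suc n))" for n
    proof -
      obtain M where M: "\<And>m. m \<ge> M \<Longrightarrow> a b m - z \<in> val_ge v (int (Suc n))" using z unfolding val_tendsto_def by blast
      have "(a b (max M n) - a b n) - (a b (max M n) - z) \<in> val_ge v (int (Suc n))"
        by (intro val_ge_diff M diff b) auto
      then show ?thesis by simp
    qed
    then show ?thesis by blast
  qed
  then obtain z where z: "\<And>b n. b \<in> B \<Longrightarrow> z b - a b n \<in> val_ge v (int (Suc n))" by metis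
  define y where "y = (\<Sum>b\<in>B. z b *s b)"
  have yx: "y - x n \<in> scale (unif ^ Suc n) ` T" for n
  proof -
    have "\<exists>r. z b - a b n = unif ^ Suc n * r \<and> r \<in> \<O>" if "b \<in> B" for b
      using z[OF that, of n] unfolding val_ge_iff by blast
    then obtain r where r: "\<And>b. b \<in> B \<Longrightarrow> z b - a b n = unif ^ Suc n * r b" "\<And>b. b \<in> B \<Longrightarrow> r b \<in> \<O>" by metis
    have "y - x n = (\<Sum>b\<in>B. (z b - a b n) *s b)"
      by (simp add: y_def xa scale_left_diff_distrib sum_subtractf)
    also have "\<dots> = unif ^ Suc n *s (\<Sum>b\<in>B. r b *s b)"
      unfolding scale_sum_right using r(1) by (intro sum.cong refl) simp
    finally show ?thesis using r(2) unfolding B(2) ospan_def by blast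
  qed
  have "y - x 0 \<in> T" using yx[of 0] scale_image_subset[OF lattice_osub[OF T] O_power[OF O_unif]] by blast
  then have "y \<in> T" using osub_add[OF lattice_osub[OF T] _ x0, of "y - x 0"] by simp
  with yx show ?thesis by blast
qed

lemma lattice_zero:
  assumes T: "lattice W T" and x: "\<And>n. x \<in> scale (unif ^ Suc n) ` T"
  shows "x = 0"
proof (rule lattice_inter[OF T])
  fix n
  have "x \<in> scale (unif ^ n) ` T"
    using x[of n] unif_power_image_mono[OF lattice_osub[OF T], of n "Suc n"] by auto
  then show "inverse (unif ^ n) *s x \<in> T" by (subst (asm) scale_image_iff) auto
qed

text \<open>Newton iteration \<open>c \<mapsto> 3 c\<^sup>2 - 2 c\<^sup>3\<close>, performed on polynomials in \<open>P\<close> so that \<open>Q\<close> commutes with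
  everything \<open>P\<close> commutes with.\<close>

lemma idempotent_lift:
  assumes T: "lattice U T" and P: "lin P" "P ` T \<subseteq> T" "\<forall>x\<in>T. P (P x) - P x \<in> scale unif ` T"
  shows "\<exists>Q. lin Q \<and> (\<forall>x\<in>T. Q x \<in> T) \<and> (\<forall>x\<in>T. Q x - P x \<in> scale unif ` T) \<and> (\<forall>x\<in>U. Q (Q x) = Q x) \<and>
    (\<forall>h. lin h \<longrightarrow> h ` T \<subseteq> T \<longrightarrow> (\<forall>x. P (h x) = h (P x)) \<longrightarrow> (\<forall>x\<in>U. Q (h x) = h (Q x)))"
proof -
  note oT = lattice_osub[OF T]
  obtain B where B: "finite B" "independent B" "span B = U" "T = ospan B" using lattice_basis[OF T] by blast
  define c :: "nat \<Rightarrow> 'k poly" where "c = rec_nat [:0, 1:] (\<lambda>_ c. 3 * c ^ 2 - 2 * c ^ 3)"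
  have c0: "c 0 = [:0, 1:]" and cS: "c (Suc n) = 3 * c n ^ 2 - 2 * c n ^ 3" for n by (simp_all add: c_def)
  define E where "E n = c n ^ 2 - c n" for n
  have num: "O_poly (numeral m)" for m using O_poly_of_nat[of "numeral m"] by simp
  have Oc: "O_poly (c n)" for n
    by (induction n) (auto simp: c0 cS intro!: O_poly_diff O_poly_mult O_poly_power num)
  have OE: "O_poly (E n)" for n unfolding E_def by (intro O_poly_diff O_poly_power Oc)
  have cE: "c (Suc n) - c n = E n * (1 - 2 * c n)" for n
    unfolding cS E_def by (simp add: algebra_simps power2_eq_square power3_eq_cube)
  \<comment> \<open>The idempotency defect \<open>E\<close> is essentially squared, so it tends to
    0; the weaker gain of one power of \<open>unif\<close> per step is all that is tracked.\<close>
  have EE: "E (Suc n) = E n * (E n * (4 * E n - 3))" for n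
    unfolding E_def[of "Suc n"] cS unfolding E_def by (simp add: algebra_simps power2_eq_square power3_eq_cube)
  define p where "p n = poly_op (c n) P" for n
  have lp: "lin (p n)" for n unfolding p_def by (rule lin_poly_op[OF P(1)])
  have in_T: "poly_op q P x \<in> T" if "O_poly q" "x \<in> T" for q x by (rule poly_op_in_osub[OF P(1) oT P(2) that])
  have pT: "p n x \<in> T" if "x \<in> T" for n x unfolding p_def by (rule in_T[OF Oc that])
  have p0: "p 0 x = P x" for x unfolding p_def c0 using poly_op_X_power[OF P(1), of 1 x] by simp
  have ET: "poly_op (E n) P x \<in> scale (unif ^ Suc n) ` T" if "x \<in> T" for n x
    using that
  proof (induction n arbitrary: x)
    case 0
    have "poly_op (E 0) P x = poly_op ([:0, 1:] ^ 2) P x - poly_op ([:0, 1:] ^ 1) P x"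
      unfolding E_def c0 by (simp only: poly_op_diff[OF P(1)] power_one_right)
    also have "\<dots> = P (P x) - P x"
      unfolding poly_op_X_power[OF P(1)] by (simp add: numeral_2_eq_2)
    finally have "poly_op (E 0) P x = P (P x) - P x" .
    then show ?case using bspec[OF P(3) 0] by simp
  next
    case (Suc n)
    have "poly_op (4 * E n - 3) P x \<in> T" by (intro in_T Suc.prems O_poly_diff O_poly_mult num OE)
    from Suc.IH[OF this] obtain y where y: "y \<in> T" "poly_op (E n) P (poly_op (4 * E n - 3) P x) = unif ^ Suc n *s y" by blast
    obtain z where z: "z \<in> T" "poly_op (E n) P y = unif ^ Suc n *s z" using Suc.IH[OF y(1)] by blast
    have "poly_op (E (Suc n)) P x = unif ^ Suc n *s (unif ^ Suc n *s z)"
      unfolding EE poly_op_mult[OF P(1)] y(2) vsp.linear_scale[OF lin_poly_op[OF P(1)]] z(2) ..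
    also have "\<dots> = unif ^ Suc (Suc n) *s (unif ^ n *s z)" by (simp add: mult_ac)
    finally show ?case using osub_scale[OF oT O_power[OF O_unif] z(1)] by (rule image_eqI)
  qed
  have pd: "p (Suc n) x - p n x \<in> scale (unif ^ Suc n) ` T" if "x \<in> T" for n x
  proof -
    have "p (Suc n) x - p n x = poly_op (E n) P (poly_op (1 - 2 * c n) P x)"
      unfolding p_def poly_op_diff[OF P(1), symmetric] cE poly_op_mult[OF P(1)] ..
    also have "\<dots> \<in> scale (unif ^ Suc n) ` T"
      by (intro ET in_T that O_poly_diff O_poly_mult num Oc O_poly_1)
    finally show ?thesis .
  qed
  have "\<exists>y. y \<in> T \<and> (\<forall>n. y - p n b \<in> scale (unif ^ Suc n) ` T)" if "b \<in> T" for b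
    using lattice_complete[OF T, of "\<lambda>n. p n b"] pT[OF that] pd[OF that] by blast
  then obtain q where q: "\<And>b. b \<in> T \<Longrightarrow> q b \<in> T" "\<And>b n. b \<in> T \<Longrightarrow> q b - p n b \<in> scale (unif ^ Suc n) ` T" by metis
  \<comment> \<open>The pointwise limit is used on the basis \<open>B\<close> only and extended
    linearly; the congruences with \<open>p n\<close> then spread from \<open>B\<close> to
    \<open>T\<close> by linearity.\<close>
  obtain Q where Q: "lin Q" "\<forall>b\<in>B. Q b = q b" using vsp.linear_independent_extend[OF B(2)] by blast
  have BT: "B \<subseteq> T" using ospan_superset[OF B(1)] B(4) by simp
  have QT: "Q x \<in> T" if "x \<in> T" for x
  proof -
    have "T \<subseteq> {x. Q x \<in> T}" unfolding B(4)
      by (rule ospan_least[OF osub_vimage[OF Q(1) osub_ospan]]) (use Q(2) q(1) BT B(4) in auto)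
    with that show ?thesis by blast
  qed
  have Qp: "Q x - p n x \<in> scale (unif ^ Suc n) ` T" if "x \<in> T" for x n
  proof -
    have l: "lin (\<lambda>x. Q x - p n x)"
      by (rule lin_I) (simp_all add: vsp.linear_add[OF Q(1)] vsp.linear_scale[OF Q(1)] vsp.linear_add[OF lp] vsp.linear_scale[OF lp]
          scale_right_diff_distrib)
    have "B \<subseteq> {x. Q x - p n x \<in> scale (unif ^ Suc n) ` T}" using Q(2) q(2) BT by auto
    from ospan_least[OF osub_vimage[OF l osub_scale_image[OF oT]] this] that B(4) show ?thesis by blast
  qed
  have sc: "g x \<in> scale r ` T" if "lin g" "g ` T \<subseteq> T" "x \<in> scale r ` T" for g x r
    using that(3,2) vsp.linear_scale[OF that(1)] by auto
  have QQ: "Q (Q x) = Q x" if x: "x \<in> T" for x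
  proof -
    have "Q (Q x) - Q x \<in> scale (unif ^ Suc n) ` T" for n
    proof -
      note o = osub_scale_image[OF oT, of "unif ^ Suc n"]
      have 1: "Q (Q x - p n x) \<in> scale (unif ^ Suc n) ` T" using QT by (intro sc[OF Q(1)] Qp x) auto
      have 2: "Q (p n x) - p n (p n x) \<in> scale (unif ^ Suc n) ` T" by (intro Qp pT x)
      have "p n (p n x) - p n x = poly_op (E n) P x"
        unfolding p_def E_def by (simp add: poly_op_diff[OF P(1)] power2_eq_square poly_op_mult[OF P(1)])
      then have 3: "p n (p n x) - p n x \<in> scale (unif ^ Suc n) ` T" using ET[OF x] by simp
      have 4: "Q x - p n x \<in> scale (unif ^ Suc n) ` T" by (intro Qp x)
      have "Q (Q x) - Q x = Q (Q x - p n x) + (Q (p n x) - p n (p n x)) + (p n (p n x) - p n x) - (Q x - p n x)"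
        by (simp add: vsp.linear_diff[OF Q(1)])
      also have "\<dots> \<in> scale (unif ^ Suc n) ` T" by (intro osub_diff[OF o] osub_add[OF o] 1 2 3 4)
      finally show ?thesis .
    qed
    from lattice_zero[OF T this] show ?thesis by simp
  qed
  have ext: "g x = g' x" if g: "lin g" "lin g'" "\<And>x. x \<in> T \<Longrightarrow> g x = g' x" and x: "x \<in> U" for g g' x
    using vsp.linear_eq_on[OF g(1,2), of x B] g(3) BT x B(3) by auto
  have lQQ: "lin (\<lambda>x. Q (Q x))" by (rule lin_I) (simp_all add: vsp.linear_add[OF Q(1)] vsp.linear_scale[OF Q(1)])
  show ?thesis
  proof (intro exI[of _ Q] conjI ballI allI impI)
    show "lin Q" by (rule Q(1))
    show "Q x \<in> T" if "x \<in> T" for x by (rule QT[OF that])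
    show "Q x - P x \<in> scale unif ` T" if "x \<in> T" for x using Qp[OF that, of 0] p0 by simp
    show "Q (Q x) = Q x" if "x \<in> U" for x by (rule ext[OF lQQ Q(1) QQ that])
    show "Q (h x) = h (Q x)" if h: "lin h" "h ` T \<subseteq> T" "\<forall>x. P (h x) = h (P x)" and x: "x \<in> U" for h x
    proof (rule ext[OF _ _ _ x])
      show "lin (\<lambda>x. Q (h x))" "lin (\<lambda>x. h (Q x))"
        by (rule lin_I; simp add: vsp.linear_add[OF Q(1)] vsp.linear_scale[OF Q(1)] vsp.linear_add[OF h(1)] vsp.linear_scale[OF h(1)])+
      fix x assume x: "x \<in> T"
      have "Q (h x) - h (Q x) \<in> scale (unif ^ Suc n) ` T" for n
      proof -
        have hp: "h (p n x) = p n (h x)" unfolding p_def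
          by (rule poly_op_commute_on[OF P(1) h(1) subspace_UNIV]) (use h(3) in auto)
        have "Q (h x) - p n (h x) \<in> scale (unif ^ Suc n) ` T" using x h(2) by (intro Qp) auto
        moreover have "h (Q x - p n x) \<in> scale (unif ^ Suc n) ` T" by (intro sc[OF h(1,2)] Qp x)
        ultimately have "(Q (h x) - p n (h x)) - h (Q x - p n x) \<in> scale (unif ^ Suc n) ` T"
          by (rule osub_diff[OF osub_scale_image[OF oT]])
        then show ?thesis by (simp add: vsp.linear_diff[OF h(1)] hp)
      qed
      from lattice_zero[OF T this] show "Q (h x) = h (Q x)" by simp
    qed
  qed
qed

text \<open>If every nonzero multiple of \<open>y\<close> in \<open>T\<close> were divisible by
  \<open>unif\<close> in \<open>T\<close>, dividing again and again would give infinite divisibility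
  and hence \<open>y = 0\<close>.\<close>

lemma lattice_primitive:
  assumes T: "lattice U T" and y: "y \<in> U" "y \<noteq> 0"
  shows "\<exists>r. r \<noteq> 0 \<and> r *s y \<in> T \<and> r *s y \<notin> scale unif ` T"
proof (rule ccontr)
  assume no: "\<not> ?thesis"
  obtain n where n: "unif ^ n *s y \<in> T" using lattice_absorbs[OF T y(1)] by blast
  have "inverse (unif ^ m) *s (unif ^ n *s y) \<in> T" for m
  proof (induction m)
    case (Suc m)
    let ?r = "inverse (unif ^ m) * unif ^ n"
    have "?r \<noteq> 0" "?r *s y \<in> T" using Suc by auto
    then have "?r *s y \<in> scale unif ` T" using no by blast
    then have "inverse unif *s (?r *s y) \<in> T" by (subst (asm) scale_image_iff) auto
    then show ?case by (simp add: mult_ac)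
  qed (use n in simp)
  from lattice_inter[OF T this] y(2) show False by simp
qed

text \<open>Nondegeneracy on the side of \<open>C\<close> makes
  \<open>c \<mapsto> (\<Sum>b\<in>B. g c b *s b)\<close> injective from \<open>C\<close> to
  \<open>X\<close>, where \<open>B\<close> is a basis of \<open>X\<close>.\<close>

lemma pairing_dim_le:
  fixes g :: "'v \<Rightarrow> 'v \<Rightarrow> 'k"
  assumes C: "subspace C" and X: "subspace X"
    and g: "\<And>x y z. g (x + y) z = g x z + g y z" "\<And>c x y. g (c *s x) y = c * g x y"
      "\<And>x y z. g x (y + z) = g x y + g x z" "\<And>c x y. g x (c *s y) = c * g x y"
    and nd: "\<And>c. c \<in> C \<Longrightarrow> (\<And>x. x \<in> X \<Longrightarrow> g c x = 0) \<Longrightarrow> c = 0"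
  shows "dim C \<le> dim X"
proof -
  obtain B where B: "B \<subseteq> X" "independent B" "X \<subseteq> span B" "card B = dim X" using basis_exists[of X] by metis
  have fB: "finite B" using B(2) by (rule finiteI_independent)
  define L where "L x = (\<Sum>b\<in>B. g x b *s b)" for x
  have L: "lin L" unfolding L_def
    by (rule lin_I) (simp_all add: g scale_left_distrib sum.distrib scale_sum_right)
  have g0: "g c 0 = 0" for c using g(4)[of c 0 0] by simp
  have inj: "c = 0" if c: "c \<in> C" "L c = 0" for c
  proof (rule nd[OF c(1)])
    fix x assume "x \<in> X"
    have "g c b = 0" if "b \<in> B" for b
      using independentD[OF B(2) fB order_refl _ that, of "g c"] c(2) by (simp add: L_def)
    then have "B \<subseteq> {y. g c y = 0}" by blast
    moreover have "subspace {y. g c y = 0}" by (simp add: subspace_def g g0)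
    ultimately have "span B \<subseteq> {y. g c y = 0}" by (rule span_minimal)
    then show "g c x = 0" using \<open>x \<in> X\<close> B(3) by blast
  qed
  have "inj_on L C"
  proof (rule inj_onI)
    fix x y assume "x \<in> C" "y \<in> C" "L x = L y"
    then have "L (x - y) = 0" "x - y \<in> C" by (simp_all add: vsp.linear_diff[OF L] subspace_diff[OF C])
    then show "x = y" using inj[of "x - y"] by simp
  qed
  moreover have "span C = C" using C by (rule span_eq_iff[THEN iffD2])
  ultimately have "dim (L ` C) = dim C" using vsp.dim_image_eq[OF L, of C] by metis
  moreover have "L ` C \<subseteq> X" unfolding L_def
    by (intro image_subsetI subspace_sum[OF X] subspace_scale[OF X]) (use B(1) in auto)
  then have "dim (L ` C) \<le> dim X" by (rule dim_subset)
  ultimately show ?thesis by simp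
qed

end

section \<open>Equivariant complements and commutation of \<open>t\<close> with
  \<open>H\<close>\<close>

context symplectic_val_space
begin

text \<open>Maschke's theorem over \<open>K\<close>: a projection onto \<open>W\<close> is averaged
  over \<open>H\<close> and then over the powers of \<open>t\<close>. Dividing by
  \<open>l ^ k\<close> is legitimate in characteristic 0, as no integrality is claimed.\<close>

lemma stable_complement:
  assumes U: "subspace U" "stable U" and W: "subspace W" "stable W" "W \<subseteq> U"
  shows "\<exists>W'. subspace W' \<and> stable W' \<and> W' \<subseteq> U \<and> W \<inter> W' \<subseteq> {0} \<and> U = {x + y | x y. x \<in> W \<and> y \<in> W'}"
proof -
  obtain q0 where q0: "range q0 \<subseteq> W" "lin q0" "\<forall>x\<in>W. q0 x = x"
    using vsp.linear_exists_left_inverse_on[OF lin_ident W(1)] by (auto simp: inj_on_def)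
  define q1 where "q1 = avg q0"
  have q1: "lin q1" unfolding q1_def by (rule avg_lin[OF q0(2)])
  have q1H: "q1 (h x) = h (q1 x)" if "h \<in> H" for h x unfolding q1_def by (rule avg_commute[OF that])
  have q1W: "q1 x \<in> W" for x unfolding q1_def
    by (rule avg_in[of W UNIV]) (use osub_subspace[OF W(1)] stableD(1)[OF W(2)] q0(1) in auto)
  have q1id: "q1 x = x" if x: "x \<in> W" for x
  proof -
    have "avg q0 x - x \<in> {0}"
      by (rule avg_id[of "{0}" W])
        (use osub_subspace[OF subspace_single_0] stableD(1)[OF W(2)] q0(3) x vsp.linear_0[OF H_lin] in auto)
    then show ?thesis by (simp add: q1_def)
  qed
  define N where "N = l ^ k"
  have N: "N > 0" unfolding N_def using l(1) by (simp add: prime_gt_0_nat)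
  have tN: "(t ^^ (N * j)) x = x" for j x unfolding N_def by (rule funpow_mult_fixes[OF t_pow])
  \<comment> \<open>Conjugation by \<open>t ^^ i\<close>; the exponent \<open>(N - 1) * i\<close>
    stands for \<open>- i\<close>, as \<open>t ^^ N\<close> is the identity.\<close>
  define F where "F x i = (t ^^ i) (q1 ((t ^^ ((N - 1) * i)) x))" for x i
  define q2 where "q2 x = inverse (of_nat N) *s (\<Sum>i<N. F x i)" for x
  note tl = vsp.linear_add[OF lin_funpow[OF t_lin]] vsp.linear_scale[OF lin_funpow[OF t_lin]]
  have q2: "lin q2" unfolding q2_def F_def
    by (rule lin_I) (simp_all add: tl vsp.linear_add[OF q1] vsp.linear_scale[OF q1] sum.distrib scale_right_distrib
      mult.commute flip: scale_sum_right)
  have ti: "(t ^^ i) ((t ^^ ((N - 1) * i)) x) = x" "(t ^^ ((N - 1) * i)) ((t ^^ i) x) = x" for i x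
  proof -
    have e: "i + (N - 1) * i = N * i" "(N - 1) * i + i = N * i" using N by (simp_all add: algebra_simps)
    show "(t ^^ i) ((t ^^ ((N - 1) * i)) x) = x" using tN[of i x] unfolding e(1)[symmetric] by (simp add: funpow_add)
    show "(t ^^ ((N - 1) * i)) ((t ^^ i) x) = x" using tN[of i x] unfolding e(2)[symmetric] by (simp add: funpow_add)
  qed
  have q2t: "q2 (t x) = t (q2 x)" for x
  proof -
    have "F (t x) (Suc i) = t (F x i)" for i
    proof -
      have e: "Suc ((N - 1) * Suc i) = (N - 1) * i + N * 1" using N by simp
      have "(t ^^ ((N - 1) * Suc i)) (t x) = (t ^^ Suc ((N - 1) * Suc i)) x"
        by (simp only: funpow_Suc_right comp_apply)
      also have "\<dots> = (t ^^ ((N - 1) * i + N * 1)) x" by (simp only: e)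
      also have "\<dots> = (t ^^ ((N - 1) * i)) x" by (simp only: funpow_add comp_apply tN)
      finally show ?thesis by (simp add: F_def)
    qed
    moreover have "F (t x) N = F (t x) 0"
      using tN[of 1] tN[of "N - 1"] by (simp add: F_def mult.commute)
    moreover have "(\<Sum>i<N. F (t x) i) + F (t x) N = F (t x) 0 + (\<Sum>i<N. F (t x) (Suc i))"
      using sum.lessThan_Suc[of "F (t x)" N] sum.lessThan_Suc_shift[of "F (t x)" N] by simp
    ultimately show ?thesis by (simp add: q2_def vsp.linear_scale[OF t_lin] vsp.linear_sum[OF t_lin])
  qed
  have q2H: "q2 (h x) = h (q2 x)" if h: "h \<in> H" for h x
  proof -
    \<comment> \<open>\<open>q1\<close> commutes with every element of \<open>H\<close>, so it does
      not matter that moving \<open>h\<close> past \<open>t ^^ i\<close> replaces it by another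
      element \<open>h'\<close>.\<close>
    have "F (h x) i = h (F x i)" for i
    proof -
      obtain h' where h': "h' \<in> H" "\<And>x. h ((t ^^ i) x) = (t ^^ i) (h' x)" using t_pow_conj'[OF h, of i] by blast
      have "h' ((t ^^ ((N - 1) * i)) x) = (t ^^ ((N - 1) * i)) (h x)"
        using h'(2)[of "(t ^^ ((N - 1) * i)) x"] ti by metis
      then show ?thesis unfolding F_def h'(2) q1H[OF h'(1), symmetric] by simp
    qed
    then show ?thesis by (simp add: q2_def vsp.linear_scale[OF H_lin[OF h]] vsp.linear_sum[OF H_lin[OF h]])
  qed
  have q2W: "q2 x \<in> W" for x unfolding q2_def F_def
    by (intro subspace_scale[OF W(1)] subspace_sum[OF W(1)] stable_t_pow[OF W(2)] q1W)
  have q2id: "q2 x = x" if "x \<in> W" for x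
  proof -
    have "F x i = x" for i unfolding F_def using q1id[OF stable_t_pow[OF W(2) that]] ti by simp
    then show ?thesis using N by (simp add: q2_def sum_constant_scale)
  qed
  define W' where "W' = {x \<in> U. q2 x = 0}"
  have "W' = U \<inter> {x. q2 x = 0}" by (auto simp: W'_def)
  then have "subspace W'" using subspace_inter[OF U(1) vsp.linear_subspace_kernel[OF q2]] by simp
  moreover have "stable W'"
    by (rule stableI) (simp_all add: W'_def q2H q2t stableD[OF U(2)] vsp.linear_0[OF H_lin] vsp.linear_0[OF t_lin])
  moreover have "W' \<subseteq> U" by (auto simp: W'_def)
  moreover have "W \<inter> W' \<subseteq> {0}" using q2id by (auto simp: W'_def)
  moreover have "U = {x + y | x y. x \<in> W \<and> y \<in> W'}"
  proof
    show "{x + y | x y. x \<in> W \<and> y \<in> W'} \<subseteq> U" using W(3) subspace_add[OF U(1)] by (auto simp: W'_def)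
    show "U \<subseteq> {x + y | x y. x \<in> W \<and> y \<in> W'}"
    proof
      fix x assume x: "x \<in> U"
      have "x - q2 x \<in> W'" using x q2W[of x] W(3) subspace_diff[OF U(1)] q2id
        by (auto simp: W'_def vsp.linear_diff[OF q2])
      moreover have "x = q2 x + (x - q2 x)" by simp
      ultimately show "x \<in> {x + y | x y. x \<in> W \<and> y \<in> W'}" using q2W by blast
    qed
  qed
  ultimately show ?thesis by blast
qed

lemma small_trivial:
  assumes "subspace Y" "lin g" "g ` Y \<subseteq> Y" "\<And>x. x \<in> Y \<Longrightarrow> (g ^^ (l ^ k)) x = x" "dim Y \<le> d" "x \<in> Y"
  shows "g x = x"
proof (rule small_dim_trivial[OF assms(1-4) _ assms(6)])
  have "e * dim Y \<le> e * d" by (rule mult_le_mono2[OF assms(5)])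
  then show "e * dim Y < l - 1" using l_bound mult.commute[of d e] by linarith
qed

text \<open>Here \<open>R\<close> projects onto a small \<open>H\<close>-stable subspace on which \<open>R t\<close> is an \<open>H\<close>-twisted
  automorphism \<open>s\<close>. Schur's lemma for a minimal \<open>(H, s)\<close>-stable subspace makes \<open>K[s ^ l ^ k]\<close> a field;
  the norm then corrects a power of \<open>s\<close> to an operator of \<open>l\<close>-power order, which must be trivial.\<close>

lemma twisted_automorphism_trivial:
  assumes U: "subspace U" "stable U" and R: "lin R" "\<And>x. x \<in> U \<Longrightarrow> R x \<in> U"
    and RH: "\<And>h x. h \<in> H \<Longrightarrow> x \<in> U \<Longrightarrow> R (h x) = h (R x)"
    and ne: "\<exists>y\<in>R ` U. y \<noteq> 0" and small: "dim (R ` U) \<le> d"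
    and inj: "\<And>y. y \<in> R ` U \<Longrightarrow> R (t y) = 0 \<Longrightarrow> y = 0"
  shows "\<exists>y\<in>U. y \<noteq> 0 \<and> (\<forall>h\<in>H. t (h y) = h (t y))"
proof -
  define s where "s x = R (t x)" for x
  have s: "lin s" unfolding s_def
    by (rule lin_I) (simp_all add: vsp.linear_add[OF R(1)] vsp.linear_scale[OF R(1)] vsp.linear_add[OF t_lin] vsp.linear_scale[OF t_lin])
  have sU: "s x \<in> R ` U" if "x \<in> U" for x unfolding s_def using stableD(2)[OF U(2) that] by (rule imageI)
  have RU: "R ` U \<subseteq> U" using R(2) by blast
  \<comment> \<open>Nonzero subspaces of the image stable under \<open>H\<close> and
    \<open>s\<close>; one of least dimension makes Schur's lemma available.\<close>
  define good_sub where "good_sub Y \<longleftrightarrow> subspace Y \<and> Y \<subseteq> R ` U \<and> (\<forall>x\<in>Y. s x \<in> Y) \<and> (\<forall>h\<in>H. \<forall>x\<in>Y. h x \<in> Y) \<and> (\<exists>y\<in>Y. y \<noteq> 0)" for Y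
  have "good_sub (R ` U)" unfolding good_sub_def
  proof (intro conjI ballI)
    show "subspace (R ` U)" by (rule vsp.linear_subspace_image[OF R(1) U(1)])
    show "s x \<in> R ` U" if "x \<in> R ` U" for x using that RU sU by blast
    show "h x \<in> R ` U" if hx: "h \<in> H" "x \<in> R ` U" for h x
    proof -
      obtain z where z: "z \<in> U" "x = R z" using hx(2) by blast
      then have "h x = R (h z)" using RH[OF hx(1)] by simp
      then show ?thesis using stableD(1)[OF U(2) hx(1) z(1)] by (rule image_eqI)
    qed
  qed (use ne in auto)
  then obtain Y where Y: "good_sub Y" and min: "\<And>Z. good_sub Z \<Longrightarrow> dim Y \<le> dim Z"
    using ex_has_least_nat[of good_sub "R ` U" dim] by blast
  have Ysub: "subspace Y" and YR: "Y \<subseteq> R ` U" and sY: "s ` Y \<subseteq> Y" and hY: "\<And>h x. h \<in> H \<Longrightarrow> x \<in> Y \<Longrightarrow> h x \<in> Y"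
    and Yne: "\<exists>y\<in>Y. y \<noteq> 0" using Y unfolding good_sub_def by auto
  have YU: "Y \<subseteq> U" using YR RU by blast
  have dY: "dim Y \<le> d" using dim_subset[OF YR] small by simp
  obtain w where w: "w \<in> Y" "w \<noteq> 0" using Yne by blast
  have s0: "x = 0" if "x \<in> Y" "s x = 0" for x using inj[of x] that YR unfolding s_def by blast
  have snY: "(s ^^ n) x \<in> Y" if "x \<in> Y" for n x using funpow_image_subset[OF sY] that by blast
  have sn0: "x = 0" if "x \<in> Y" "(s ^^ n) x = 0" for x n
    using that(2)
  proof (induction n)
    case (Suc n)
    then show ?case using s0[OF snY[OF that(1), of n]] by simp
  qed simp
  \<comment> \<open>One and the same \<open>h'\<close> serves \<open>t ^^ n\<close> and
    \<open>s ^^ n\<close>, because \<open>R\<close> commutes with \<open>H\<close>; so what is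
    learnt about \<open>s\<close> on \<open>Y\<close> can be transferred to
    \<open>t\<close>.\<close>
  have conj: "\<exists>h'\<in>H. (\<forall>x. (t ^^ n) (h x) = h' ((t ^^ n) x)) \<and> (\<forall>y\<in>Y. (s ^^ n) (h y) = h' ((s ^^ n) y))" if h: "h \<in> H" for n h
  proof (induction n)
    case 0 show ?case using h by (intro bexI[of _ h]) auto
  next
    case (Suc n)
    then obtain h1 where h1: "h1 \<in> H" "\<And>x. (t ^^ n) (h x) = h1 ((t ^^ n) x)" "\<And>y. y \<in> Y \<Longrightarrow> (s ^^ n) (h y) = h1 ((s ^^ n) y)"
      by blast
    obtain h2 where h2: "h2 \<in> H" "\<And>x. t (h1 x) = h2 (t x)" using t_conj[OF h1(1)] by blast
    have "s (h1 y) = h2 (s y)" if "y \<in> Y" for y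
    proof -
      have "t y \<in> U" using that YU stableD(2)[OF U(2)] by blast
      then show ?thesis unfolding s_def h2(2) by (rule RH[OF h2(1)])
    qed
    then show ?case using h1 h2 snY by (intro bexI[of _ h2]) auto
  qed
  \<comment> \<open>The exponent \<open>l ^ k\<close> makes the twist trivial:
    \<open>t ^^ (l ^ k)\<close> is the identity, so here \<open>h' = h\<close> and \<open>a\<close>
    commutes with \<open>H\<close> on \<open>Y\<close>.\<close>
  define a where "a = s ^^ (l ^ k)"
  have a: "lin a" unfolding a_def by (rule lin_funpow[OF s])
  have aY: "a ` Y \<subseteq> Y" unfolding a_def by (rule funpow_image_subset[OF sY])
  have ah: "h (a y) = a (h y)" if h: "h \<in> H" and y: "y \<in> Y" for h y
  proof -
    obtain h' where "\<And>x. (t ^^ (l ^ k)) (h x) = h' ((t ^^ (l ^ k)) x)" "\<And>y. y \<in> Y \<Longrightarrow> (s ^^ (l ^ k)) (h y) = h' ((s ^^ (l ^ k)) y)"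
      using conj[OF h, of "l ^ k"] by blast
    then show ?thesis using y by (simp add: a_def t_pow)
  qed
  have as: "s (a y) = a (s y)" for y by (simp add: a_def funpow_swap1)
  have ph: "h (poly_op p a y) = poly_op p a (h y)" if "h \<in> H" "y \<in> Y" for p h y
    by (rule poly_op_commute_on[OF a H_lin[OF that(1)] Ysub ah[OF that(1)] aY that(2)])
  have ps: "s (poly_op p a y) = poly_op p a (s y)" for p y
    by (rule poly_op_commute_on[OF a s subspace_UNIV as]) auto
  have pY: "poly_op p a y \<in> Y" if "y \<in> Y" for p y by (rule poly_op_in_subspace[OF a Ysub aY that])
  \<comment> \<open>Schur: the kernel of a polynomial in \<open>a\<close> on \<open>Y\<close> is
    stable under \<open>H\<close> and \<open>s\<close>, so by minimality it is 0 or all of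
    \<open>Y\<close>.\<close>
  have field: "poly_op p a y = 0" if x: "x \<in> Y" "x \<noteq> 0" "poly_op p a x = 0" and y: "y \<in> Y" for p x y
  proof -
    define Z where "Z = Y \<inter> {z. poly_op p a z = 0}"
    have "good_sub Z" unfolding good_sub_def
    proof (intro conjI ballI)
      show "subspace Z" unfolding Z_def by (intro subspace_inter Ysub vsp.linear_subspace_kernel lin_poly_op a)
      show "Z \<subseteq> R ` U" using YR by (auto simp: Z_def)
      show "s z \<in> Z" if "z \<in> Z" for z using that sY by (auto simp: Z_def vsp.linear_0[OF s] simp flip: ps)
      show "h z \<in> Z" if "h \<in> H" "z \<in> Z" for h z
        using that hY ph[OF that(1), of z p] by (auto simp: Z_def vsp.linear_0[OF H_lin])
      show "\<exists>y\<in>Z. y \<noteq> 0" using x by (auto simp: Z_def)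
    qed
    then have "dim Y \<le> dim Z" "subspace Z" using min by (auto simp: good_sub_def)
    then have "Z = Y" using subspace_dim_equal[of Z Y] Ysub by (auto simp: Z_def)
    then show ?thesis using y by (auto simp: Z_def)
  qed
  obtain m p where m: "0 < m" "m \<le> dim Y" and p: "\<And>y. y \<in> Y \<Longrightarrow> (poly_op p a ^^ (l ^ k)) y = (a ^^ m) y"
    using norm_root_of_power[OF Ysub s sY w, of "l ^ k"] field unfolding a_def by blast
  define n where "n = poly_op p a"
  have n: "lin n" unfolding n_def by (rule lin_poly_op[OF a])
  have nY: "n ` Y \<subseteq> Y" unfolding n_def using pY by blast
  have lk: "l ^ k > 0" using l(1) by (simp add: prime_gt_0_nat)
  have n0: "y = 0" if y: "y \<in> Y" "n y = 0" for y
  proof -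
    obtain j where j: "l ^ k = Suc j" using lk by (metis Suc_pred')
    have "(n ^^ (l ^ k)) y = 0" unfolding j funpow_Suc_right using y vsp.linear_0[OF lin_funpow[OF n]] by simp
    then have "(s ^^ (l ^ k * m)) y = 0" using p[OF y(1)] by (simp add: n_def a_def funpow_mult)
    then show ?thesis by (rule sn0[OF y(1)])
  qed
  have nn0: "x = y" if "x \<in> Y" "y \<in> Y" "(n ^^ j) x = (n ^^ j) y" for x y j
    using that(3)
  proof (induction j)
    case (Suc j)
    have "(n ^^ j) x - (n ^^ j) y \<in> Y" using funpow_image_subset[OF nY, of j] that(1,2) by (intro subspace_diff[OF Ysub]) auto
    moreover have "n ((n ^^ j) x - (n ^^ j) y) = 0" using Suc.prems by (simp add: vsp.linear_diff[OF n])
    ultimately have "(n ^^ j) x - (n ^^ j) y = 0" by (rule n0)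
    then show ?case using Suc.IH by simp
  qed simp
  have "inj_on n Y" using nn0[of _ _ 1] by (auto intro: inj_onI)
  then obtain n' where n': "range n' \<subseteq> Y" "lin n'" "\<forall>y\<in>Y. n' (n y) = y"
    using vsp.linear_exists_left_inverse_on[OF n Ysub] by blast
  have "n ` Y = Y" by (rule inj_endo_surj[OF Ysub n nY n0])
  have nn': "n (n' y) = y" if y: "y \<in> Y" for y
  proof -
    have "y \<in> n ` Y" unfolding \<open>n ` Y = Y\<close> by (rule y)
    then obtain z where "z \<in> Y" "y = n z" by (rule imageE)
    then show ?thesis using n'(3) by simp
  qed
  \<comment> \<open>\<open>g\<close> is \<open>s ^^ m\<close> divided by \<open>n\<close>. Since
    \<open>n\<close> commutes with \<open>s\<close> and \<open>n ^^ (l ^ k) = a ^^ m\<close> on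
    \<open>Y\<close>, the \<open>l ^ k\<close>-th power of \<open>g\<close> is the identity there;
    smallness of \<open>Y\<close> then yields \<open>s ^^ m = n\<close>.\<close>
  define g where "g x = n' ((s ^^ m) x)" for x
  have g: "lin g" unfolding g_def
    by (rule lin_I) (simp_all add: vsp.linear_add[OF lin_funpow[OF s]] vsp.linear_scale[OF lin_funpow[OF s]]
      vsp.linear_add[OF n'(2)] vsp.linear_scale[OF n'(2)])
  have gY: "g ` Y \<subseteq> Y" unfolding g_def using n'(1) by blast
  have ng: "n (g y) = (s ^^ m) y" if "y \<in> Y" for y unfolding g_def by (rule nn'[OF snY[OF that]])
  have sn: "s (n y) = n (s y)" for y unfolding n_def by (rule ps)
  have ssn: "(n ^^ j) ((s ^^ i) y) = (s ^^ i) ((n ^^ j) y)" for i j y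
    by (rule funpow_commute_on[of UNIV]) (auto intro: funpow_commute_on[of UNIV, symmetric] simp: sn)
  have gj: "(n ^^ j) ((g ^^ j) y) = (s ^^ (m * j)) y" if "y \<in> Y" for j y
  proof (induction j)
    case (Suc j)
    have gy: "(g ^^ j) y \<in> Y" using funpow_image_subset[OF gY, of j] that by blast
    have "(n ^^ Suc j) ((g ^^ Suc j) y) = (n ^^ j) (n (g ((g ^^ j) y)))" by (simp add: funpow_swap1)
    also have "\<dots> = (n ^^ j) ((s ^^ m) ((g ^^ j) y))" unfolding ng[OF gy] ..
    also have "\<dots> = (s ^^ m) ((s ^^ (m * j)) y)" unfolding ssn Suc.IH ..
    finally show ?case by (simp add: funpow_add)
  qed simp
  have gid: "g y = y" if y: "y \<in> Y" for y
  proof (rule small_trivial[OF Ysub g gY _ dY y])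
    fix x assume x: "x \<in> Y"
    have "(n ^^ (l ^ k)) ((g ^^ (l ^ k)) x) = (n ^^ (l ^ k)) x"
      unfolding gj[OF x] using p[OF x] by (simp add: n_def a_def funpow_mult mult.commute)
    moreover have "(g ^^ (l ^ k)) x \<in> Y" using funpow_image_subset[OF gY] x by blast
    ultimately show "(g ^^ (l ^ k)) x = x" using nn0 x by blast
  qed
  have smn: "(s ^^ m) y = n y" if "y \<in> Y" for y using ng[OF that] gid[OF that] by simp
  have sm: "(s ^^ m) ` Y = Y"
    by (rule inj_endo_surj[OF Ysub lin_funpow[OF s] funpow_image_subset[OF sY] sn0])
  \<comment> \<open>On \<open>Y\<close> the operator \<open>s ^^ m = n\<close> is a polynomial in
    \<open>a\<close> and commutes with \<open>H\<close>, so the element \<open>h'\<close> attached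
    to \<open>h\<close> by \<open>t ^^ m\<close> acts on \<open>Y\<close> like
    \<open>h\<close>.\<close>
  have conj_m: "\<exists>h'\<in>H. (\<forall>x. (t ^^ m) (h x) = h' ((t ^^ m) x)) \<and> (\<forall>y\<in>Y. h' y = h y)" if h: "h \<in> H" for h
  proof -
    obtain h' where h': "h' \<in> H" "\<And>x. (t ^^ m) (h x) = h' ((t ^^ m) x)" "\<And>y. y \<in> Y \<Longrightarrow> (s ^^ m) (h y) = h' ((s ^^ m) y)"
      using conj[OF h, of m] by blast
    have "h' z = h z" if z: "z \<in> Y" for z
    proof -
      have "z \<in> (s ^^ m) ` Y" unfolding sm by (rule z)
      then obtain y where y: "y \<in> Y" "z = (s ^^ m) y" by (rule imageE)
      have "h' z = (s ^^ m) (h y)" using h'(3) y by simp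
      also have "\<dots> = n (h y)" by (rule smn[OF hY[OF h y(1)]])
      also have "\<dots> = h (n y)" unfolding n_def by (rule ph[OF h y(1), symmetric])
      also have "\<dots> = h z" using smn y by simp
      finally show ?thesis .
    qed
    with h' show ?thesis by blast
  qed
  have conj_mr: "\<exists>h'\<in>H. (\<forall>x. (t ^^ (m * r)) (h x) = h' ((t ^^ (m * r)) x)) \<and> (\<forall>y\<in>Y. h' y = h y)" if h: "h \<in> H" for h r
  proof (induction r)
    case 0 show ?case using h by (intro bexI[of _ h]) auto
  next
    case (Suc r)
    then obtain h1 where h1: "h1 \<in> H" "\<And>x. (t ^^ (m * r)) (h x) = h1 ((t ^^ (m * r)) x)" "\<And>y. y \<in> Y \<Longrightarrow> h1 y = h y"
      by blast
    obtain h2 where h2: "h2 \<in> H" "\<And>x. (t ^^ m) (h1 x) = h2 ((t ^^ m) x)" "\<And>y. y \<in> Y \<Longrightarrow> h2 y = h1 y"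
      using conj_m[OF h1(1)] by blast
    show ?case using h1 h2 by (intro bexI[of _ h2]) (auto simp: funpow_add)
  qed
  \<comment> \<open>\<open>m \<le> dim Y \<le> d \<le> d * e < l\<close>, so \<open>m\<close> is
    invertible modulo \<open>l ^ k\<close> and \<open>t\<close> is a power of
    \<open>t ^^ m\<close>.\<close>
  have "m < l"
  proof -
    have "d * 1 \<le> d * e" using l(3) by (intro mult_left_mono) auto
    then show ?thesis using m(2) dY l_bound by linarith
  qed
  then have "\<not> l dvd m" using m(1) nat_dvd_not_less by simp
  then have "coprime l m" by (rule prime_imp_coprime[OF l(1)])
  then have "coprime m (l ^ k)" by (simp add: coprime_commute)
  from cong_solve_coprime_nat[OF this] obtain r where r: "[m * r = 1] (mod l ^ k)" by auto
  have t1: "(t ^^ (m * r)) x = t x" for x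
  proof -
    have "(t ^^ (m * r)) x = (t ^^ ((m * r) mod l ^ k)) x" using funpow_mod_eq[OF t_pow, of "m * r" x] by simp
    also have "\<dots> = (t ^^ (1 mod l ^ k)) x" using r by (simp add: cong_def)
    also have "\<dots> = t x" using funpow_mod_eq[OF t_pow, of 1 x] by simp
    finally show ?thesis .
  qed
  \<comment> \<open>The inverse image of \<open>w\<close> under \<open>t\<close>: the twist of
    \<open>h\<close> by \<open>t\<close> is now known to act as \<open>h\<close> on
    \<open>Y\<close>, and \<open>t y = w\<close> lies there.\<close>
  define y where "y = (t ^^ (l ^ k - 1)) w"
  have ty: "t y = w" unfolding y_def by (rule t_inverse(1))
  have "y \<in> U" unfolding y_def using stable_t_pow[OF U(2) subsetD[OF YU w(1)]] .
  moreover have "y \<noteq> 0" using ty w(2) vsp.linear_0[OF t_lin] by auto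
  moreover have "t (h y) = h (t y)" if h: "h \<in> H" for h
  proof -
    obtain h' where h': "\<And>x. t (h x) = h' (t x)" "\<And>y. y \<in> Y \<Longrightarrow> h' y = h y"
      using conj_mr[OF h, of r] unfolding t1 by blast
    show ?thesis unfolding h'(1) ty by (rule h'(2)[OF w(1)])
  qed
  ultimately show ?thesis by blast
qed

section \<open>Irreducible and general symplectic modules\<close>

text \<open>If \<open>T\<close> is neither self-dual nor self-dual up to the uniformizer, the projection onto the radical
  of the reduction of \<open>f\<close> lifts to a proper \<open>H\<close>-equivariant idempotent.\<close>

lemma commuting_vector_exists:
  assumes U: "nondeg U" and T: "lattice U T" "stable T"
    and TD: "T \<subseteq> dual U T" "scale unif ` dual U T \<subseteq> T"
    and ne: "dual U T \<noteq> T" "scale unif ` dual U T \<noteq> T" and dimU: "dim U \<le> 2 * d"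
  shows "\<exists>y\<in>U. y \<noteq> 0 \<and> (\<forall>h\<in>H. t (h y) = h (t y))"
proof -
  let ?X = "scale unif ` dual U T"
  let ?uT = "scale unif ` T"
  have sub: "subspace U" and stU: "stable U" using U by (auto simp: nondeg_def)
  note oT = lattice_osub[OF T(1)]
  note latD = dual_lattice(1)[OF U T(1)]
  have stX: "stable ?X" by (intro stable_scale dual_stable stU T(2))
  have stuT: "stable ?uT" by (intro stable_scale T(2))
  have oX: "osub ?X" by (rule osub_scale_image[OF lattice_osub[OF latD]])
  have ouT: "osub ?uT" by (rule osub_scale_image[OF oT])
  have neg: "x \<in> ?uT" if "- x \<in> ?uT" for x using osub_minus[OF ouT that] by simp
  have uTX: "?uT \<subseteq> ?X" using TD(1) by (rule image_mono)
  from H_projection[OF U T TD] obtain P where P: "lin P" "\<forall>x\<in>U. P x \<in> U" "\<forall>h\<in>H. \<forall>x. P (h x) = h (P x)"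
      "\<forall>x\<in>T. P x \<in> ?X" "\<forall>x\<in>?X. P x - x \<in> ?uT"
    by (elim exE conjE)
  have PT: "P ` T \<subseteq> T" using P(4) TD(2) by blast
  have PP: "\<forall>x\<in>T. P (P x) - P x \<in> ?uT" using bspec[OF P(5) bspec[OF P(4)]] by (rule ballI)
  from idempotent_lift[OF T(1) P(1) PT PP] obtain Q where Q: "lin Q" "\<forall>x\<in>T. Q x \<in> T" "\<forall>x\<in>T. Q x - P x \<in> ?uT"
    "\<forall>x\<in>U. Q (Q x) = Q x"
    "\<forall>h. lin h \<longrightarrow> h ` T \<subseteq> T \<longrightarrow> (\<forall>x. P (h x) = h (P x)) \<longrightarrow> (\<forall>x\<in>U. Q (h x) = h (Q x))"
    by (elim exE conjE)
  have QH: "Q (h x) = h (Q x)" if "h \<in> H" "x \<in> U" for h x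
  proof -
    have "h ` T \<subseteq> T" using stableD(1)[OF T(2) that(1)] by blast
    then show ?thesis using Q(5) H_lin[OF that(1)] P(3) that by simp
  qed
  have QX: "Q x \<in> ?X" if "x \<in> T" for x
  proof -
    have "(Q x - P x) + P x \<in> ?X" by (rule osub_add[OF oX subsetD[OF uTX bspec[OF Q(3) that]] bspec[OF P(4) that]])
    then show ?thesis by simp
  qed
  have Qid: "Q x - x \<in> ?uT" if "x \<in> ?X" for x
  proof -
    have "(Q x - P x) + (P x - x) \<in> ?uT" by (rule osub_add[OF ouT bspec[OF Q(3) subsetD[OF TD(2) that]] bspec[OF P(5) that]])
    then show ?thesis by simp
  qed
  have QU: "Q x \<in> U" if "x \<in> U" for x
  proof -
    have "T \<subseteq> {x. Q x \<in> U}" using Q(2) lattice_subset[OF T(1)] by auto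
    then have "span T \<subseteq> {x. Q x \<in> U}"
      by (intro span_minimal vsp.linear_subspace_vimage[OF Q(1) sub, unfolded vimage_def])
    with that lattice_span[OF T(1)] show ?thesis by blast
  qed
  define Q' where "Q' x = x - Q x" for x
  have Q': "lin Q'" unfolding Q'_def
    by (rule lin_I) (simp_all add: vsp.linear_add[OF Q(1)] vsp.linear_scale[OF Q(1)] scale_right_diff_distrib)
  have Q'U: "Q' x \<in> U" if "x \<in> U" for x unfolding Q'_def using that QU by (intro subspace_diff[OF sub])
  have t_uT: "y \<in> ?uT" if "t y \<in> ?uT" for y
    using stable_t_pow[OF stuT that, of "l ^ k - 1"] t_inverse(2)[of y] by simp
  have prim: "\<exists>r. r \<noteq> 0 \<and> r *s y \<in> T \<and> r *s y \<notin> ?uT" if "y \<in> U" "y \<noteq> 0" for y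
    by (rule lattice_primitive[OF T(1) that])
  \<comment> \<open>A primitive multiple \<open>z\<close> of \<open>y\<close> lies in
    \<open>unif\<close> times the dual, where \<open>Q\<close> is the identity modulo
    \<open>unif T\<close>. So \<open>Q (t z) = 0\<close> would put \<open>t z\<close>, and then
    \<open>z\<close>, into \<open>unif T\<close>.\<close>
  have inj: "y = 0" if y: "y \<in> Q ` U" "Q (t y) = 0" for y
  proof (rule ccontr)
    assume y0: "y \<noteq> 0"
    obtain u where u: "u \<in> U" "y = Q u" using y(1) by blast
    have yU: "y \<in> U" using u QU by simp
    have Qy: "Q y = y" using u Q(4) by simp
    obtain r where r: "r \<noteq> 0" "r *s y \<in> T" "r *s y \<notin> ?uT" using prim[OF yU y0] by blast
    define z where "z = r *s y"
    have Qz: "Q z = z" unfolding z_def by (simp add: vsp.linear_scale[OF Q(1)] Qy)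
    have "z \<in> ?X" using QX[OF r(2)] Qz by (simp add: z_def)
    then have "t z \<in> ?X" by (rule stableD(2)[OF stX])
    from Qid[OF this] have "- t z \<in> ?uT" using y(2) by (simp add: z_def vsp.linear_scale[OF t_lin] vsp.linear_scale[OF Q(1)])
    then have "t z \<in> ?uT" by (rule neg)
    then show False using t_uT r(3) by (simp add: z_def)
  qed
  \<comment> \<open>For the complementary image \<open>Q z = 0\<close>, while
    \<open>Q' (t z) = 0\<close> means \<open>t z = Q (t z)\<close>, which lies in
    \<open>unif\<close> times the dual. Pulling back by \<open>t\<close>, so does \<open>z\<close>,
    and then \<open>Q z\<close> is congruent to \<open>z\<close> modulo \<open>unif T\<close>,
    against primitivity.\<close>
  have inj': "y = 0" if y: "y \<in> Q' ` U" "Q' (t y) = 0" for y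
  proof (rule ccontr)
    assume y0: "y \<noteq> 0"
    obtain u where u: "u \<in> U" "y = Q' u" using y(1) by blast
    have yU: "y \<in> U" using u Q'U by simp
    have "Q y = Q u - Q (Q u)" unfolding u(2) Q'_def by (rule vsp.linear_diff[OF Q(1)])
    then have Qy: "Q y = 0" using bspec[OF Q(4) u(1)] by simp
    obtain r where r: "r \<noteq> 0" "r *s y \<in> T" "r *s y \<notin> ?uT" using prim[OF yU y0] by blast
    define z where "z = r *s y"
    have Qz: "Q z = 0" unfolding z_def by (simp add: vsp.linear_scale[OF Q(1)] Qy)
    have "Q (t z) = t z" using y(2) by (simp add: z_def Q'_def vsp.linear_scale[OF t_lin] vsp.linear_scale[OF Q(1)])
    moreover have "Q (t z) \<in> ?X" using QX stableD(2)[OF T(2) r(2)] by (simp add: z_def)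
    ultimately have tz: "t z \<in> ?X" by simp
    have "z \<in> ?X" using stable_t_pow[OF stX tz, of "l ^ k - 1"] t_inverse(2)[of z] by simp
    from Qid[OF this] have "- z \<in> ?uT" by (simp add: Qz)
    then have "z \<in> ?uT" by (rule neg)
    then show False using r(3) by (simp add: z_def)
  qed
  \<comment> \<open>\<open>Q = 0\<close> on \<open>U\<close> would make \<open>T\<close> equal to
    its dual; likewise \<open>Q' = 0\<close> below would make it \<open>unif\<close> times its
    dual.\<close>
  have ne1: "\<exists>y\<in>Q ` U. y \<noteq> 0"
  proof (rule ccontr)
    assume no: "\<not> ?thesis"
    have "x \<in> T" if x: "x \<in> dual U T" for x
    proof -
      have X: "unif *s x \<in> ?X" using x by (rule imageI)
      then have "unif *s x \<in> U" using TD(2) lattice_subset[OF T(1)] by blast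
      then have "Q (unif *s x) = 0" using no by auto
      with Qid[OF X] have "- (unif *s x) \<in> ?uT" by simp
      then have "unif *s x \<in> ?uT" by (rule neg)
      then show ?thesis by (subst (asm) scale_image_iff) auto
    qed
    then show False using ne(1) TD(1) by blast
  qed
  have ne2: "\<exists>y\<in>Q' ` U. y \<noteq> 0"
  proof (rule ccontr)
    assume no: "\<not> ?thesis"
    have "x \<in> ?X" if x: "x \<in> T" for x
    proof -
      have "x \<in> U" using x lattice_subset[OF T(1)] by blast
      then have "Q' x = 0" using no by blast
      then have "Q x = x" by (simp add: Q'_def)
      then show ?thesis using QX[OF x] by simp
    qed
    then show False using ne(2) TD(2) by blast
  qed
  have subs: "subspace (Q ` U)" "subspace (Q' ` U)"
    by (rule vsp.linear_subspace_image[OF Q(1) sub], rule vsp.linear_subspace_image[OF Q' sub])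
  have Q'H: "Q' (h x) = h (Q' x)" if "h \<in> H" "x \<in> U" for h x
    unfolding Q'_def by (simp add: QH[OF that] vsp.linear_diff[OF H_lin[OF that(1)]])
  have "dim {x + y |x y. x \<in> Q ` U \<and> y \<in> Q' ` U} + dim (Q ` U \<inter> Q' ` U) = dim (Q ` U) + dim (Q' ` U)"
    by (rule dim_sums_Int[OF subs])
  moreover have "Q ` U \<inter> Q' ` U \<subseteq> {0}"
  proof
    fix x assume "x \<in> Q ` U \<inter> Q' ` U"
    then obtain u w where u: "u \<in> U" "x = Q u" and w: "w \<in> U" "x = Q' w" by blast
    have "Q x = Q w - Q (Q w)" unfolding w(2) Q'_def by (rule vsp.linear_diff[OF Q(1)])
    then have "Q x = 0" using bspec[OF Q(4) w(1)] by simp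
    moreover have "Q x = x" unfolding u(2) by (rule bspec[OF Q(4) u(1)])
    ultimately show "x \<in> {0}" by simp
  qed
  then have "dim (Q ` U \<inter> Q' ` U) = 0" by simp
  moreover have "{x + y |x y. x \<in> Q ` U \<and> y \<in> Q' ` U} \<subseteq> U"
    using QU Q'U subspace_add[OF sub] by auto
  then have "dim {x + y |x y. x \<in> Q ` U \<and> y \<in> Q' ` U} \<le> dim U" by (rule dim_subset)
  ultimately have "dim (Q ` U) \<le> d \<or> dim (Q' ` U) \<le> d" using dimU by linarith
  then show ?thesis
  proof
    assume "dim (Q ` U) \<le> d"
    from twisted_automorphism_trivial[OF sub stU Q(1) QU QH ne1 this inj] show ?thesis .
  next
    assume "dim (Q' ` U) \<le> d"
    from twisted_automorphism_trivial[OF sub stU Q' Q'U Q'H ne2 this inj'] show ?thesis .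
  qed
qed

definition irred :: "'v set \<Rightarrow> bool" where
  "irred U \<longleftrightarrow> (\<forall>W. subspace W \<longrightarrow> stable W \<longrightarrow> W \<subseteq> U \<longrightarrow> W = {0} \<or> W = U)"

text \<open>The vectors on which \<open>t\<close> commutes with all of \<open>H\<close> form a
  stable subspace. For stability under \<open>t\<close>: on such a \<open>z\<close>, the relation h
  t = t h' and injectivity of \<open>t\<close> give h z = h' z.\<close>

lemma commute_of_irred:
  assumes U: "subspace U" "stable U" "irred U" and y: "y \<in> U" "y \<noteq> 0" "\<forall>h\<in>H. t (h y) = h (t y)"
    and h: "h \<in> H" and x: "x \<in> U"
  shows "t (h x) = h (t x)"
proof -
  define C where "C = {y \<in> U. \<forall>h\<in>H. t (h y) = h (t y)}"
  have "subspace C" unfolding subspace_def C_def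
    by (auto simp: subspace_0[OF U(1)] subspace_add[OF U(1)] subspace_scale[OF U(1)] vsp.linear_0[OF t_lin] vsp.linear_0[OF H_lin]
      vsp.linear_add[OF t_lin] vsp.linear_add[OF H_lin] vsp.linear_scale[OF t_lin] vsp.linear_scale[OF H_lin])
  moreover have "stable C"
  proof (rule stableI)
    have CE: "t (h z) = h (t z)" if "z \<in> C" "h \<in> H" for h z using that by (simp add: C_def)
    have CU: "z \<in> U" if "z \<in> C" for z using that by (simp add: C_def)
    have CI: "z \<in> C" if "z \<in> U" "\<And>h. h \<in> H \<Longrightarrow> t (h z) = h (t z)" for z using that by (simp add: C_def)
    fix g z assume g: "g \<in> H" and z: "z \<in> C"
    have "t (h (g z)) = h (t (g z))" if h: "h \<in> H" for h
      using CE[OF z H_comp[OF h g]] CE[OF z g] by simp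
    then show "g z \<in> C" by (rule CI[OF stableD(1)[OF U(2) g CU[OF z]]])
  next
    have CE: "t (h z) = h (t z)" if "z \<in> C" "h \<in> H" for h z using that by (simp add: C_def)
    have CU: "z \<in> U" if "z \<in> C" for z using that by (simp add: C_def)
    have CI: "z \<in> C" if "z \<in> U" "\<And>h. h \<in> H \<Longrightarrow> t (h z) = h (t z)" for z using that by (simp add: C_def)
    fix z assume z: "z \<in> C"
    have "t (h (t z)) = h (t (t z))" if h: "h \<in> H" for h
    proof -
      from t_conj'[OF h] obtain h' where h': "h' \<in> H" and hh: "\<forall>x. h (t x) = t (h' x)" by (elim bexE)
      have "t (h z) = t (h' z)" using CE[OF z h] hh by simp
      then have "(t ^^ (l ^ k - 1)) (t (h z)) = (t ^^ (l ^ k - 1)) (t (h' z))" by (rule arg_cong)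
      then have eq: "h z = h' z" by (simp only: t_inverse(2))
      have "t (h (t z)) = t (t (h z))" using CE[OF z h] by simp
      also have "\<dots> = t (t (h' z))" unfolding eq ..
      also have "\<dots> = t (h' (t z))" unfolding CE[OF z h'] ..
      also have "\<dots> = h (t (t z))" using hh by simp
      finally show ?thesis .
    qed
    then show "t z \<in> C" by (rule CI[OF stableD(2)[OF U(2) CU[OF z]]])
  qed
  moreover have "C \<subseteq> U" by (auto simp: C_def)
  ultimately have "C = {0} \<or> C = U" using U(3) unfolding irred_def by simp
  moreover have "y \<in> C" using y by (simp add: C_def)
  ultimately have "C = U" using y(2) by auto
  then show ?thesis using x h by (auto simp: C_def)
qed

text \<open>When \<open>t\<close> is central, \<open>U\<close> is a line over the totally ramified field \<open>K[t]\<close>, whose uniformizer is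
  \<open>t - 1\<close>; so \<open>T / (t - 1) T\<close> has no proper submodule, which is what the chain bound says.\<close>

lemma selfdual_of_central:
  assumes U: "nondeg U" and irr: "irred U" and dimU: "dim U \<le> 2 * d" and nt: "\<exists>x\<in>U. t x \<noteq> x"
    and central: "\<And>h x. h \<in> H \<Longrightarrow> x \<in> U \<Longrightarrow> t (h x) = h (t x)"
    and T: "lattice U T" "stable T" and TD: "T \<subseteq> dual U T" "scale unif ` dual U T \<subseteq> T"
    and max: "\<And>X. osub X \<Longrightarrow> stable X \<Longrightarrow> T \<subseteq> X \<Longrightarrow> X \<subseteq> U \<Longrightarrow> (\<And>x y. x \<in> X \<Longrightarrow> y \<in> X \<Longrightarrow> f x y \<in> \<O>) \<Longrightarrow> X = T"
  shows "dual U T = T"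
proof (rule ccontr)
  assume neq: "dual U T \<noteq> T"
  let ?D = "dual U T"
  have sub: "subspace U" and stU: "stable U" using U by (auto simp: nondeg_def)
  note oT = lattice_osub[OF T(1)]
  note latD = dual_lattice(1)[OF U T(1)]
  have stD: "stable ?D" by (rule dual_stable[OF stU T(2)])
  have DU: "?D \<subseteq> U" by (auto simp: dual_def)
  have tU: "t ` U \<subseteq> U" using stableD(2)[OF stU] by blast
  have tnU: "(t ^^ n) x \<in> U" if "x \<in> U" for n x by (rule stable_t_pow[OF stU that])
  have tnH: "(t ^^ n) (h x) = h ((t ^^ n) x)" if h: "h \<in> H" and x: "x \<in> U" for n h x
  proof (induction n)
    case (Suc n)
    then show ?case using central[OF h tnU[OF x, of n]] by simp
  qed simp
  define j where "j = (LEAST j. \<forall>x\<in>U. (t ^^ (l ^ j)) x = x)"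
  have j: "\<forall>x\<in>U. (t ^^ (l ^ j)) x = x" unfolding j_def
    by (rule LeastI[of _ k]) (simp add: t_pow)
  have "j \<noteq> 0"
  proof
    assume "j = 0"
    then have "\<forall>x\<in>U. t x = x" using j by simp
    then show False using nt by blast
  qed
  then obtain i where i: "j = Suc i" by (cases j) auto
  define q where "q = l ^ i"
  have q0: "q > 0" unfolding q_def using l(1) by (simp add: prime_gt_0_nat)
  have lq: "l ^ j = q * l" unfolding q_def i by simp
  have "\<not> (\<forall>x\<in>U. (t ^^ q) x = x)"
    using not_less_Least[of i "\<lambda>j. \<forall>x\<in>U. (t ^^ (l ^ j)) x = x"] unfolding j_def[symmetric] i q_def by blast
  \<comment> \<open>The fixed vectors of \<open>t ^^ q\<close> form a stable subspace, not all of
    \<open>U\<close> by minimality of \<open>j\<close>, hence 0. The cyclotomic sum below is fixed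
    by \<open>t ^^ q\<close> and so vanishes on \<open>U\<close>.\<close>
  define Fx where "Fx = {x \<in> U. (t ^^ q) x = x}"
  have "subspace Fx" unfolding subspace_def Fx_def
    by (auto simp: subspace_0[OF sub] subspace_add[OF sub] subspace_scale[OF sub] vsp.linear_0[OF lin_funpow[OF t_lin]]
      vsp.linear_add[OF lin_funpow[OF t_lin]] vsp.linear_scale[OF lin_funpow[OF t_lin]])
  moreover have "stable Fx"
  proof (rule stableI)
    show "h x \<in> Fx" if "h \<in> H" "x \<in> Fx" for h x
      using that tnH[OF that(1), of x q] stableD(1)[OF stU] by (simp add: Fx_def)
    show "t x \<in> Fx" if "x \<in> Fx" for x
      using that stableD(2)[OF stU] by (simp add: Fx_def funpow_swap1[symmetric])
  qed
  moreover have "Fx \<subseteq> U" by (auto simp: Fx_def)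
  ultimately have "Fx = {0} \<or> Fx = U" using irr unfolding irred_def by simp
  moreover have "Fx \<noteq> U" using \<open>\<not> (\<forall>x\<in>U. (t ^^ q) x = x)\<close> by (auto simp: Fx_def)
  ultimately have Fx0: "Fx = {0}" by blast
  have fix0: "x = 0" if "x \<in> U" "(t ^^ q) x = x" for x
  proof -
    have "x \<in> Fx" using that by (simp add: Fx_def)
    then show ?thesis using Fx0 by simp
  qed
  have cyc: "(\<Sum>i<l. (t ^^ (q * i)) x) = 0" if x: "x \<in> U" for x
  proof (rule fix0)
    show "(\<Sum>i<l. (t ^^ (q * i)) x) \<in> U" by (intro subspace_sum[OF sub] tnU x)
    have "(t ^^ q) (\<Sum>i<l. (t ^^ (q * i)) x) = (\<Sum>i<l. (t ^^ (q * Suc i)) x)"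
      by (simp add: vsp.linear_sum[OF lin_funpow[OF t_lin]] funpow_add)
    moreover have "(\<Sum>i<l. (t ^^ (q * i)) x) + (t ^^ (q * l)) x = (t ^^ (q * 0)) x + (\<Sum>i<l. (t ^^ (q * Suc i)) x)"
      using sum.lessThan_Suc[of "\<lambda>i. (t ^^ (q * i)) x" l] sum.lessThan_Suc_shift[of "\<lambda>i. (t ^^ (q * i)) x" l] by simp
    moreover have "(t ^^ (q * l)) x = x" using j x lq by simp
    ultimately show "(t ^^ q) (\<Sum>i<l. (t ^^ (q * i)) x) = (\<Sum>i<l. (t ^^ (q * i)) x)" by simp
  qed
  define \<psi> where "\<psi> x = t x - x" for x
  have \<psi>: "lin \<psi>" unfolding \<psi>_def
    by (rule lin_I) (simp_all add: vsp.linear_add[OF t_lin] vsp.linear_scale[OF t_lin] scale_right_diff_distrib)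
  have \<psi>0: "x = 0" if "x \<in> U" "\<psi> x = 0" for x
    by (rule fix0[OF that(1)], rule funpow_fixes) (use that(2) in \<open>simp add: \<psi>_def\<close>)
  have tT: "t ` T \<subseteq> T" using stableD(2)[OF T(2)] by blast
  have \<psi>T: "\<psi> ` T \<subseteq> T" unfolding \<psi>_def using stableD(2)[OF T(2)] by (auto intro: osub_diff[OF oT])
  have \<psi>D: "\<psi> ` ?D \<subseteq> ?D" unfolding \<psi>_def using stableD(2)[OF stD] by (auto intro: osub_diff[OF lattice_osub[OF latD]])
  have up: "scale (unif ^ e) ` T \<subseteq> (\<psi> ^^ (l - 1)) ` T"
    unfolding \<psi>_def by (rule cyclotomic_lattice[OF T(1) t_lin tT tU q0 cyc])
  have "t ` ?D \<subseteq> ?D" using stableD(2)[OF stD] by blast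
  from unipotent_mod_unif[OF latD t_lin this t_pow] have nil: "(\<psi> ^^ (l ^ k)) ` ?D \<subseteq> T"
    unfolding \<psi>_def using TD(2) by (rule subset_trans)
  \<comment> \<open>Applying \<psi> to \<open>x0\<close> until just before it enters
    \<open>T\<close> produces an \<open>x\<close> in the dual, outside \<open>T\<close>, with
    \<open>\<psi> x\<close> in \<open>T\<close>. The process stops because \<psi> is nilpotent on
    the dual modulo \<open>T\<close>.\<close>
  obtain x0 where x0: "x0 \<in> ?D" "x0 \<notin> T" using neq TD(1) by blast
  define n where "n = (LEAST n. (\<psi> ^^ n) x0 \<in> T)"
  have "(\<psi> ^^ (l ^ k)) x0 \<in> T" using nil x0(1) by blast
  then have n: "(\<psi> ^^ n) x0 \<in> T" unfolding n_def by (rule LeastI)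
  have "n \<noteq> 0"
  proof
    assume "n = 0"
    then show False using n x0(2) by simp
  qed
  then obtain n' where n': "n = Suc n'" by (cases n) auto
  define x where "x = (\<psi> ^^ n') x0"
  have xT: "x \<notin> T" using not_less_Least[of n' "\<lambda>n. (\<psi> ^^ n) x0 \<in> T"] unfolding n_def[symmetric] n' x_def by simp
  have xD: "x \<in> ?D" unfolding x_def using funpow_image_subset[OF \<psi>D, of n'] x0(1) by blast
  have \<psi>x: "\<psi> x \<in> T" using n unfolding n' x_def by simp
  have xU: "x \<in> U" using xD DU by blast
  define L where "L = {c *s x | c. c \<in> \<O>}"
  have oL: "osub L" unfolding osub_def L_def
  proof (intro conjI ballI)
    show "0 \<in> {c *s x |c. c \<in> \<O>}" by (intro CollectI exI[of _ 0]) simp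
    show "y + z \<in> {c *s x |c. c \<in> \<O>}" if yz: "y \<in> {c *s x |c. c \<in> \<O>}" "z \<in> {c *s x |c. c \<in> \<O>}" for y z
    proof -
      obtain c c' where "y = c *s x" "z = c' *s x" "c \<in> \<O>" "c' \<in> \<O>" using yz by blast
      then show ?thesis by (intro CollectI exI[of _ "c + c'"]) (simp add: scale_left_distrib O_add)
    qed
    show "b *s y \<in> {c *s x |c. c \<in> \<O>}" if yz: "b \<in> \<O>" "y \<in> {c *s x |c. c \<in> \<O>}" for y b
    proof -
      obtain c where "y = c *s x" "c \<in> \<O>" using yz by blast
      then show ?thesis using yz(1) by (intro CollectI exI[of _ "b * c"]) (simp add: O_mult)
    qed
  qed
  \<comment> \<open>Enlarging \<open>T\<close> by the single vector \<open>x\<close> keeps the form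
    integral, as \<open>f x x = 0\<close>; the aim is to show that this \<open>X\<close> is stable,
    against the maximality of \<open>T\<close>.\<close>
  define X where "X = {a + b | a b. a \<in> T \<and> b \<in> L}"
  have oX: "osub X" unfolding X_def by (rule osub_plus[OF oT oL])
  have XE: "\<exists>a\<in>T. \<exists>c\<in>\<O>. z = a + c *s x" if "z \<in> X" for z using that unfolding X_def L_def by blast
  have XI: "a + c *s x \<in> X" if "a \<in> T" "c \<in> \<O>" for a c using that unfolding X_def L_def by blast
  have TX: "T \<subseteq> X"
  proof
    fix a assume "a \<in> T"
    then show "a \<in> X" using XI[of a 0] by simp
  qed
  have xX: "x \<in> X" using XI[OF osub_0[OF oT] O_1] by simp
  have XU: "X \<subseteq> U"
  proof
    fix z assume "z \<in> X"
    then obtain a c where "a \<in> T" "z = a + c *s x" using XE by blast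
    then show "z \<in> U" using lattice_subset[OF T(1)] xU by (auto intro: subspace_add[OF sub] subspace_scale[OF sub])
  qed
  have \<psi>X: "\<psi> ` X \<subseteq> T"
  proof (rule image_subsetI)
    fix z assume "z \<in> X"
    then obtain a c where ac: "a \<in> T" "c \<in> \<O>" "z = a + c *s x" using XE by blast
    have "\<psi> z = \<psi> a + c *s \<psi> x" unfolding ac(3) by (simp add: vsp.linear_add[OF \<psi>] vsp.linear_scale[OF \<psi>])
    also have "\<dots> \<in> T" using \<psi>T ac \<psi>x by (intro osub_add[OF oT] osub_scale[OF oT]) auto
    finally show "\<psi> z \<in> T" .
  qed
  have \<psi>inj: "y = z" if "y \<in> U" "z \<in> U" "\<psi> y = \<psi> z" for y z
  proof -
    have "y - z = 0" by (rule \<psi>0) (use that in \<open>simp_all add: vsp.linear_diff[OF \<psi>] subspace_diff[OF sub]\<close>)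
    then show ?thesis by simp
  qed
  have XT: "\<psi> ` X \<noteq> \<psi> ` T"
  proof
    assume eq: "\<psi> ` X = \<psi> ` T"
    have "\<psi> x \<in> \<psi> ` X" using xX by (rule imageI)
    then have "\<psi> x \<in> \<psi> ` T" unfolding eq .
    then obtain y where y: "y \<in> T" "\<psi> x = \<psi> y" by blast
    then have "x = y" using \<psi>inj[OF xU] lattice_subset[OF T(1)] by blast
    then show False using y(1) xT by simp
  qed
  \<comment> \<open>Otherwise \<open>\<psi> X\<close> lies strictly between \<open>\<psi> T\<close>
    and \<open>T\<close>, and the doubled chain gives
    \<open>2 * (l - 1) \<le> e * dim U \<le> 2 * d * e\<close>, against
    \<open>l_bound\<close>.\<close>
  have "\<psi> ` X = T"
  proof (rule ccontr)
    assume "\<psi> ` X \<noteq> T"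
    then have proper: "\<psi> ` X \<subset> T" using \<psi>X by blast
    have "2 * (l - 1) \<le> e * dim U"
      by (rule chain_bound(2)[OF T(1) \<psi> \<psi>0 \<psi>T up osub_image[OF \<psi> oX] image_mono[OF TX] proper XT])
    also have "\<dots> \<le> e * (2 * d)" by (rule mult_le_mono2[OF dimU])
    finally show False using l_bound by (simp add: mult.commute)
  qed
  \<comment> \<open>\<open>X\<close> is thus the full preimage of \<open>T\<close> under \<psi> in
    \<open>U\<close>, a description invariant under \<open>H\<close> and \<open>t\<close>, whereas
    stability is not visible from the generator \<open>x\<close>.\<close>
  have Xchar: "z \<in> X" if z: "z \<in> U" "\<psi> z \<in> T" for z
  proof -
    have "\<psi> z \<in> \<psi> ` X" unfolding \<open>\<psi> ` X = T\<close> by (rule z(2))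
    then obtain y where y: "\<psi> z = \<psi> y" "y \<in> X" by (rule imageE)
    then have "z = y" using \<psi>inj[OF z(1)] XU by blast
    then show ?thesis using y(2) by simp
  qed
  have "X = T"
  proof (rule max[OF oX _ TX XU])
    show "stable X"
    proof (rule stableI)
      fix h z assume h: "h \<in> H" and z: "z \<in> X"
      have zU: "z \<in> U" using z XU by blast
      have "\<psi> z \<in> T" using z \<psi>X by blast
      moreover have "\<psi> (h z) = h (\<psi> z)" unfolding \<psi>_def by (simp add: central[OF h zU] vsp.linear_diff[OF H_lin[OF h]])
      ultimately show "h z \<in> X" using stableD(1)[OF stU h zU] stableD(1)[OF T(2) h] by (intro Xchar) simp_all
    next
      fix z assume z: "z \<in> X"
      have zU: "z \<in> U" using z XU by blast
      have "\<psi> z \<in> T" using z \<psi>X by blast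
      moreover have "\<psi> (t z) = t (\<psi> z)" unfolding \<psi>_def by (simp add: vsp.linear_diff[OF t_lin])
      ultimately show "t z \<in> X" using stableD(2)[OF stU zU] stableD(2)[OF T(2)] by (intro Xchar) simp_all
    qed
    fix y z assume "y \<in> X" "z \<in> X"
    then obtain a c b c' where ab: "a \<in> T" "c \<in> \<O>" "y = a + c *s x" "b \<in> T" "c' \<in> \<O>" "z = b + c' *s x"
      using XE by metis
    have "f x a \<in> \<O>" "f x b \<in> \<O>" using xD ab by (simp_all add: dual_def)
    then have "f a x \<in> \<O>" "f x b \<in> \<O>" using f_sym_OD by auto
    moreover have "f a b \<in> \<O>" using TD(1) ab by (auto simp: dual_def)
    ultimately show "f y z \<in> \<O>" unfolding ab
      by (simp add: f_add_left f_add_right f_scale_left f_scale_right O_add O_mult ab)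
  qed
  then show False using xX xT by simp
qed

lemma good_of_irred:
  assumes U: "nondeg U" and irr: "irred U" and dimU: "dim U \<le> 2 * d" and nt: "\<exists>x\<in>U. t x \<noteq> x"
  shows "good U"
proof -
  have sub: "subspace U" and stU: "stable U" using U by (auto simp: nondeg_def)
  from maximal_lattice[OF U] obtain T where T: "lattice U T" "stable T"
    and TD: "T \<subseteq> dual U T" "scale unif ` dual U T \<subseteq> T"
    and max: "\<forall>X. osub X \<longrightarrow> stable X \<longrightarrow> T \<subseteq> X \<longrightarrow> X \<subseteq> U \<longrightarrow> (\<forall>x\<in>X. \<forall>y\<in>X. f x y \<in> \<O>) \<longrightarrow> X = T"
    by (elim exE conjE)
  note oT = lattice_osub[OF T(1)]
  have ouT: "osub (scale unif ` T)" by (rule osub_scale_image[OF oT])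
  consider "dual U T = T" | "scale unif ` dual U T = T" | "dual U T \<noteq> T" "scale unif ` dual U T \<noteq> T" by blast
  then show ?thesis
  proof cases
    case 1
    show ?thesis
    proof (rule good_from_projection[OF U T TD, of "\<lambda>x. 0"])
      show "lin (\<lambda>x. 0)" by (rule lin_I) auto
      show "0 \<in> scale unif ` dual U T" using osub_0[OF ouT] 1 by simp
      show "0 - x \<in> scale unif ` T" if "x \<in> scale unif ` dual U T" for x
        using osub_minus[OF ouT, of x] that 1 by simp
    qed (simp_all add: subspace_0[OF sub] vsp.linear_0[OF H_lin] vsp.linear_0[OF t_lin])
  next
    case 2
    show ?thesis
    proof (rule good_from_projection[OF U T TD lin_ident])
      show "x - x \<in> scale unif ` T" for x using osub_0[OF ouT] by simp
    qed (simp_all add: 2)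
  next
    case 3
    obtain y where y: "y \<in> U" "y \<noteq> 0" "\<forall>h\<in>H. t (h y) = h (t y)"
      using commuting_vector_exists[OF U T TD 3 dimU] by blast
    have "dual U T = T"
      by (rule selfdual_of_central[OF U irr dimU nt commute_of_irred[OF sub stU irr y] T TD]) (use max in auto)
    with 3(1) show ?thesis by blast
  qed
qed

section \<open>Orthogonal splitting and induction on the dimension\<close>

definition perp :: "'v set \<Rightarrow> 'v set \<Rightarrow> 'v set" where
  "perp U W = {x \<in> U. \<forall>y\<in>W. f x y = 0}"

lemma perp_subspace: "subspace U \<Longrightarrow> subspace (perp U W)"
  unfolding subspace_def perp_def by (auto simp: f_add_left f_scale_left)

lemma perp_stable:
  assumes "stable U" "stable W"
  shows "stable (perp U W)"
proof (rule stableI)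
  fix h x assume h: "h \<in> H" and x: "x \<in> perp U W"
  obtain h' where h': "h' \<in> H" "\<And>x. h (h' x) = x" using H_inv[OF h] by blast
  have "f (h x) y = 0" if "y \<in> W" for y
    using f_H[OF h, of x "h' y"] h'(2)[of y] x stableD(1)[OF assms(2) h'(1) that] by (simp add: perp_def)
  then show "h x \<in> perp U W" using x stableD(1)[OF assms(1) h] by (simp add: perp_def)
next
  fix x assume x: "x \<in> perp U W"
  have "f (t x) y = 0" if "y \<in> W" for y
    using f_t[of x "(t ^^ (l ^ k - 1)) y"] t_inverse[of y] x stable_t_pow[OF assms(2) that] by (simp add: perp_def)
  then show "t x \<in> perp U W" using x stableD(2)[OF assms(1)] by (simp add: perp_def)
qed

text \<open>Subtracting from a vector its projection given by a dual basis of \<open>W\<close>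
  leaves a remainder orthogonal to \<open>W\<close>.\<close>

lemma nondeg_split:
  assumes U: "nondeg U" and W: "nondeg W" "W \<subseteq> U"
  shows "nondeg (perp U W)" "W \<inter> perp U W \<subseteq> {0}" "U = {x + y | x y. x \<in> W \<and> y \<in> perp U W}"
proof -
  have sub: "subspace U" and stU: "stable U" and subW: "subspace W" and stW: "stable W"
    using U W by (auto simp: nondeg_def)
  show disj: "W \<inter> perp U W \<subseteq> {0}" using W(1) by (auto simp: nondeg_def perp_def)
  obtain B0 where B0: "B0 \<subseteq> W" "independent B0" "W \<subseteq> span B0" using basis_exists[of W] by metis
  have B: "finite B0" "span B0 = W"
    using finiteI_independent[OF B0(2)] span_minimal[OF B0(1) subW] B0(3) by auto
  obtain b' where b': "\<And>b. b \<in> B0 \<Longrightarrow> b' b \<in> W" "\<And>b c. b \<in> B0 \<Longrightarrow> c \<in> B0 \<Longrightarrow> f (b' b) c = (if c = b then 1 else 0)"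
    using dual_basis_exists[OF W(1) B(1) B0(2) B(2)] by blast
  show dec: "U = {x + y | x y. x \<in> W \<and> y \<in> perp U W}"
  proof
    show "{x + y | x y. x \<in> W \<and> y \<in> perp U W} \<subseteq> U" using W(2) subspace_add[OF sub] by (auto simp: perp_def)
    show "U \<subseteq> {x + y | x y. x \<in> W \<and> y \<in> perp U W}"
    proof
      fix x assume x: "x \<in> U"
      define w where "w = (\<Sum>b\<in>B0. f x b *s b' b)"
      have wW: "w \<in> W" unfolding w_def by (intro subspace_sum[OF subW] subspace_scale[OF subW] b')
      have "f (x - w) c = 0" if c: "c \<in> B0" for c
      proof -
        have "f w c = (\<Sum>b\<in>B0. if c = b then f x b else 0)"
          unfolding w_def f_sum f_scale_left using b' c by (auto intro!: sum.cong)
        then show ?thesis using c B(1) by (simp add: f_diff)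
      qed
      moreover have "subspace {y. f (x - w) y = 0}" by (auto simp: subspace_def f_add_right f_scale_right)
      ultimately have "span B0 \<subseteq> {y. f (x - w) y = 0}" by (intro span_minimal) auto
      then have "x - w \<in> perp U W" using x wW W(2) B(2) by (auto simp: perp_def intro: subspace_diff[OF sub])
      moreover have "x = w + (x - w)" by simp
      ultimately show "x \<in> {x + y | x y. x \<in> W \<and> y \<in> perp U W}" using wW by blast
    qed
  qed
  show "nondeg (perp U W)" unfolding nondeg_def
  proof (intro conjI ballI impI)
    show "subspace (perp U W)" by (rule perp_subspace[OF sub])
    show "stable (perp U W)" by (rule perp_stable[OF stU stW])
    fix x assume x: "x \<in> perp U W" "\<forall>y\<in>perp U W. f x y = 0"
    have "f x z = 0" if z: "z \<in> U" for z
    proof -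
      have "z \<in> {x + y | x y. x \<in> W \<and> y \<in> perp U W}" using z by (simp only: dec[symmetric])
      then obtain a b where ab: "z = a + b" "a \<in> W" "b \<in> perp U W" by blast
      have "f x a = 0" using x(1) ab(2) by (simp add: perp_def)
      moreover have "f x b = 0" by (rule bspec[OF x(2) ab(3)])
      ultimately show ?thesis by (simp add: ab(1) f_add_right)
    qed
    moreover have "x \<in> U" using x by (simp add: perp_def)
    ultimately show "x = 0" using U by (simp add: nondeg_def)
  qed
qed

text \<open>If a proper nonzero stable \<open>W\<close> meets its orthogonal in 0, then
  \<open>U\<close> splits. Otherwise the intersection \<open>X\<close> is isotropic; a complement
  \<open>W'\<close> of its orthogonal is dually paired with it, and both have dimension at most
  \<open>d\<close>, so \<open>t\<close> is trivial on \<open>X + W'\<close>, which is split off or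
  is all of \<open>U\<close>.\<close>

lemma good_nondeg:
  assumes "nondeg U" "dim U \<le> 2 * d"
  shows "good U"
  using assms
proof (induction "dim U" arbitrary: U rule: less_induct)
  case less
  note U = less.prems(1) and dimU = less.prems(2)
  have sub: "subspace U" and stU: "stable U" using U by (auto simp: nondeg_def)
  have split: "good U" if W: "nondeg W" "W \<subseteq> U" "W \<noteq> U" "W \<noteq> {0}" for W
  proof -
    note sp = nondeg_split[OF U W(1,2)]
    have subW: "subspace W" "stable W" "subspace (perp U W)" "stable (perp U W)" using W(1) sp(1) by (auto simp: nondeg_def)
    have PU: "perp U W \<subseteq> U" by (auto simp: perp_def)
    have "perp U W \<noteq> U"
    proof
      assume "perp U W = U"
      then have "W \<subseteq> {0}" using sp(2) W(2) by blast
      then show False using W(4) subspace_0[OF subW(1)] by blast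
    qed
    have lt: "dim W < dim U" "dim (perp U W) < dim U"
      using subspace_dim_equal[OF subW(1) sub W(2)] subspace_dim_equal[OF subW(3) sub PU]
        W(3) \<open>perp U W \<noteq> U\<close> not_less by blast+
    show ?thesis
      by (rule good_sum[OF less.hyps[OF lt(1) W(1)] subW(1,2) less.hyps[OF lt(2) sp(1)] subW(3,4) sp(2,3)])
        (use lt dimU in auto)
  qed
  show ?case
  proof (cases "irred U")
    case True
    show ?thesis
    proof (cases "\<exists>x\<in>U. t x \<noteq> x")
      case True
      show ?thesis by (rule good_of_irred[OF U \<open>irred U\<close> dimU True])
    qed (use good_of_trivial[OF U] in blast)
  next
    case False
    then obtain W where W: "subspace W" "stable W" "W \<subseteq> U" "W \<noteq> {0}" "W \<noteq> U" unfolding irred_def by blast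
    define X where "X = W \<inter> perp U W"
    have X: "subspace X" "stable X" "X \<subseteq> U"
    proof -
      show "subspace X" unfolding X_def by (intro subspace_inter W perp_subspace sub)
      show "stable X" unfolding X_def
        using stableD[OF W(2)] stableD[OF perp_stable[OF stU W(2)]] by (intro stableI) auto
      show "X \<subseteq> U" unfolding X_def using W(3) by blast
    qed
    show ?thesis
    proof (cases "X = {0}")
      case True
      have "nondeg W" unfolding nondeg_def
      proof (intro conjI W ballI impI)
        fix x assume x: "x \<in> W" "\<forall>y\<in>W. f x y = 0"
        then have "x \<in> X" using W(3) by (auto simp: X_def perp_def)
        then show "x = 0" using True by simp
      qed
      then show ?thesis using split W by simp
    next
      case False
      have iso: "f x y = 0" if "x \<in> X" "y \<in> X" for x y using that by (auto simp: X_def perp_def)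
      let ?P = "perp U X"
      have "?P \<subseteq> U" by (auto simp: perp_def)
      note P = perp_subspace[OF sub, of X] perp_stable[OF stU X(2)] this
      have XP: "X \<subseteq> ?P" using X(3) iso by (auto simp: perp_def)
      \<comment> \<open>An equivariant complement of the orthogonal of \<open>X\<close>: the facts
        \<open>c0\<close> and \<open>x0\<close> say that \<open>f\<close> pairs it with
        \<open>X\<close> nondegenerately on both sides.\<close>
      from stable_complement[OF sub stU P] obtain W' where W': "subspace W'" "stable W'" "W' \<subseteq> U"
        "?P \<inter> W' \<subseteq> {0}" "U = {x + y | x y. x \<in> ?P \<and> y \<in> W'}"
        by (elim exE conjE)
      have c0: "c = 0" if "c \<in> W'" "\<And>x. x \<in> X \<Longrightarrow> f c x = 0" for c
      proof -
        have "c \<in> ?P" using that W'(3) by (auto simp: perp_def)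
        then show ?thesis using that(1) W'(4) by blast
      qed
      have x0: "x = 0" if x: "x \<in> X" "\<And>y. y \<in> W' \<Longrightarrow> f x y = 0" for x
      proof -
        have "f x z = 0" if "z \<in> U" for z
        proof -
          have "z \<in> {x + y | x y. x \<in> ?P \<and> y \<in> W'}" using \<open>z \<in> U\<close> by (simp only: W'(5)[symmetric])
          then obtain a b where ab: "a \<in> ?P" "b \<in> W'" "z = a + b" by blast
          have "f a x = 0" using ab(1) x(1) by (simp add: perp_def)
          then show ?thesis using x(2)[OF ab(2)] f_skew[of x a] by (simp add: ab(3) f_add_right)
        qed
        then show ?thesis using U x(1) X(3) unfolding nondeg_def by blast
      qed
      have "dim W' \<le> dim X"
        by (rule pairing_dim_le[OF W'(1) X(1) f_add_left f_scale_left f_add_right f_scale_right c0])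
      moreover have "dim X \<le> dim W'"
        by (rule pairing_dim_le[OF X(1) W'(1) f_add_left f_scale_left f_add_right f_scale_right x0])
      moreover have "dim U + dim (?P \<inter> W') = dim ?P + dim W'"
        using dim_sums_Int[OF P(1) W'(1)] unfolding W'(5)[symmetric] .
      moreover have "dim (?P \<inter> W') = 0" using W'(4) by simp
      moreover have "dim X \<le> dim ?P" by (rule dim_subset[OF XP])
      \<comment> \<open>\<open>dim U = dim ?P + dim W'\<close>, \<open>dim X \<le> dim ?P\<close> by
        isotropy and \<open>dim X = dim W'\<close>, so twice this dimension is at most
        \<open>2 * d\<close>.\<close>
      ultimately have d: "dim X \<le> d" "dim W' \<le> d" using dimU by linarith+
      have tX: "t x = x" if "x \<in> X" for x
        by (rule small_trivial[OF X(1) t_lin _ t_pow d(1) that]) (use stableD(2)[OF X(2)] in blast)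
      have tW': "t x = x" if "x \<in> W'" for x
        by (rule small_trivial[OF W'(1) t_lin _ t_pow d(2) that]) (use stableD(2)[OF W'(2)] in blast)
      define Z where "Z = {x + y | x y. x \<in> X \<and> y \<in> W'}"
      have ZE: "\<exists>a\<in>X. \<exists>b\<in>W'. z = a + b" if "z \<in> Z" for z using that unfolding Z_def by blast
      have ZI: "a + b \<in> Z" if "a \<in> X" "b \<in> W'" for a b using that unfolding Z_def by blast
      have tZ: "t z = z" if z: "z \<in> Z" for z
        using ZE[OF z] tX tW' vsp.linear_add[OF t_lin] by auto
      have ZU: "Z \<subseteq> U"
      proof
        fix z assume "z \<in> Z"
        then obtain a b where "a \<in> X" "b \<in> W'" "z = a + b" using ZE by blast
        then show "z \<in> U" using X(3) W'(3) by (auto intro: subspace_add[OF sub])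
      qed
      have XZ: "X \<subseteq> Z" and W'Z: "W' \<subseteq> Z"
        using ZI[OF _ subspace_0[OF W'(1)]] ZI[OF subspace_0[OF X(1)]] by auto
      have ndZ: "nondeg Z" unfolding nondeg_def
      proof (intro conjI ballI impI)
        show "subspace Z" unfolding Z_def by (rule subspace_sums[OF X(1) W'(1)])
        show "stable Z" unfolding Z_def by (rule stable_plus[OF X(2) W'(2)])
        fix z assume z: "z \<in> Z" "\<forall>y\<in>Z. f z y = 0"
        obtain a b where ab: "a \<in> X" "b \<in> W'" "z = a + b" using ZE[OF z(1)] by blast
        \<comment> \<open>\<open>W'\<close> need not be isotropic, but the pairing is triangular:
          testing against \<open>X\<close> kills \<open>b\<close>, and then testing against
          \<open>W'\<close> kills \<open>a\<close>.\<close>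
        have "b = 0"
        proof (rule c0[OF ab(2)])
          fix x assume x: "x \<in> X"
          have "f z x = 0" using z(2) x XZ by blast
          then show "f b x = 0" using iso[OF ab(1) x] by (simp add: ab(3) f_add_left)
        qed
        moreover have "a = 0"
        proof (rule x0[OF ab(1)])
          fix y assume y: "y \<in> W'"
          have "f z y = 0" using z(2) y W'Z by blast
          then show "f a y = 0" using \<open>b = 0\<close> by (simp add: ab(3))
        qed
        ultimately show "z = 0" by (simp add: ab(3))
      qed
      show ?thesis
      proof (cases "Z = U")
        case True
        show ?thesis by (rule good_of_trivial[OF U]) (use tZ True in blast)
      next
        case False
        have "Z \<noteq> {0}" using XZ \<open>X \<noteq> {0}\<close> subspace_0[OF X(1)] by blast
        then show ?thesis using split[OF ndZ ZU False] by simp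
      qed
    qed
  qed
qed

end

section \<open>Groups of inertia type\<close>

text \<open>In a Sylow \<open>l\<close>-subgroup of \<open>H\<close> every element has order
  dividing both a power of \<open>l\<close> and \<open>m\<close>, so that subgroup is
  trivial.\<close>

lemma (in group) not_dvd_card_subgroup:
  assumes finH: "finite H" and H: "subgroup H G" and l: "prime l" "\<not> l dvd m"
    and pow: "\<And>g. g \<in> H \<Longrightarrow> g [^] m = \<one>"
  shows "\<not> l dvd card H"
proof
  assume dvd: "l dvd card H"
  interpret K: group "G\<lparr>carrier := H\<rparr>" using subgroup_imp_group[OF H] .
  have "card H > 0" using finH subgroup.one_closed[OF H] by (auto simp: card_gt_0_iff)
  define a where "a = multiplicity l (card H)"
  obtain r where "card H = l ^ a * r" using multiplicity_dvd[of l "card H"] unfolding a_def by (auto elim: dvdE)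
  then have "Coset.order (G\<lparr>carrier := H\<rparr>) = l ^ a * r" by (simp add: Coset.order_def)
  from sylow_thm[OF l(1) K.group_axioms this] finH
  obtain S where S: "subgroup S (G\<lparr>carrier := H\<rparr>)" "card S = l ^ a" by auto
  have a: "a > 0" unfolding a_def using dvd \<open>card H > 0\<close> l(1) by (simp add: prime_multiplicity_gt_zero_iff)
  have S': "subgroup S G" by (rule incl_subgroup[OF H S(1)])
  interpret S: group "G\<lparr>carrier := S\<rparr>" using subgroup_imp_group[OF S'] .
  have SH: "S \<subseteq> H" using subgroup.subset[OF S(1)] by simp
  have "S \<subseteq> {\<one>}"
  proof
    fix g assume g: "g \<in> S"
    have gG: "g \<in> carrier G" using g subgroup.subset[OF S'] by blast
    have "g [^] (l ^ a) = \<one>"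
      using S.pow_order_eq_1[of g] g S(2) by (simp add: Coset.order_def nat_pow_consistent[symmetric])
    then have 1: "ord g dvd l ^ a" by (simp add: pow_eq_id[OF gG])
    have 2: "ord g dvd m" using pow[OF subsetD[OF SH g]] by (simp add: pow_eq_id[OF gG])
    have "coprime (l ^ a) m" using prime_imp_coprime[OF l] by simp
    then have "ord g = 1" using 1 2 by (metis coprime_common_divisor_nat nat_dvd_1_iff_1)
    then show "g \<in> {\<one>}" using pow_ord_eq_1[OF gG] gG by simp
  qed
  then have "card S \<le> 1" using card_mono[of "{\<one>}" S] by simp
  moreover have "l ^ a \<ge> 2 ^ 1" using prime_ge_2_nat[OF l(1)] a power_increasing[of 1 a l] by simp
  ultimately show False using S(2) by simp
qed

text \<open>\<open>H\<close> is the preimage of the part of \<open>Q\<close> of order prime to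
  \<open>l\<close>, and \<tau> is a power of a lift of a generator of \<open>Q\<close>, adjusted to
  have \<open>l\<close>-power order while its image still generates the \<open>l\<close>-part of
  \<open>Q\<close>. The exponent of \<open>H\<close> divides \<open>N' * m\<close>, so its order is
  prime to \<open>l\<close>.\<close>

lemma cyclic_extension_decomposition:
  fixes G (structure)
  assumes hom: "group_hom G Q \<phi>" and fin: "finite (carrier G)"
    and surj: "\<phi> ` carrier G = carrier Q" and cyc: "cyclic_group Q"
    and l: "prime l" "\<not> l dvd m" and ker: "\<And>g. g \<in> carrier G \<Longrightarrow> \<phi> g = \<one>\<^bsub>Q\<^esub> \<Longrightarrow> g [^] (m::nat) = \<one>"
  shows "\<exists>H \<tau> k. subgroup H G \<and> \<not> l dvd card H \<and> \<tau> \<in> carrier G \<and> \<tau> [^] (l ^ k :: nat) = \<one> \<and>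
    (\<forall>h\<in>H. \<tau> \<otimes> h \<otimes> inv \<tau> \<in> H) \<and> (\<forall>h\<in>H. inv \<tau> \<otimes> h \<otimes> \<tau> \<in> H) \<and>
    (\<forall>g\<in>carrier G. \<exists>i::nat. g \<otimes> \<tau> [^] i \<in> H)"
proof -
  interpret group G by (rule group_hom.axioms(1)[OF hom])
  interpret Q: group Q by (rule group_hom.axioms(2)[OF hom])
  interpret \<phi>: group_hom G Q \<phi> by (rule hom)
  interpret Qc: comm_group Q by (rule Q.cyclic_imp_abelian_group[OF cyc])
  have finQ: "finite (carrier Q)" unfolding surj[symmetric] using fin by simp
  define N where "N = Coset.order (Q)"
  have N0: "N > 0" unfolding N_def using finQ Q.order_gt_0_iff_finite by blast
  define k where "k = multiplicity l N"
  obtain N' where N': "N = l ^ k * N'" "\<not> l dvd N'"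
    using multiplicity_decompose'[of N l] N0 l(1) unfolding k_def by (metis neq0_conv not_prime_unit)
  define M where "M = N' * m"
  have lM: "\<not> l dvd M"
  proof
    assume "l dvd M"
    then show False using N'(2) l by (simp add: M_def prime_dvd_mult_iff)
  qed
  have "coprime l M" by (rule prime_imp_coprime[OF l(1) lM])
  then have "coprime M (l ^ k)" by (simp add: coprime_commute)
  from cong_solve_coprime_nat[OF this] obtain c where c: "[M * c = Suc 0] (mod l ^ k)" by (elim exE)
  obtain X where X: "X \<in> carrier (Q)" "carrier (Q) = range (\<lambda>n::int. X [^]\<^bsub>Q\<^esub> n)"
    using cyc unfolding Q.cyclic_group by (elim exE conjE bexE)
  obtain x where x: "x \<in> carrier G" "X = \<phi> x" using X(1) surj by blast
  have XN: "X [^]\<^bsub>Q\<^esub> N = \<one>\<^bsub>Q\<^esub>" unfolding N_def by (rule Q.pow_order_eq_1[OF X(1)])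
  have XNi: "X [^]\<^bsub>Q\<^esub> (int N * j) = \<one>\<^bsub>Q\<^esub>" for j :: int
    using XN X(1) by (simp add: Q.int_pow_pow[symmetric] Q.int_pow_one int_pow_int)
  \<comment> \<open>The factor \<open>M = N' * m\<close> in the exponent makes \<tau> of
    \<open>l\<close>-power order; the factor \<open>c\<close>, inverse to \<open>M\<close> modulo
    \<open>l ^ k\<close>, keeps its image equal to \<open>X\<close> modulo the part of
    \<open>Q\<close> of order prime to \<open>l\<close>.\<close>
  define \<tau> where "\<tau> = x [^] (M * c)"
  have \<tau>: "\<tau> \<in> carrier G" unfolding \<tau>_def using x(1) by simp
  have \<tau>1: "\<tau> [^] (l ^ k) = \<one>"
  proof -
    have "\<phi> (x [^] N) = \<one>\<^bsub>Q\<^esub>" using XN x by (simp add: \<phi>.hom_nat_pow)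
    then have "(x [^] N) [^] m = \<one>" using x(1) by (intro ker) auto
    then have "x [^] (N * m * c) = \<one>" using x(1) by (simp add: nat_pow_pow[symmetric])
    moreover have "N * m * c = M * c * l ^ k" by (simp add: N'(1) M_def)
    ultimately show ?thesis unfolding \<tau>_def using x(1) by (simp add: nat_pow_pow)
  qed
  define H where "H = {g \<in> carrier G. \<phi> g [^]\<^bsub>Q\<^esub> N' = \<one>\<^bsub>Q\<^esub>}"
  have HI: "g \<in> H" if "g \<in> carrier G" "\<phi> g [^]\<^bsub>Q\<^esub> N' = \<one>\<^bsub>Q\<^esub>" for g using that by (simp add: H_def)
  have sub: "subgroup H G"
  proof (rule subgroupI)
    show "H \<subseteq> carrier G" by (auto simp: H_def)
    have "\<one> \<in> H" by (rule HI) simp_all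
    then show "H \<noteq> {}" by blast
    show "inv g \<in> H" if "g \<in> H" for g
      using that by (auto simp: H_def Q.nat_pow_inv)
    show "g \<otimes> h \<in> H" if "g \<in> H" "h \<in> H" for g h
      using that by (auto simp: H_def Qc.nat_pow_distrib)
  qed
  have "g [^] M = \<one>" if "g \<in> H" for g
  proof -
    have gG: "g \<in> carrier G" using that by (simp add: H_def)
    have "\<phi> (g [^] N') = \<one>\<^bsub>Q\<^esub>" using that gG by (simp add: H_def \<phi>.hom_nat_pow)
    then have "(g [^] N') [^] m = \<one>" using gG by (intro ker) auto
    then show ?thesis using gG by (simp add: nat_pow_pow M_def)
  qed
  from not_dvd_card_subgroup[OF finite_subset[OF subgroup.subset[OF sub] fin] sub l(1) lM this] have card: "\<not> l dvd card H" .
  have conj: "a \<otimes> h \<otimes> b \<in> H" if ab: "a \<in> carrier G" "b \<in> carrier G" "b \<otimes> a = \<one>" and h: "h \<in> H" for a b h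
  proof (rule HI)
    have hG: "h \<in> carrier G" using h by (simp add: H_def)
    then show "a \<otimes> h \<otimes> b \<in> carrier G" using ab by simp
    have "\<phi> (a \<otimes> h \<otimes> b) = \<phi> h \<otimes>\<^bsub>Q\<^esub> (\<phi> b \<otimes>\<^bsub>Q\<^esub> \<phi> a)"
      using ab(1,2) hG by (simp add: Qc.m_ac)
    also have "\<phi> b \<otimes>\<^bsub>Q\<^esub> \<phi> a = \<phi> (b \<otimes> a)" using ab(1,2) by simp
    also have "\<phi> h \<otimes>\<^bsub>Q\<^esub> \<phi> (b \<otimes> a) = \<phi> h" using hG by (simp add: ab(3))
    finally show "\<phi> (a \<otimes> h \<otimes> b) [^]\<^bsub>Q\<^esub> N' = \<one>\<^bsub>Q\<^esub>" using h by (simp add: H_def)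
  qed
  have gen: "\<exists>i::nat. g \<otimes> \<tau> [^] i \<in> H" if g: "g \<in> carrier G" for g
  proof -
    have "\<phi> g \<in> carrier (Q)" using g by simp
    then obtain i :: int where i: "\<phi> g = X [^]\<^bsub>Q\<^esub> i" using X(2) by auto
    \<comment> \<open>A natural number congruent to \<open>- i\<close>: it cancels the exponent of
      the image of \<open>g\<close> modulo \<open>l ^ k\<close>, and what remains is killed by the
      power \<open>N'\<close>.\<close>
    define i' where "i' = nat ((- i) mod int (l ^ k))"
    have lk: "int (l ^ k) > 0" using l(1) by (simp add: prime_gt_0_nat)
    have i': "int i' = (- i) mod int (l ^ k)" unfolding i'_def using lk by simp
    have c': "[int (M * c) = 1] (mod int (l ^ k))"
      using c by (simp only: cong_int_iff[symmetric] One_nat_def[symmetric] of_nat_1)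
    have "[int i' = - i] (mod int (l ^ k))" unfolding i' by (rule cong_mod_leftI[OF cong_refl])
    from cong_add[OF cong_refl cong_mult[OF c' this]]
    have "[i + int (M * c) * int i' = i + 1 * (- i)] (mod int (l ^ k))" .
    then have "int (l ^ k) dvd i + int (M * c) * int i'" by (simp only: mult_1 add.right_inverse cong_0_iff)
    then obtain z where z: "i + int (M * c) * int i' = int (l ^ k) * z" by (elim dvdE)
    have "\<tau> [^] i' = x [^] (M * c * i')" unfolding \<tau>_def by (rule nat_pow_pow[OF x(1)])
    then have "\<phi> (\<tau> [^] i') = X [^]\<^bsub>Q\<^esub> (M * c * i')" by (simp only: \<phi>.hom_nat_pow[OF x(1)] x(2))
    then have "\<phi> (\<tau> [^] i') = X [^]\<^bsub>Q\<^esub> (int (M * c) * int i')" by (simp only: int_pow_int[symmetric] of_nat_mult)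
    then have "\<phi> (g \<otimes> \<tau> [^] i') = X [^]\<^bsub>Q\<^esub> i \<otimes>\<^bsub>Q\<^esub> X [^]\<^bsub>Q\<^esub> (int (M * c) * int i')"
      using i \<phi>.hom_mult[OF g nat_pow_closed[OF \<tau>]] by simp
    also have "\<dots> = X [^]\<^bsub>Q\<^esub> (int (l ^ k) * z)" by (simp only: Q.int_pow_mult[OF X(1), symmetric] z)
    finally have "\<phi> (g \<otimes> \<tau> [^] i') [^]\<^bsub>Q\<^esub> N' = (X [^]\<^bsub>Q\<^esub> (int (l ^ k) * z)) [^]\<^bsub>Q\<^esub> int N'"
      by (simp only: int_pow_int)
    also have "\<dots> = X [^]\<^bsub>Q\<^esub> (int (l ^ k) * z * int N')" using X(1) by (simp only: Q.int_pow_pow)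
    also have "int (l ^ k) * z * int N' = int N * z" by (simp add: N'(1))
    also have "X [^]\<^bsub>Q\<^esub> (int N * z) = \<one>\<^bsub>Q\<^esub>" by (rule XNi)
    finally have "g \<otimes> \<tau> [^] i' \<in> H" using g \<tau> by (intro HI) auto
    then show ?thesis ..
  qed
  show ?thesis
  proof (rule exI[of _ H], rule exI[of _ \<tau>], rule exI[of _ k], intro conjI ballI)
    show "\<tau> \<otimes> h \<otimes> inv \<tau> \<in> H" if "h \<in> H" for h using that \<tau> by (intro conj) auto
    show "inv \<tau> \<otimes> h \<otimes> \<tau> \<in> H" if "h \<in> H" for h using that \<tau> by (intro conj) auto
    show "\<exists>i::nat. g \<otimes> \<tau> [^] i \<in> H" if "g \<in> carrier G" for g by (rule gen[OF that])
  qed (fact sub card \<tau> \<tau>1)+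
qed

text \<open>The preceding decomposition is applied to the projection of \<open>G\<close> onto its
  cyclic quotient by the normal \<open>p\<close>-subgroup, whose elements are killed by
  \<open>p ^ n\<close>.\<close>

lemma inertia_type_decomposition:
  fixes G (structure)
  assumes p: "prime p" and G: "inertia_type p G" and l: "prime l" "l \<noteq> p"
  shows "\<exists>H \<tau> k. subgroup H G \<and> \<not> l dvd card H \<and> \<tau> \<in> carrier G \<and> \<tau> [^] (l ^ k :: nat) = \<one> \<and>
    (\<forall>h\<in>H. \<tau> \<otimes> h \<otimes> inv \<tau> \<in> H) \<and> (\<forall>h\<in>H. inv \<tau> \<otimes> h \<otimes> \<tau> \<in> H) \<and>
    (\<forall>g\<in>carrier G. \<exists>i::nat. g \<otimes> \<tau> [^] i \<in> H)"
proof -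
  obtain H0 n where grp: "group G" and fin: "finite (carrier G)" and H0: "H0 \<lhd> G" "card H0 = p ^ n"
    and cyc: "cyclic_group (G Mod H0)" using G unfolding inertia_type_def by (elim exE conjE)
  interpret group G by (rule grp)
  interpret N: normal H0 G by (rule H0(1))
  have hom: "group_hom G (G Mod H0) ((#>) H0)"
    unfolding group_hom_def group_hom_axioms_def
    by (intro conjI grp N.factorgroup_is_group N.r_coset_hom_Mod)
  have surj: "(#>) H0 ` carrier G = carrier (G Mod H0)" by (auto simp: FactGroup_def RCOSETS_def)
  have ldvd: "\<not> l dvd p ^ n"
  proof
    assume "l dvd p ^ n"
    then have "l dvd p" by (rule prime_dvd_power[OF l(1)])
    then show False using primes_dvd_imp_eq[OF l(1) p] l(2) by simp
  qed
  have ker: "g [^] (p ^ n) = \<one>" if g: "g \<in> carrier G" "H0 #> g = \<one>\<^bsub>G Mod H0\<^esub>" for g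
  proof -
    interpret K: group "G\<lparr>carrier := H0\<rparr>" by (rule subgroup_imp_group[OF N.is_subgroup])
    have "H0 #> g = H0" using g(2) by simp
    from coset_join1[OF this g(1) N.is_subgroup] have "g \<in> H0" .
    then show ?thesis using K.pow_order_eq_1[of g] H0(2) by (simp add: Coset.order_def nat_pow_consistent[symmetric])
  qed
  show ?thesis by (rule cyclic_extension_decomposition[OF hom fin surj cyc l(1) ldvd ker])
qed

section \<open>Perfect forms on lattices\<close>

context val_space
begin

text \<open>For surjectivity, a functional is first represented over \<open>K\<close>, where
  nondegeneracy suffices; it is integral on \<open>T\<close>, so self-duality puts the representing
  vector into \<open>T\<close>. The other side follows from skew-symmetry by composing with
  negation.\<close>

lemma perfect_form_on_selfdual:
  assumes T: "lattice UNIV T"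
    and add_left: "\<And>x y z. g (x + y) z = g x z + g y z" and add_right: "\<And>x y z. g x (y + z) = g x y + g x z"
    and scale_left: "\<And>c x y. g (c *s x) y = c * g x y" and scale_right: "\<And>c x y. g x (c *s y) = c * g x y"
    and alt: "\<And>x. g x x = 0"
    and int: "\<And>x y. x \<in> T \<Longrightarrow> y \<in> T \<Longrightarrow> g x y \<in> \<O>"
    and dual: "\<And>x. \<forall>y\<in>T. g x y \<in> \<O> \<Longrightarrow> x \<in> T"
  shows "perfect_form_on v scale T g"
proof -
  obtain B where B: "finite B" "independent B" "span B = UNIV" "T = ospan B"
    using lattice_basis[OF T] by (elim exE conjE)
  have osub: "osub T" by (rule lattice_osub[OF T])
  have BT: "b \<in> T" if b: "b \<in> B" for b using subsetD[OF ospan_superset[OF B(1)] b] by (simp add: B(4))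
  have skew: "g y x = - g x y" for x y
  proof -
    have "g x x + g y x + (g x y + g y y) = 0" using alt[of "x + y"] by (simp only: add_left add_right)
    then show ?thesis by (simp add: alt eq_neg_iff_add_eq_0)
  qed
  have g0: "g x 0 = 0" for x using scale_right[of x 0 0] by simp
  have g_sum: "g x (sum F I) = (\<Sum>i\<in>I. g x (F i))" for x F and I :: "'v set"
    by (induction I rule: infinite_finite_induct) (simp_all add: add_right g0)
  have g_diff: "g (x - y) z = g x z - g y z" for x y z
    using add_left[of "x - y" y z] by simp
  have zero: "x = 0" if x: "\<forall>y\<in>T. g x y = 0" for x
    by (rule lattice_inter[OF T], rule dual) (simp add: scale_left x)
  have bil: "val_bilinear_form_on v scale T g"
    unfolding val_bilinear_form_on_def val_dual_def
    using osub_add[OF osub] osub_scale[OF osub] int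
    by (simp add: add_left add_right scale_left scale_right)
  define L where "L x = (\<Sum>b\<in>B. g x b *s b)" for x
  have L: "lin L" unfolding L_def
    by (rule lin_I) (simp_all add: add_left scale_left scale_left_distrib sum.distrib scale_sum_right)
  have coeffs: "u b = w b" if eq: "(\<Sum>b\<in>B. u b *s b) = (\<Sum>b\<in>B. w b *s b)" and b: "b \<in> B" for u w :: "'v \<Rightarrow> 'k" and b
  proof -
    have "(\<Sum>b\<in>B. (u b - w b) *s b) = 0" using eq by (simp add: scale_left_diff_distrib sum_subtractf)
    from independentD[OF B(2,1) subset_refl this b] show ?thesis by simp
  qed
  have L_inj: "x = 0" if x: "L x = 0" for x
  proof (rule zero, rule ballI)
    fix y assume "y \<in> T"
    then obtain c where c: "y = (\<Sum>b\<in>B. c b *s b)" unfolding B(4) ospan_def by auto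
    have "g x b = 0" if b: "b \<in> B" for b
      using coeffs[of "g x" "\<lambda>_. 0" b] x b by (simp add: L_def)
    then show "g x y = 0" by (simp add: c g_sum scale_right)
  qed
  have L_surj: "L ` UNIV = UNIV" by (rule inj_endo_surj[OF subspace_UNIV L]) (simp_all add: L_inj)
  have bij: "bij_betw (\<lambda>x. \<lambda>y\<in>T. g x y) T (val_dual v scale T)"
    unfolding bij_betw_def
  proof
    show "inj_on (\<lambda>x. \<lambda>y\<in>T. g x y) T"
    proof (rule inj_onI)
      fix x x' assume eq: "(\<lambda>y\<in>T. g x y) = (\<lambda>y\<in>T. g x' y)"
      have "g x y = g x' y" if y: "y \<in> T" for y using fun_cong[OF eq, of y] y by simp
      then have "x - x' = 0" by (intro zero) (simp add: g_diff)
      then show "x = x'" by simp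
    qed
    show "(\<lambda>x. \<lambda>y\<in>T. g x y) ` T = val_dual v scale T"
    proof (rule equalityI; rule subsetI)
      fix \<psi> assume "\<psi> \<in> (\<lambda>x. \<lambda>y\<in>T. g x y) ` T"
      then show "\<psi> \<in> val_dual v scale T" using bil unfolding val_bilinear_form_on_def by (elim imageE) simp
    next
      fix \<psi> assume \<psi>: "\<psi> \<in> val_dual v scale T"
      then have \<psi>E: "\<psi> \<in> T \<rightarrow>\<^sub>E \<O>" and \<psi>_add: "\<And>x y. x \<in> T \<Longrightarrow> y \<in> T \<Longrightarrow> \<psi> (x + y) = \<psi> x + \<psi> y"
        and \<psi>_scale: "\<And>a x. a \<in> \<O> \<Longrightarrow> x \<in> T \<Longrightarrow> \<psi> (a *s x) = a * \<psi> x"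
        unfolding val_dual_def by simp_all
      have "(\<Sum>b\<in>B. \<psi> b *s b) \<in> L ` UNIV" by (simp only: L_surj UNIV_I)
      then obtain x where x: "(\<Sum>b\<in>B. \<psi> b *s b) = L x" by (elim imageE)
      have gb: "g x b = \<psi> b" if b: "b \<in> B" for b using coeffs[OF x[unfolded L_def] b] by simp
      have \<psi>0: "\<psi> 0 = 0" using \<psi>_scale[of 0 0] osub_0[OF osub] by simp
      have \<psi>_sum: "\<psi> (\<Sum>b\<in>S. c b *s b) = (\<Sum>b\<in>S. c b * \<psi> b) \<and> (\<Sum>b\<in>S. c b *s b) \<in> T"
        if c: "\<forall>b\<in>B. c b \<in> \<O>" and S: "S \<subseteq> B" for c S
        using finite_subset[OF S B(1)] S
      proof (induction S rule: finite_induct)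
        case empty then show ?case by (simp add: \<psi>0 osub_0[OF osub])
      next
        case (insert b S)
        then have "b \<in> T" "c b \<in> \<O>" using BT c by auto
        then show ?case using insert by (simp add: \<psi>_add \<psi>_scale osub_add[OF osub] osub_scale[OF osub])
      qed
      have gy: "g x y = \<psi> y" if y: "y \<in> T" for y
      proof -
        obtain c where c: "y = (\<Sum>b\<in>B. c b *s b)" "\<forall>b\<in>B. c b \<in> \<O>" using y unfolding B(4) ospan_def by auto
        show ?thesis using \<psi>_sum[OF c(2) subset_refl] by (simp add: c(1) g_sum scale_right gb)
      qed
      then have "x \<in> T" using \<psi>E by (intro dual) (simp add: PiE_mem[OF \<psi>E])
      moreover have "\<psi> = (\<lambda>y\<in>T. g x y)"
        using PiE_restrict[OF \<psi>E] gy by (metis (no_types, lifting) restrict_ext)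
      ultimately show "\<psi> \<in> (\<lambda>x. \<lambda>y\<in>T. g x y) ` T" by simp
    qed
  qed
  have neg: "bij_betw uminus T T"
    by (rule bij_betw_byWitness[where f' = uminus]) (auto intro: osub_minus[OF osub])
  have "(\<lambda>y. \<lambda>x\<in>T. g x y) = (\<lambda>x. \<lambda>y\<in>T. g x y) \<circ> uminus"
  proof (rule ext, simp, rule restrict_ext)
    fix x y show "g y x = g (- x) y" using g_diff[of 0 x y] scale_left[of 0 0 y] skew[of y x] by simp
  qed
  then have "bij_betw (\<lambda>y. \<lambda>x\<in>T. g x y) T (val_dual v scale T)"
    using bij_betw_trans[OF neg bij] by simp
  then show ?thesis unfolding perfect_form_on_def using bil bij by simp
qed

lemma val_lattice_lattice:
  assumes "lattice UNIV T"
  shows "val_lattice v scale T"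
proof -
  obtain B where B: "finite B" "independent B" "span B = UNIV" "T = ospan B"
    using lattice_basis[OF assms] by (elim exE conjE)
  have "finite_dimensional_vector_space scale B" using B(1-3) by unfold_locales
  then show ?thesis unfolding val_lattice_def using B(4) by (auto simp: ospan_def)
qed

end

text \<open>By division with remainder, the naturals in the maximal ideal are multiples of the least
  positive one, which is therefore the greatest common divisor in the definition of the residue
  characteristic.\<close>

lemma residue_char_valuation:
  fixes v :: "'k::field_char_0 \<Rightarrow> int"
  assumes "discrete_valuation v" "residue_char v = l" "l > 0"
  shows "v (of_nat l) \<ge> 1" and "\<not> l dvd n \<Longrightarrow> v (of_nat n) = 0"
proof -
  interpret discrete_valuation v by fact
  define S where "S = {n. (of_nat n :: 'k) \<in> val_ge v 1}"
  have l: "l = Gcd S" using assms(2) by (simp add: residue_char_def val_max_ideal_def S_def)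
  have "\<exists>m. m > 0 \<and> m \<in> S"
  proof (rule ccontr)
    assume "\<not> ?thesis"
    then have "S \<subseteq> {0}" by auto
    then show False using assms(3) by (simp only: l Gcd_0_iff[THEN iffD2])
  qed
  then obtain m where m: "m > 0" "m \<in> S" "\<And>m'. m' < m \<Longrightarrow> \<not> (m' > 0 \<and> m' \<in> S)"
    using exists_least_iff[of "\<lambda>m. m > 0 \<and> m \<in> S"] by auto
  have m_dvd: "m dvd n" if n: "n \<in> S" for n
  proof -
    have "(of_nat n :: 'k) = of_nat (n div m) * of_nat m + of_nat (n mod m)"
      by (metis div_mult_mod_eq of_nat_add of_nat_mult)
    then have "(of_nat (n mod m) :: 'k) = of_nat n - of_nat (n div m) * of_nat m" by simp
    moreover have "(of_nat (n div m) :: 'k) * of_nat m \<in> val_ge v (0 + 1)"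
      using O_of_nat m(2) by (intro val_ge_mult) (simp_all add: S_def val_ring_def)
    ultimately have "n mod m \<in> S" using n val_ge_diff[of "of_nat n" 1 "of_nat (n div m) * of_nat m"] by (simp add: S_def)
    then show ?thesis using m(3)[of "n mod m"] m(1) by (auto simp: dvd_eq_mod_eq_0)
  qed
  have "l dvd m" using m(2) by (simp add: l)
  moreover have "m dvd l" unfolding l using m_dvd by (rule Gcd_greatest)
  ultimately have lm: "l = m" by (rule dvd_antisym)
  show "v (of_nat l) \<ge> 1" using m(1,2) by (simp add: lm S_def val_ge_def)
  show "v (of_nat n) = 0" if n: "\<not> l dvd n"
  proof -
    have "n \<noteq> 0" using n by (intro notI) simp
    then have 0: "(of_nat n :: 'k) \<noteq> 0" by simp
    moreover have "n \<notin> S" using m_dvd n lm by auto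
    ultimately show ?thesis using O_iff[OF 0] O_of_nat[of n] by (auto simp: S_def val_ge_def)
  qed
qed

theorem theorem4p3:
  fixes p l d :: nat
    and G :: "('g, 'm) monoid_scheme"
    and v :: "'k::field_char_0 \<Rightarrow> int"
    and scale :: "'k \<Rightarrow> 'v::ab_group_add \<Rightarrow> 'v"
    and Bs :: "'v set"
    and \<rho> :: "'g \<Rightarrow> 'v \<Rightarrow> 'v"
  assumes "prime p"
    and "inertia_type p G"
    and "prime l" and "l \<noteq> p"
    and "complete_discrete_valuation v"
    and "residue_char v = l"
    and "finite_dimensional_vector_space scale Bs"
    and "vector_space.dim scale UNIV = 2 * d"
    and "symplectic_rep G scale \<rho>"
    and "int l > int d * abs_ramification_index v + 1"
  shows "\<exists>T f'. val_lattice v scale T \<and> stable_under G \<rho> T \<and>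
           perfect_form_on v scale T f' \<and> alternating_on T f' \<and> invariant_form_on G \<rho> T f'"
proof -
  obtain H \<tau> k where H: "subgroup H G" "\<not> l dvd card H" and \<tau>: "\<tau> \<in> carrier G" "\<tau> [^]\<^bsub>G\<^esub> (l ^ k :: nat) = \<one>\<^bsub>G\<^esub>"
    and conj: "\<forall>h\<in>H. \<tau> \<otimes>\<^bsub>G\<^esub> h \<otimes>\<^bsub>G\<^esub> inv\<^bsub>G\<^esub> \<tau> \<in> H" "\<forall>h\<in>H. inv\<^bsub>G\<^esub> \<tau> \<otimes>\<^bsub>G\<^esub> h \<otimes>\<^bsub>G\<^esub> \<tau> \<in> H"
    and gen: "\<forall>g\<in>carrier G. \<exists>i::nat. g \<otimes>\<^bsub>G\<^esub> \<tau> [^]\<^bsub>G\<^esub> i \<in> H"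
    using inertia_type_decomposition[OF assms(1-4)] by (elim exE conjE)
  have rep: "group_rep G scale \<rho>" using assms(9) unfolding symplectic_rep_def by (rule conjunct1)
  obtain f where f: "bilinear_form scale f" "nondegenerate_form f" "alternating_on UNIV f" "invariant_form_on G \<rho> UNIV f"
    using assms(9) unfolding symplectic_rep_def by (elim exE conjE)
  have f_lin: "f (x + y) z = f x z + f y z" "f x (y + z) = f x y + f x z"
    "f (scale c x) y = c * f x y" "f x (scale c y) = c * f x y" for x y z c
    using f(1) unfolding bilinear_form_def Vector_Spaces.linear_iff by simp_all
  have f_inv: "f (\<rho> g x) (\<rho> g y) = f x y" if "g \<in> carrier G" for g x y
    using f(4) that unfolding invariant_form_on_def by simp
  have lin: "Vector_Spaces.linear scale scale (\<rho> g)" if "g \<in> carrier G" for g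
    using rep that unfolding group_rep_def by simp
  interpret ga: group_action G UNIV \<rho> using rep unfolding group_rep_def by (rule conjunct1)
  interpret group G using ga.group_hom by (rule group_hom.axioms(1))
  have fin: "finite (carrier G)" using assms(2) unfolding inertia_type_def by simp
  have HG: "h \<in> carrier G" if "h \<in> H" for h using subgroup.mem_carrier[OF H(1) that] .
  have finH: "finite H" using finite_subset[OF subgroup.subset[OF H(1)] fin] .
  have \<rho>_mult: "\<rho> (g \<otimes>\<^bsub>G\<^esub> h) x = \<rho> g (\<rho> h x)" if "g \<in> carrier G" "h \<in> carrier G" for g h x
    using ga.composition_rule[OF UNIV_I that] .
  have \<rho>_one: "\<rho> \<one>\<^bsub>G\<^esub> = (\<lambda>x. x)" using ga.id_eq_one by (simp add: restrict_UNIV)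
  have \<rho>_pow: "\<rho> (\<tau> [^]\<^bsub>G\<^esub> n) x = (\<rho> \<tau> ^^ n) x" for n :: nat and x
    by (induction n arbitrary: x) (simp_all add: \<rho>_one \<rho>_mult \<tau>(1) funpow_swap1)
  have Hpow: "h [^]\<^bsub>G\<^esub> card H = \<one>\<^bsub>G\<^esub>" if "h \<in> H" for h
  proof -
    interpret K: group "G\<lparr>carrier := H\<rparr>" by (rule subgroup_imp_group[OF H(1)])
    show ?thesis using K.pow_order_eq_1[of h] that by (simp add: Coset.order_def nat_pow_consistent[symmetric])
  qed
  \<comment> \<open>\<rho> need not be injective, so the order of the image is controlled through
    its exponent, which divides \<open>card H\<close>.\<close>
  have lH: "\<not> l dvd card (\<rho> ` H)"
  proof -
    interpret gh: group_hom G "BijGroup UNIV" \<rho> by (rule ga.group_hom)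
    have pow: "g [^]\<^bsub>BijGroup UNIV\<^esub> card H = \<one>\<^bsub>BijGroup UNIV\<^esub>" if g: "g \<in> \<rho> ` H" for g
      using g
    proof (elim imageE)
      fix h assume h: "g = \<rho> h" "h \<in> H"
      show ?thesis using gh.hom_nat_pow[OF HG[OF h(2)], of "card H"] by (simp add: h(1) Hpow[OF h(2)])
    qed
    show ?thesis
      by (rule gh.H.not_dvd_card_subgroup[OF finite_imageI[OF finH] gh.subgroup_img_is_subgroup[OF H(1)] assms(3) H(2) pow])
  qed
  have dv: "discrete_valuation v" using assms(5) by (rule complete_discrete_valuation.axioms(1))
  note rc = residue_char_valuation[OF dv assms(6) prime_gt_0_nat[OF assms(3)]]
  define e where "e = nat (v (of_nat l))"
  have e: "v (of_nat l) = int e" "e > 0" using rc(1) by (simp_all add: e_def)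
  interpret val_space scale Bs v by (rule val_space.intro[OF assms(7,5)])
  interpret symplectic_val_space scale Bs v l e f "\<rho> ` H" "\<rho> \<tau>" k d
  proof (intro symplectic_val_space.intro mixed_val_space.intro mixed_val_space_axioms.intro
      symplectic_val_space_axioms.intro, goal_cases)
    case 1 show ?case by (rule val_space_axioms)
  next
    case 2 show ?case by (rule assms(3))
  next
    case 3 show ?case by (rule e(1))
  next
    case 4 show ?case by (rule e(2))
  next
    case (5 x y z) show ?case by (rule f_lin(1))
  next
    case (6 x y z) show ?case by (rule f_lin(2))
  next
    case (7 c x y) show ?case by (rule f_lin(3))
  next
    case (8 x c y) show ?case by (rule f_lin(4))
  next
    case (9 x) show ?case using f(3) by (simp add: alternating_on_def)
  next
    case (10 h) then show ?case by (elim imageE) (simp add: lin HG)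
  next
    case 11 show ?case using finH by simp
  next
    case 12 show ?case using subgroup.one_closed[OF H(1)] \<rho>_one by (metis imageI)
  next
    case (13 h h')
    then obtain a b where ab: "a \<in> H" "b \<in> H" "h = \<rho> a" "h' = \<rho> b" by (elim imageE)
    have "\<rho> (a \<otimes>\<^bsub>G\<^esub> b) = (\<lambda>x. h (h' x))" by (rule ext) (simp add: \<rho>_mult HG ab)
    then show ?case using subgroup.m_closed[OF H(1) ab(1,2)] by (metis imageI)
  next
    case (14 h)
    then obtain a where a: "a \<in> H" "h = \<rho> a" by (elim imageE)
    have "\<forall>x. \<rho> a (\<rho> (inv\<^bsub>G\<^esub> a) x) = x \<and> \<rho> (inv\<^bsub>G\<^esub> a) (\<rho> a x) = x"
      using HG[OF a(1)] by (simp add: \<rho>_mult[symmetric] \<rho>_one)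
    then show ?case using subgroup.m_inv_closed[OF H(1) a(1)] a(2) by (intro bexI[of _ "\<rho> (inv\<^bsub>G\<^esub> a)"]) simp_all
  next
    case 15 show ?case by (rule rc(2)[OF lH])
  next
    case 16 show ?case by (rule lin[OF \<tau>(1)])
  next
    case (17 x) show ?case using \<rho>_pow[of "l ^ k" x] by (simp add: \<tau>(2) \<rho>_one)
  next
    case (18 h)
    then obtain a where a: "a \<in> H" "h = \<rho> a" by (elim imageE)
    have "\<tau> \<otimes>\<^bsub>G\<^esub> a \<otimes>\<^bsub>G\<^esub> inv\<^bsub>G\<^esub> \<tau> \<otimes>\<^bsub>G\<^esub> \<tau> = \<tau> \<otimes>\<^bsub>G\<^esub> a"
      using HG[OF a(1)] \<tau>(1) by (simp add: m_assoc)
    then have "\<rho> \<tau> (h x) = \<rho> (\<tau> \<otimes>\<^bsub>G\<^esub> a \<otimes>\<^bsub>G\<^esub> inv\<^bsub>G\<^esub> \<tau>) (\<rho> \<tau> x)" for x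
      using HG[OF a(1)] \<tau>(1) by (simp add: a(2) \<rho>_mult[symmetric])
    then show ?case using bspec[OF conj(1) a(1)] by (intro bexI[of _ "\<rho> (\<tau> \<otimes>\<^bsub>G\<^esub> a \<otimes>\<^bsub>G\<^esub> inv\<^bsub>G\<^esub> \<tau>)"]) simp_all
  next
    case (19 h)
    then obtain a where a: "a \<in> H" "h = \<rho> a" by (elim imageE)
    have "\<tau> \<otimes>\<^bsub>G\<^esub> (inv\<^bsub>G\<^esub> \<tau> \<otimes>\<^bsub>G\<^esub> a \<otimes>\<^bsub>G\<^esub> \<tau>) = a \<otimes>\<^bsub>G\<^esub> \<tau>"
      using HG[OF a(1)] \<tau>(1) by (simp add: m_assoc[symmetric])
    then have "h (\<rho> \<tau> x) = \<rho> \<tau> (\<rho> (inv\<^bsub>G\<^esub> \<tau> \<otimes>\<^bsub>G\<^esub> a \<otimes>\<^bsub>G\<^esub> \<tau>) x)" for x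
      using HG[OF a(1)] \<tau>(1) by (simp add: a(2) \<rho>_mult[symmetric])
    then show ?case using bspec[OF conj(2) a(1)] by (intro bexI[of _ "\<rho> (inv\<^bsub>G\<^esub> \<tau> \<otimes>\<^bsub>G\<^esub> a \<otimes>\<^bsub>G\<^esub> \<tau>)"]) simp_all
  next
    case (20 h x y) then show ?case by (elim imageE) (simp add: f_inv HG)
  next
    case (21 x y) show ?case by (rule f_inv[OF \<tau>(1)])
  next
    case 22
    have "int (d * e + 1) < int l" using assms(10) by (simp add: abs_ramification_index_def assms(6) e(1))
    then show ?case by (simp only: of_nat_less_iff)
  qed
  have "nondeg UNIV"
    unfolding nondeg_def stable_def using f(2) unfolding nondegenerate_form_def by (simp add: subspace_UNIV)
  then have "good UNIV" by (rule good_nondeg) (rule eq_refl[OF assms(8)])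
  then obtain T f' where T: "lattice UNIV T" "stable T" and f': "bil f'" "\<forall>x\<in>UNIV. f' x x = 0"
    "\<forall>h\<in>\<rho> ` H. \<forall>x\<in>UNIV. \<forall>y\<in>UNIV. f' (h x) (h y) = f' x y" "\<forall>x\<in>UNIV. \<forall>y\<in>UNIV. f' (\<rho> \<tau> x) (\<rho> \<tau> y) = f' x y"
    "\<forall>x\<in>T. \<forall>y\<in>T. f' x y \<in> \<O>" "\<forall>x\<in>UNIV. (\<forall>y\<in>T. f' x y \<in> \<O>) \<longrightarrow> x \<in> T"
    unfolding good_def by (elim exE conjE)
  have factor: "\<exists>h\<in>H. \<exists>j. \<forall>x. \<rho> g x = \<rho> h ((\<rho> \<tau> ^^ j) x)" if g: "g \<in> carrier G" for g
  proof -
    obtain i :: nat where i: "g \<otimes>\<^bsub>G\<^esub> \<tau> [^]\<^bsub>G\<^esub> i \<in> H" using bspec[OF gen g] by (elim exE)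
    \<comment> \<open>\<open>\<tau> [^] j\<close> is the inverse of \<open>\<tau> [^] i\<close>,
      written with a natural exponent so that it becomes an iterate of
      \<open>\<rho> \<tau>\<close>.\<close>
    define j where "j = (l ^ k - 1) * i"
    have "i + j = l ^ k * i" using prime_gt_0_nat[OF assms(3)] by (simp add: j_def diff_mult_distrib)
    then have "\<tau> [^]\<^bsub>G\<^esub> i \<otimes>\<^bsub>G\<^esub> \<tau> [^]\<^bsub>G\<^esub> j = \<one>\<^bsub>G\<^esub>"
      using \<tau> by (simp add: nat_pow_mult nat_pow_pow[symmetric])
    then have "g \<otimes>\<^bsub>G\<^esub> \<tau> [^]\<^bsub>G\<^esub> i \<otimes>\<^bsub>G\<^esub> \<tau> [^]\<^bsub>G\<^esub> j = g" using g \<tau>(1) by (simp add: m_assoc)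
    then have "\<rho> g x = \<rho> (g \<otimes>\<^bsub>G\<^esub> \<tau> [^]\<^bsub>G\<^esub> i) ((\<rho> \<tau> ^^ j) x)" for x
      using \<rho>_mult[OF HG[OF i] nat_pow_closed[OF \<tau>(1)], of j x] by (simp add: \<rho>_pow)
    then show ?thesis using i by (intro bexI[of _ "g \<otimes>\<^bsub>G\<^esub> \<tau> [^]\<^bsub>G\<^esub> i"] exI[of _ j] allI)
  qed
  have "stable_under G \<rho> T"
    unfolding stable_under_def
  proof (intro ballI)
    fix g x assume g: "g \<in> carrier G" and x: "x \<in> T"
    obtain h j where h: "h \<in> H" "\<forall>x. \<rho> g x = \<rho> h ((\<rho> \<tau> ^^ j) x)" using factor[OF g] by (elim bexE exE)
    have "(\<rho> \<tau> ^^ j) x \<in> T" using x T(2) by (induction j) (simp_all add: stable_def)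
    then show "\<rho> g x \<in> T" using T(2) h by (simp add: stable_def)
  qed
  moreover have "invariant_form_on G \<rho> T f'"
    unfolding invariant_form_on_def
  proof (intro ballI)
    fix g x y assume g: "g \<in> carrier G"
    obtain h j where h: "h \<in> H" "\<forall>x. \<rho> g x = \<rho> h ((\<rho> \<tau> ^^ j) x)" using factor[OF g] by (elim bexE exE)
    have "f' ((\<rho> \<tau> ^^ j) x) ((\<rho> \<tau> ^^ j) y) = f' x y" using f'(4) by (induction j) simp_all
    then show "f' (\<rho> g x) (\<rho> g y) = f' x y" using f'(3) h by simp
  qed
  moreover have "alternating_on T f'" using f'(2) by (simp add: alternating_on_def)
  moreover have "perfect_form_on v scale T f'"
    using f'(1,2,5,6) by (intro perfect_form_on_selfdual[OF T(1)]) (simp_all add: bil_def)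
  ultimately show ?thesis using val_lattice_lattice[OF T(1)] by (intro exI conjI)
qed

end
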